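(* Let $G$ be a finitely generated virtually solvable group and let $\varphi\colon G\to \mathrm{Homeo}_0(\mathbb{R})$ be an irreducible action. Then there exist an irreducible affine action $\psi\colon G\to \mathrm{Aff}(\mathbb{R})$, an interval $I$ of the form $(a,+\infty)$, and a non-decreasing map $h\colon I\to \mathbb{R}$ with $\lim_{x\to +\infty} h(x)=+\infty$, such that for every $g\in G$ we have \[\psi(g)(h(x))= h(\varphi(g)(x))\] for any sufficiently large $x\in \mathbb{R}$ (how large may depend on $g$). This action $\psi$ is unique up to affine conjugacy (that is, up to conjugation by an affine map).
   Context: A group is virtually solvable if it contains a solvable subgroup of finite index. $\mathrm{Homeo}_0(\mathbb{R})$ is the group of orientation-preserving homeomorphisms of $\mathbb{R}$. An action $\varphi\colon G\to\mathrm{Homeo}_0(\mathbb{R})$ (a homomorphism) is irreducible if it has no global fixed point in $\mathbb{R}$. $\mathrm{Aff}(\mathbb{R})=\{x\mapsto ax+b : a>0,\ b\in\mathbb{R}\}$, and an affine action is a homomorphism $\psi\colon G\to\mathrm{Aff}(\mathbb{R})$. *)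

theory Defs
  imports "HOL-Analysis.Analysis" "HOL-Algebra.Solvable_Groups"
begin

definition finitely_generated_group :: "('g, 'm) monoid_scheme \<Rightarrow> bool" where
  "finitely_generated_group G \<longleftrightarrow>
     (\<exists>S. finite S \<and> S \<subseteq> carrier G \<and> generate G S = carrier G)"

definition virtually_solvable :: "('g, 'm) monoid_scheme \<Rightarrow> bool" where
  "virtually_solvable G \<longleftrightarrow>
     (\<exists>H. subgroup H G \<and> finite (rcosets\<^bsub>G\<^esub> H) \<and> solvable (G\<lparr>carrier := H\<rparr>))"

definition Homeo0 :: "(real \<Rightarrow> real) monoid" where
  "Homeo0 = \<lparr>carrier = {f. (\<exists>f'. homeomorphism UNIV UNIV f f') \<and> strict_mono f},
             mult = (\<circ>), one = id\<rparr>"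

definition affine_maps :: "(real \<Rightarrow> real) set" where
  "affine_maps = {f. \<exists>a b. a > 0 \<and> f = (\<lambda>x. a * x + b)}"

definition Aff :: "(real \<Rightarrow> real) monoid" where
  "Aff = Homeo0\<lparr>carrier := affine_maps\<rparr>"

definition irreducible_action :: "('g, 'm) monoid_scheme \<Rightarrow> ('g \<Rightarrow> real \<Rightarrow> real) \<Rightarrow> bool" where
  "irreducible_action G \<phi> \<longleftrightarrow> \<not> (\<exists>x. \<forall>g\<in>carrier G. \<phi> g x = x)"

text \<open>
  The map \<open>h\<close> below is only relevant on the ray \<open>{a<..}\<close>; its values elsewhere are arbitrary.
  Since \<open>\<phi> g\<close> tends to infinity at infinity, both \<open>x\<close> and \<open>\<phi> g x\<close> lie in this ray for all
  sufficiently large \<open>x\<close>.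
\<close>

definition semiconjugate_near_infinity ::
    "('g, 'm) monoid_scheme \<Rightarrow> ('g \<Rightarrow> real \<Rightarrow> real) \<Rightarrow> ('g \<Rightarrow> real \<Rightarrow> real) \<Rightarrow> bool" where
  "semiconjugate_near_infinity G \<phi> \<psi> \<longleftrightarrow>
     (\<exists>(a::real) (h :: real \<Rightarrow> real).
        mono_on {a<..} h \<and> filterlim h at_top at_top \<and>
        (\<forall>g\<in>carrier G. \<forall>\<^sub>F x in at_top. \<psi> g (h x) = h (\<phi> g x)))"

definition affine_conjugate ::
    "('g, 'm) monoid_scheme \<Rightarrow> ('g \<Rightarrow> real \<Rightarrow> real) \<Rightarrow> ('g \<Rightarrow> real \<Rightarrow> real) \<Rightarrow> bool" where
  "affine_conjugate G \<psi> \<psi>' \<longleftrightarrow>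
     (\<exists>f\<in>carrier Aff. \<forall>g\<in>carrier G. \<psi>' g = f \<otimes>\<^bsub>Aff\<^esub> \<psi> g \<otimes>\<^bsub>Aff\<^esub> inv\<^bsub>Aff\<^esub> f)"

lemma group_Homeo0: "group Homeo0"
proof (rule groupI)
  fix f g assume "f \<in> carrier Homeo0" "g \<in> carrier Homeo0"
  then obtain f' g' where "homeomorphism UNIV UNIV f f'" "homeomorphism UNIV UNIV g g'"
    and mono: "strict_mono f" "strict_mono g"
    by (auto simp: Homeo0_def)
  then have "homeomorphism UNIV UNIV (f \<circ> g) (g' \<circ> f')"
    by (blast intro: homeomorphism_compose)
  then show "f \<otimes>\<^bsub>Homeo0\<^esub> g \<in> carrier Homeo0"
    using mono by (auto simp: Homeo0_def intro: strict_mono_o)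
next
  have "homeomorphism UNIV UNIV (id :: real \<Rightarrow> real) id"
    by (simp add: homeomorphism_def)
  then show "\<one>\<^bsub>Homeo0\<^esub> \<in> carrier Homeo0"
    by (auto simp: Homeo0_def strict_mono_def)
next
  fix f assume "f \<in> carrier Homeo0"
  then obtain f' where f': "homeomorphism UNIV UNIV f f'" and f: "strict_mono f"
    by (auto simp: Homeo0_def)
  have inv: "f (f' x) = x" "f' (f x) = x" for x
    using f' by (auto simp: homeomorphism_def)
  have "strict_mono f'"
  proof (rule strict_monoI)
    fix x y :: real assume "x < y"
    then show "f' x < f' y"
      using strict_mono_less[OF f, of "f' x" "f' y"] inv(1) by simp
  qed
  moreover have "homeomorphism UNIV UNIV f' f"
    using f' by (rule homeomorphism_symD)
  ultimately show "\<exists>g\<in>carrier Homeo0. g \<otimes>\<^bsub>Homeo0\<^esub> f = \<one>\<^bsub>Homeo0\<^esub>"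
    using inv by (intro bexI[of _ f']) (auto simp: Homeo0_def)
qed (auto simp: Homeo0_def)

lemma affine_inverse_in_affine_maps:
  fixes a b :: real
  assumes "a > 0"
  shows "(\<lambda>x. (x - b) / a) \<in> affine_maps"
proof -
  have "(\<lambda>x. (x - b) / a) = (\<lambda>x. (1 / a) * x + (- b / a))"
    by (simp add: fun_eq_iff diff_divide_distrib)
  moreover have "1 / a > 0"
    using assms by simp
  ultimately show ?thesis
    unfolding affine_maps_def by blast
qed

lemma affine_maps_subset_Homeo0: "affine_maps \<subseteq> carrier Homeo0"
proof
  fix f assume "f \<in> affine_maps"
  then obtain a b where ab: "a > 0" "f = (\<lambda>x. a * x + b)"
    by (auto simp: affine_maps_def)
  have "homeomorphism UNIV UNIV f (\<lambda>x. (x - b) / a)"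
    using ab by (intro homeomorphismI) (auto intro!: continuous_intros)
  moreover have "strict_mono f"
    using ab by (auto simp: strict_mono_def)
  ultimately show "f \<in> carrier Homeo0"
    by (auto simp: Homeo0_def)
qed

lemma subgroup_Aff: "subgroup affine_maps Homeo0"
proof (rule group.subgroupI[OF group_Homeo0 affine_maps_subset_Homeo0])
  show "affine_maps \<noteq> {}"
    using affine_inverse_in_affine_maps[of 1 0] by auto
next
  fix f assume f_in: "f \<in> affine_maps"
  then obtain a b where ab: "a > 0" "f = (\<lambda>x. a * x + b)"
    by (auto simp: affine_maps_def)
  have "inv\<^bsub>Homeo0\<^esub> f = (\<lambda>x. (x - b) / a)"
  proof (rule group.inv_equality[OF group_Homeo0])
    show "(\<lambda>x. (x - b) / a) \<otimes>\<^bsub>Homeo0\<^esub> f = \<one>\<^bsub>Homeo0\<^esub>"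
      using ab by (auto simp: Homeo0_def)
  qed (use f_in affine_inverse_in_affine_maps[OF ab(1)] affine_maps_subset_Homeo0 in auto)
  then show "inv\<^bsub>Homeo0\<^esub> f \<in> affine_maps"
    using affine_inverse_in_affine_maps[OF ab(1)] by simp
next
  fix f g assume "f \<in> affine_maps" "g \<in> affine_maps"
  then obtain a b c d where *: "a > 0" "f = (\<lambda>x. a * x + b)" "c > 0" "g = (\<lambda>x. c * x + d)"
    by (auto simp: affine_maps_def)
  then have "f \<otimes>\<^bsub>Homeo0\<^esub> g = (\<lambda>x. (a * c) * x + (a * d + b))"
    by (simp add: Homeo0_def fun_eq_iff algebra_simps)
  moreover have "a * c > 0"
    using * by simp
  ultimately show "f \<otimes>\<^bsub>Homeo0\<^esub> g \<in> affine_maps"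
    unfolding affine_maps_def by blast
qed

lemma group_Aff: "group Aff"
  unfolding Aff_def by (rule group.subgroup_imp_group[OF group_Homeo0 subgroup_Aff])

end

theory Submission
  imports Defs
begin

text \<open>
  \<^bold>\<open>Existence.\<close> Only the behaviour of \<open>\<phi>\<close> near \<open>+\<infinity>\<close> matters, and it is recorded by the
  left-invariant preorder \<open>g \<preceq> k \<longleftrightarrow> \<phi> g 0 \<le> \<phi> k 0\<close> on \<open>G\<close>. The proof simplifies this preorder
  step by step, and the simplified preorders are no longer total: they are left-invariant and
  directed, and all up-sets \<open>{x. z \<preceq> x}\<close> are totally preordered (\<open>tree_order\<close>). Such a preorder
  is pictured as an orbit of vertices in a tree on which \<open>G\<close> acts fixing one end; ``near
  infinity'' means near that end. The property \<open>has_affine_height\<close> asks for a real function that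
  is monotone and unbounded near the end, and on which each group element acts, close enough to
  the end, through an irreducible affine action. For the preorder of \<open>\<phi>\<close>, infima over orbit points
  turn such a function into the required \<open>h\<close>.

  A finite-index normal solvable subgroup and its derived series give normal subgroups
  \<open>{\<one>} = N 0 \<subseteq> \<dots> \<subseteq> N k\<close> of \<open>G\<close> with abelian successive quotients and \<open>N k\<close> of finite index. Let
  \<open>N i\<close> act trivially on a tree. As \<open>N k\<close> cannot act trivially, \<open>i < k\<close>, and \<open>A = N (i + 1)\<close> acts
  by commuting maps. There are three cases.

  \<^item> \<^emph>\<open>Some \<open>f\<close> in \<open>A\<close> has powers that tend to the end.\<close> Then \<open>A\<close> is preordered like an Archimedean
    group, so there is a translation number \<open>tau\<close> on \<open>A\<close> with \<open>tau f = 1\<close>, and conjugation by \<open>g\<close>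
    multiplies it by a constant \<open>multiplier g\<close>. The height of \<open>x\<close> is the supremum of \<open>tau a\<close> over
    \<open>a \<preceq> x\<close>. If some multiplier differs from 1, then \<open>tau\<close> has dense image, the height is determined
    up to a constant by monotonicity and equivariance under \<open>A\<close>, and \<open>G\<close> must act on it by affine
    maps. If all multipliers are 1, the orbits of the kernel of \<open>tau\<close> can be collapsed; commutators
    of \<open>N (i + 2)\<close> lie in that kernel, so the situation repeats with \<open>N (i + 2)\<close> and the same \<open>f\<close>.
    At the top of the series an average over the finitely many cosets of \<open>N k\<close> finishes the proof.

  \<^item> \<^emph>\<open>\<open>A\<close> is not cofinal in the tree.\<close> Collapsing the orbits of \<open>A\<close> gives a tree on which \<open>A\<close> acts
    trivially.

  \<^item> \<^emph>\<open>\<open>A\<close> is cofinal, but the powers of each of its elements stay away from the end.\<close> Because \<open>A\<close>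
    commutes, the convex hulls of its cyclic orbits are nested as soon as they meet, and a hull
    that meets one of its translates under \<open>A\<close> equals it. Hulls ordered by inclusion, up to \<open>A\<close>, therefore form a
    tree on which \<open>A\<close> acts trivially. Finite generation ensures that the translates of a single
    hull are cofinal: it suffices that this hull contains a finite generating set.

  In the last two cases one continues with \<open>N (i + 1)\<close>; a height on the new tree gives one on the
  old tree.

  \<^bold>\<open>Uniqueness.\<close> Whether \<open>\<psi> g\<close> pushes points near \<open>+\<infinity>\<close> upwards can be read off from \<open>\<phi>\<close>, so two
  solutions \<open>\<psi>\<close> and \<open>\<psi>'\<close> induce the same order at infinity on \<open>G\<close>. That order determines the
  translations in the image up to a positive factor, conjugation of translations determines the
  dilation factors, and commutators determine the remaining constants up to an affine change of
  coordinate.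
\<close>

section \<open>Heights on preordered sets\<close>

text \<open>
  The set \<open>X\<close> with the preorder \<open>prec\<close> is the real line at one end of the argument and the group
  itself at the other; a property holds near infinity if it holds above some element of \<open>X\<close>.
\<close>

definition affine_height ::
    "('g, 'm) monoid_scheme \<Rightarrow> 'x set \<Rightarrow> ('x \<Rightarrow> 'x \<Rightarrow> bool) \<Rightarrow> ('g \<Rightarrow> 'x \<Rightarrow> 'x) \<Rightarrow>
     ('g \<Rightarrow> real \<Rightarrow> real) \<Rightarrow> ('x \<Rightarrow> real) \<Rightarrow> bool" where
  "affine_height G X prec act \<psi> h \<longleftrightarrow>
     (\<exists>t\<in>X. \<forall>x\<in>X. \<forall>y\<in>X. prec t x \<longrightarrow> prec x y \<longrightarrow> h x \<le> h y) \<and>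
     (\<forall>M. \<exists>t\<in>X. \<forall>x\<in>X. prec t x \<longrightarrow> M \<le> h x) \<and>
     (\<forall>k\<in>carrier G. \<exists>t\<in>X. \<forall>x\<in>X. prec t x \<longrightarrow> h (act k x) = \<psi> k (h x))"

definition has_affine_height :: "('g, 'm) monoid_scheme \<Rightarrow> ('g \<Rightarrow> 'g \<Rightarrow> bool) \<Rightarrow> bool" where
  "has_affine_height G prec \<longleftrightarrow>
     (\<exists>\<psi> h. \<psi> \<in> hom G Aff \<and> irreducible_action G \<psi> \<and>
        affine_height G (carrier G) prec (\<lambda>g x. g \<otimes>\<^bsub>G\<^esub> x) \<psi> h)"

lemma Aff_carrier: "f \<in> carrier Aff \<longleftrightarrow> (\<exists>a b. a > 0 \<and> f = (\<lambda>x. a * x + b))"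
  by (simp add: Aff_def affine_maps_def)

lemma Aff_mult: "f \<otimes>\<^bsub>Aff\<^esub> g = f \<circ> g"
  by (simp add: Aff_def Homeo0_def)

lemma Aff_one: "\<one>\<^bsub>Aff\<^esub> = id"
  by (simp add: Aff_def Homeo0_def)

lemma Homeo0_mult: "f \<otimes>\<^bsub>Homeo0\<^esub> g = f \<circ> g"
  by (simp add: Homeo0_def)

lemma (in group) inv_mult_cancel [simp]:
  assumes "x \<in> carrier G" "y \<in> carrier G"
  shows "inv x \<otimes> (x \<otimes> y) = y" "x \<otimes> (inv x \<otimes> y) = y"
  using assms by (simp_all add: m_assoc [symmetric])

text \<open>
  Together with the cancellation rules above, these equations rewrite group words to their
  freely reduced form.
\<close>

lemmas (in group) group_normalize = m_assoc inv_mult_group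

lemma (in group) conj_nat_pow:
  assumes "g \<in> carrier G" "x \<in> carrier G"
  shows "(g \<otimes> x \<otimes> inv g) [^] (n::nat) = g \<otimes> x [^] n \<otimes> inv g"
proof (induction n)
  case (Suc n)
  then show ?case using assms by (simp add: group_normalize)
qed (use assms in simp)

section \<open>Left-invariant tree preorders\<close>

text \<open>
  Two elements have a common upper bound, but they may be incomparable when they have no common
  lower bound, as for points on different branches of a tree that merge higher up.
\<close>

locale tree_order = group G for G (structure) +
  fixes prec :: "'a \<Rightarrow> 'a \<Rightarrow> bool" (infix "\<preceq>" 50)
  assumes le_carrier: "x \<preceq> y \<Longrightarrow> x \<in> carrier G \<and> y \<in> carrier G"
    and le_refl: "x \<in> carrier G \<Longrightarrow> x \<preceq> x"
    and le_trans [trans]: "x \<preceq> y \<Longrightarrow> y \<preceq> z \<Longrightarrow> x \<preceq> z"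
    and le_left: "g \<in> carrier G \<Longrightarrow> x \<preceq> y \<Longrightarrow> g \<otimes> x \<preceq> g \<otimes> y"
    and comparable: "z \<preceq> x \<Longrightarrow> z \<preceq> y \<Longrightarrow> x \<preceq> y \<or> y \<preceq> x"
    and directed: "x \<in> carrier G \<Longrightarrow> y \<in> carrier G \<Longrightarrow> \<exists>z. x \<preceq> z \<and> y \<preceq> z"
    and nontrivial: "\<exists>x\<in>carrier G. \<exists>y\<in>carrier G. \<not> x \<preceq> y"
begin

lemma le_left_iff:
  assumes "g \<in> carrier G" "x \<in> carrier G" "y \<in> carrier G"
  shows "g \<otimes> x \<preceq> g \<otimes> y \<longleftrightarrow> x \<preceq> y"
  using le_left[of g x y] le_left[of "inv g" "g \<otimes> x" "g \<otimes> y"] assms by auto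

lemma le_inv_left:
  assumes "g \<in> carrier G" "x \<in> carrier G" "y \<in> carrier G"
  shows "inv g \<otimes> x \<preceq> y \<longleftrightarrow> x \<preceq> g \<otimes> y"
  using le_left_iff[of g "inv g \<otimes> x" y] assms by simp

lemma le_inv_right:
  assumes "g \<in> carrier G" "x \<in> carrier G" "y \<in> carrier G"
  shows "x \<preceq> inv g \<otimes> y \<longleftrightarrow> g \<otimes> x \<preceq> y"
  using le_left_iff[of g x "inv g \<otimes> y"] assms by simp

text \<open>
  A greatest element could be moved to any other place by left translation, which would make all
  elements equivalent.
\<close>

lemma unbounded: "\<exists>z\<in>carrier G. \<not> z \<preceq> w"
proof (rule ccontr)
  assume *: "\<not> ?thesis"
  obtain x y where xy: "x \<in> carrier G" "y \<in> carrier G" "\<not> x \<preceq> y"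
    using nontrivial by blast
  have w: "w \<in> carrier G" using * le_carrier one_closed by blast
  have "w \<otimes> inv y \<otimes> x \<preceq> w" using * xy w by simp
  then have "(y \<otimes> inv w) \<otimes> (w \<otimes> inv y \<otimes> x) \<preceq> (y \<otimes> inv w) \<otimes> w"
    using xy w by (intro le_left) auto
  then show False using xy w by (simp add: group_normalize)
qed

lemma finite_upper_bound:
  assumes "finite F" "F \<subseteq> carrier G"
  shows "\<exists>w\<in>carrier G. \<forall>x\<in>F. x \<preceq> w"
  using assms
proof induction
  case (insert x F)
  then obtain w where w: "w \<in> carrier G" "\<forall>y\<in>F. y \<preceq> w" by auto
  obtain z where "x \<preceq> z" "w \<preceq> z" using directed[of x w] insert w by auto
  then show ?case using w le_trans le_carrier by blast
qed auto

definition eventually_above :: "('a \<Rightarrow> bool) \<Rightarrow> bool" where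
  "eventually_above Q \<longleftrightarrow> (\<exists>t\<in>carrier G. \<forall>x. t \<preceq> x \<longrightarrow> Q x)"

lemma eventually_above_ge: "t \<in> carrier G \<Longrightarrow> eventually_above (\<lambda>x. t \<preceq> x)"
  unfolding eventually_above_def by blast

lemma eventually_above_conj:
  assumes "eventually_above P" "eventually_above Q" shows "eventually_above (\<lambda>x. P x \<and> Q x)"
proof -
  obtain s t where st: "s \<in> carrier G" "t \<in> carrier G" "\<And>x. s \<preceq> x \<Longrightarrow> P x" "\<And>x. t \<preceq> x \<Longrightarrow> Q x"
    using assms unfolding eventually_above_def by blast
  obtain u where "s \<preceq> u" "t \<preceq> u" using directed st by blast
  then show ?thesis unfolding eventually_above_def using st le_trans le_carrier by blast
qed

lemma eventually_above_mono:
  assumes "eventually_above P" "\<And>x. x \<in> carrier G \<Longrightarrow> P x \<Longrightarrow> Q x" shows "eventually_above Q"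
  using assms le_carrier unfolding eventually_above_def by blast

lemma eventually_above_ex: "eventually_above P \<Longrightarrow> \<exists>x\<in>carrier G. P x"
  using le_refl unfolding eventually_above_def by blast

lemma eventually_above_shift:
  assumes "k \<in> carrier G" "eventually_above P" shows "eventually_above (\<lambda>x. P (k \<otimes> x))"
proof -
  obtain t where t: "t \<in> carrier G" "\<And>x. t \<preceq> x \<Longrightarrow> P x"
    using assms unfolding eventually_above_def by blast
  have "P (k \<otimes> x)" if "inv k \<otimes> t \<preceq> x" for x
    using that t assms le_inv_left[of k t x] le_carrier by blast
  then show ?thesis unfolding eventually_above_def using t assms by (intro bexI[of _ "inv k \<otimes> t"]) auto
qed

text \<open>
  The translation part of the affine action need not be given: the cocycle relation for \<open>b\<close>
  follows by evaluating \<open>h\<close> at a single point that is high enough. The element \<open>f\<close> translates by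
  \<open>d \<noteq> 0\<close>, which makes the action irreducible.
\<close>

lemma has_affine_heightI:
  fixes h :: "'a \<Rightarrow> real" and multiplier :: "'a \<Rightarrow> real"
  assumes multiplier_pos: "\<And>g. g \<in> carrier G \<Longrightarrow> multiplier g > 0"
    and multiplier_mult: "\<And>g k. g \<in> carrier G \<Longrightarrow> k \<in> carrier G \<Longrightarrow> multiplier (g \<otimes> k) = multiplier g * multiplier k"
    and t0: "t0 \<in> carrier G" and mono: "\<And>x y. t0 \<preceq> x \<Longrightarrow> x \<preceq> y \<Longrightarrow> h x \<le> h y"
    and unb: "\<And>M. eventually_above (\<lambda>x. M \<le> h x)"
    and cocycle: "\<And>g. g \<in> carrier G \<Longrightarrow> \<exists>b. eventually_above (\<lambda>x. h (g \<otimes> x) = multiplier g * h x + b)"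
    and f: "f \<in> carrier G" "multiplier f = 1" and shift: "eventually_above (\<lambda>x. h (f \<otimes> x) = h x + d)" and d: "d \<noteq> 0"
  shows "has_affine_height G prec"
proof -
  obtain beta where beta: "\<And>g. g \<in> carrier G \<Longrightarrow> eventually_above (\<lambda>x. h (g \<otimes> x) = multiplier g * h x + beta g)"
    using cocycle by metis
  define \<psi> where "\<psi> g = (\<lambda>t. multiplier g * t + beta g)" for g
  have beta_mult: "beta (g \<otimes> k) = multiplier g * beta k + beta g" if gk: "g \<in> carrier G" "k \<in> carrier G" for g k
  proof -
    have "eventually_above (\<lambda>x. h (g \<otimes> k \<otimes> x) = multiplier (g \<otimes> k) * h x + beta (g \<otimes> k) \<and>
      h (k \<otimes> x) = multiplier k * h x + beta k \<and> h (g \<otimes> (k \<otimes> x)) = multiplier g * h (k \<otimes> x) + beta g)"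
      using gk by (intro eventually_above_conj beta eventually_above_shift[where P = "\<lambda>y. h (g \<otimes> y) = multiplier g * h y + beta g"]) auto
    then obtain x where "x \<in> carrier G" "h (g \<otimes> k \<otimes> x) = multiplier (g \<otimes> k) * h x + beta (g \<otimes> k)"
      "h (k \<otimes> x) = multiplier k * h x + beta k" "h (g \<otimes> (k \<otimes> x)) = multiplier g * h (k \<otimes> x) + beta g"
      using eventually_above_ex by blast
    then show ?thesis using gk multiplier_mult by (simp add: m_assoc algebra_simps)
  qed
  have "\<psi> \<in> hom G Aff"
  proof (rule homI)
    show "\<psi> g \<in> carrier Aff" if "g \<in> carrier G" for g
      unfolding Aff_carrier \<psi>_def using multiplier_pos[OF that] by blast
    show "\<psi> (g \<otimes> k) = \<psi> g \<otimes>\<^bsub>Aff\<^esub> \<psi> k" if "g \<in> carrier G" "k \<in> carrier G" for g k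
      using multiplier_mult[OF that] beta_mult[OF that]
      by (simp add: Aff_mult \<psi>_def fun_eq_iff algebra_simps)
  qed
  moreover have "irreducible_action G \<psi>"
  proof -
    have "eventually_above (\<lambda>x. h (f \<otimes> x) = h x + d \<and> h (f \<otimes> x) = multiplier f * h x + beta f)"
      by (intro eventually_above_conj shift beta f)
    then have "beta f = d" using f eventually_above_ex by fastforce
    then have "\<psi> f x \<noteq> x" for x using f d by (simp add: \<psi>_def)
    then show ?thesis unfolding irreducible_action_def using f by blast
  qed
  moreover have "affine_height G (carrier G) prec (\<lambda>g x. g \<otimes> x) \<psi> h"
    unfolding affine_height_def
  proof (intro conjI allI ballI)
    show "\<exists>t\<in>carrier G. \<forall>x\<in>carrier G. \<forall>y\<in>carrier G. t \<preceq> x \<longrightarrow> x \<preceq> y \<longrightarrow> h x \<le> h y"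
      using t0 mono by blast
    show "\<exists>t\<in>carrier G. \<forall>x\<in>carrier G. t \<preceq> x \<longrightarrow> M \<le> h x" for M
      using unb[of M] unfolding eventually_above_def by blast
    show "\<exists>t\<in>carrier G. \<forall>x\<in>carrier G. t \<preceq> x \<longrightarrow> h (k \<otimes> x) = \<psi> k (h x)" if "k \<in> carrier G" for k
      using beta[OF that] unfolding eventually_above_def \<psi>_def by blast
  qed
  ultimately show ?thesis unfolding has_affine_height_def by blast
qed

text \<open>
  Since \<open>a\<close> and \<open>b\<close> may be exchanged, the two sides are in fact equivalent for \<open>\<preceq>\<close>: this says that
  the elements of \<open>A\<close> commute as maps of the tree.
\<close>

definition commutes_on :: "'a set \<Rightarrow> bool" where
  "commutes_on A \<longleftrightarrow> (\<forall>a\<in>A. \<forall>b\<in>A. \<forall>x\<in>carrier G. a \<otimes> (b \<otimes> x) \<preceq> b \<otimes> (a \<otimes> x))"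

text \<open>
  For a normal subgroup this condition at the base point \<open>\<one>\<close> already implies that each \<open>n \<otimes> x\<close> is
  equivalent to \<open>x\<close>, by conjugation and inversion.
\<close>

definition acts_trivially :: "'a set \<Rightarrow> bool" where
  "acts_trivially N \<longleftrightarrow> (\<forall>n\<in>N. \<one> \<preceq> n)"

lemma acts_triviallyD:
  assumes "acts_trivially N" "N \<lhd> G" "n \<in> N" "x \<in> carrier G"
  shows "x \<preceq> n \<otimes> x" "n \<otimes> x \<preceq> x"
proof -
  interpret N: normal N G by (rule assms)
  have *: "y \<preceq> m \<otimes> y" if "m \<in> N" "y \<in> carrier G" for m y
  proof -
    have "inv y \<otimes> m \<otimes> y \<in> N" using N.inv_op_closed1 that by blast
    then have "\<one> \<preceq> inv y \<otimes> m \<otimes> y" using assms(1) acts_trivially_def by blast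
    then have "y \<otimes> \<one> \<preceq> y \<otimes> (inv y \<otimes> m \<otimes> y)" using that by (intro le_left)
    then show ?thesis using that by (simp add: group_normalize)
  qed
  show "x \<preceq> n \<otimes> x" using * assms by blast
  show "n \<otimes> x \<preceq> x" using *[of "inv n" "n \<otimes> x"] assms by auto
qed

lemma commutes_onI:
  assumes "acts_trivially N" "N \<lhd> G" "A \<subseteq> carrier G"
    and "\<And>a b. a \<in> A \<Longrightarrow> b \<in> A \<Longrightarrow> a \<otimes> b \<otimes> inv a \<otimes> inv b \<in> N"
  shows "commutes_on A"
  unfolding commutes_on_def
proof (intro ballI)
  fix a b x assume *: "a \<in> A" "b \<in> A" "x \<in> carrier G"
  then have in_G: "a \<in> carrier G" "b \<in> carrier G" using assms by auto
  have "(a \<otimes> b \<otimes> inv a \<otimes> inv b) \<otimes> (b \<otimes> (a \<otimes> x)) \<preceq> b \<otimes> (a \<otimes> x)"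
    using assms * in_G by (intro acts_triviallyD(2)) auto
  then show "a \<otimes> (b \<otimes> x) \<preceq> b \<otimes> (a \<otimes> x)" using * in_G by (simp add: group_normalize)
qed

section \<open>Collapsing the orbits of a normal subgroup\<close>

definition le_mod :: "'a set \<Rightarrow> 'a \<Rightarrow> 'a \<Rightarrow> bool" where
  "le_mod A x y \<longleftrightarrow> x \<in> carrier G \<and> (\<exists>c\<in>A. c \<otimes> x \<preceq> y)"

lemma le_imp_le_mod:
  assumes "A \<lhd> G" "x \<preceq> y" shows "le_mod A x y"
proof -
  interpret A: normal A G by fact
  show ?thesis unfolding le_mod_def using assms le_carrier[of x y] by (auto intro!: bexI[of _ \<one>])
qed

text \<open>
  Translating by \<open>A\<close> on the left only conjugates its elements, so the quotient preorder stays left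
  invariant. It is nontrivial because \<open>z\<close> lies below \<open>\<one>\<close> up to \<open>A\<close> only if \<open>z\<close> lies below some
  element of \<open>A\<close>.
\<close>

lemma tree_order_le_mod:
  assumes "A \<lhd> G" and not_cofinal: "\<exists>z\<in>carrier G. \<forall>c\<in>A. \<not> z \<preceq> c"
  shows "tree_order G (le_mod A)"
proof -
  interpret A: normal A G by fact
  show ?thesis
  proof (unfold_locales, goal_cases)
    case (1 x y)
    then show ?case unfolding le_mod_def using le_carrier by blast
  next
    case (2 x)
    then show ?case using le_imp_le_mod[OF assms(1)] le_refl by blast
  next
    case (3 x y z)
    then obtain c d where cd: "c \<in> A" "d \<in> A" "c \<otimes> x \<preceq> y" "d \<otimes> y \<preceq> z" "x \<in> carrier G"
      unfolding le_mod_def by blast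
    have "d \<otimes> (c \<otimes> x) \<preceq> d \<otimes> y" using cd le_left by auto
    then have "d \<otimes> c \<otimes> x \<preceq> z" using cd le_trans by (simp add: m_assoc) 
    then show ?case unfolding le_mod_def using cd by blast
  next
    case (4 g x y)
    then obtain c where c: "c \<in> A" "c \<otimes> x \<preceq> y" "x \<in> carrier G" unfolding le_mod_def by blast
    have "(g \<otimes> c \<otimes> inv g) \<otimes> (g \<otimes> x) = g \<otimes> (c \<otimes> x)" using c 4 by (simp add: group_normalize)
    then have "(g \<otimes> c \<otimes> inv g) \<otimes> (g \<otimes> x) \<preceq> g \<otimes> y" using c 4 le_left by simp
    then show ?case unfolding le_mod_def using A.inv_op_closed2[of g c] c 4 by blast
  next
    case (5 z x y)
    then obtain c d where cd: "c \<in> A" "d \<in> A" "c \<otimes> z \<preceq> x" "d \<otimes> z \<preceq> y" "z \<in> carrier G"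
      unfolding le_mod_def by blast
    then have xy: "x \<in> carrier G" "y \<in> carrier G" using le_carrier by blast+
    have "(c \<otimes> inv d) \<otimes> (d \<otimes> z) \<preceq> (c \<otimes> inv d) \<otimes> y" using cd by (intro le_left) auto
    then have "c \<otimes> z \<preceq> (c \<otimes> inv d) \<otimes> y" using cd by (simp add: group_normalize)
    then have "x \<preceq> (c \<otimes> inv d) \<otimes> y \<or> (c \<otimes> inv d) \<otimes> y \<preceq> x" using comparable cd by blast
    then have "inv (c \<otimes> inv d) \<otimes> x \<preceq> y \<or> (c \<otimes> inv d) \<otimes> y \<preceq> x" using le_inv_left xy cd by auto
    then show ?case unfolding le_mod_def using cd xy by blast
  next
    case (6 x y)
    then show ?case using directed[of x y] le_imp_le_mod[OF assms(1)] by blast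
  next
    case 7
    obtain z where z: "z \<in> carrier G" "\<And>c. c \<in> A \<Longrightarrow> \<not> z \<preceq> c" using not_cofinal by blast
    have "\<not> le_mod A z \<one>"
    proof
      assume "le_mod A z \<one>"
      then obtain c where c: "c \<in> A" "c \<otimes> z \<preceq> \<one>" unfolding le_mod_def by blast
      then have "z \<preceq> inv c" using le_inv_right[of c z \<one>] z by simp
      then show False using c z by blast
    qed
    then show ?case using z by blast
  qed
qed

lemma affine_height_le_mod:
  assumes "A \<lhd> G" "has_affine_height G (le_mod A)"
  shows "has_affine_height G prec"
proof -
  obtain \<psi> h where *: "\<psi> \<in> hom G Aff" "irreducible_action G \<psi>"
    "affine_height G (carrier G) (le_mod A) (\<lambda>g x. g \<otimes> x) \<psi> h"
    using assms(2) has_affine_height_def by blast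
  have "affine_height G (carrier G) prec (\<lambda>g x. g \<otimes> x) \<psi> h"
    using *(3) le_imp_le_mod[OF assms(1)] unfolding affine_height_def by meson
  then show ?thesis using * has_affine_height_def by blast
qed

lemma acts_trivially_le_mod:
  assumes "A \<lhd> G" and t: "tree_order G (le_mod A)" shows "tree_order.acts_trivially G (le_mod A) A"
proof -
  interpret A: normal A G by fact
  interpret T: tree_order G "le_mod A" by fact
  show ?thesis unfolding T.acts_trivially_def
  proof
    fix a assume a: "a \<in> A"
    then have "a \<otimes> \<one> \<preceq> a" using le_refl by simp
    then show "le_mod A \<one> a" unfolding le_mod_def using a by blast
  qed
qed

end

section \<open>Translation numbers\<close>

text \<open>
  The element \<open>f\<close> acts like a hyperbolic isometry whose axis runs to the fixed end of the tree.
\<close>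

locale hyperbolic_tree_order = tree_order G prec
  for G (structure) and prec (infix "\<preceq>" 50) +
  fixes A f
  assumes A_normal: "A \<lhd> G" and A_commutes: "commutes_on A" and f_in: "f \<in> A"
    and one_le_f: "\<one> \<preceq> f" and f_cofinal: "z \<in> carrier G \<Longrightarrow> \<exists>k::nat. z \<preceq> f [^] k"
begin

sublocale A: normal A G by (rule A_normal)

lemma A_pow_closed [simp]: "a \<in> A \<Longrightarrow> a [^] (n::nat) \<in> A"
  by (induction n) auto

lemma A_int_pow_closed [simp]: "a \<in> A \<Longrightarrow> a [^] (n::int) \<in> A"
  by (cases n rule: int_cases2) (simp_all add: int_pow_neg_int int_pow_int)

lemma A_conj [simp]: "g \<in> carrier G \<Longrightarrow> a \<in> A \<Longrightarrow> g \<otimes> a \<otimes> inv g \<in> A"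
  by (rule A.inv_op_closed2)

lemma swap: "a \<in> A \<Longrightarrow> b \<in> A \<Longrightarrow> x \<in> carrier G \<Longrightarrow> a \<otimes> (b \<otimes> x) \<preceq> b \<otimes> (a \<otimes> x)"
  using A_commutes commutes_on_def by blast

lemma swap_one: "a \<in> A \<Longrightarrow> b \<in> A \<Longrightarrow> a \<otimes> b \<preceq> b \<otimes> a"
  using swap[of a b \<one>] by simp

text \<open>
  Commutation makes the preorder on \<open>A\<close> invariant on both sides.
\<close>

lemma A_right_mono:
  assumes "a \<in> A" "b \<in> A" "c \<in> A" "a \<preceq> b" shows "a \<otimes> c \<preceq> b \<otimes> c"
proof -
  have "a \<otimes> c \<preceq> c \<otimes> a" using assms swap_one by blast
  also have "\<dots> \<preceq> c \<otimes> b" using assms by (intro le_left) auto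
  also have "\<dots> \<preceq> b \<otimes> c" using assms swap_one by blast
  finally show ?thesis .
qed

lemma A_mult_mono:
  assumes "a \<in> A" "b \<in> A" "c \<in> A" "d \<in> A" "a \<preceq> b" "c \<preceq> d" shows "a \<otimes> c \<preceq> b \<otimes> d"
proof -
  have "a \<otimes> c \<preceq> b \<otimes> c" using assms A_right_mono by blast
  also have "\<dots> \<preceq> b \<otimes> d" using assms by (intro le_left) auto
  finally show ?thesis .
qed

lemma A_inv_mono:
  assumes "a \<in> A" "b \<in> A" "a \<preceq> b" shows "inv b \<preceq> inv a"
proof -
  have "inv a \<otimes> a \<preceq> inv a \<otimes> b" using assms by (intro le_left) auto
  then have "(inv a \<otimes> a) \<otimes> inv b \<preceq> (inv a \<otimes> b) \<otimes> inv b" using assms by (intro A_right_mono) auto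
  then show ?thesis using assms by (simp add: group_normalize)
qed

lemma A_pow_mono:
  assumes "a \<in> A" "b \<in> A" "a \<preceq> b" shows "a [^] (n::nat) \<preceq> b [^] n"
proof (induction n)
  case 0
  show ?case using le_refl by simp
next
  case (Suc n)
  then show ?case using assms by (simp add: A_mult_mono)
qed

lemma f_pow_mono_nat: "m \<le> n \<Longrightarrow> f [^] m \<preceq> f [^] (n::nat)"
proof (induction n)
  case (Suc n)
  have "f [^] n \<otimes> \<one> \<preceq> f [^] n \<otimes> f" using f_in one_le_f by (intro le_left) auto
  then have "f [^] n \<preceq> f [^] Suc n" using f_in by simp
  then show ?case using Suc le_trans[of "f [^] m" "f [^] n" "f [^] Suc n"] le_refl[of "f [^] m"] f_in
    by (auto simp: le_Suc_eq)
qed (use le_refl in simp)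

lemma f_not_le_one: "\<not> f \<preceq> \<one>"
proof
  assume "f \<preceq> \<one>"
  then have "f [^] n \<preceq> \<one>" for n :: nat using A_pow_mono[of f \<one> n] f_in by simp
  then show False using unbounded[of \<one>] f_cofinal le_trans by blast
qed

lemma f_pow_le_iff: "f [^] (p::int) \<preceq> f [^] (q::int) \<longleftrightarrow> p \<le> q"
proof -
  have mono: "f [^] p \<preceq> f [^] q" if "p \<le> q" for p q :: int
  proof -
    have "\<one> \<preceq> f [^] nat (q - p)" using f_pow_mono_nat[of 0 "nat (q - p)"] by simp
    then have "f [^] p \<otimes> \<one> \<preceq> f [^] p \<otimes> f [^] nat (q - p)" using f_in by (intro le_left) auto
    also have "f [^] nat (q - p) = f [^] (q - p)" using that by (simp add: pow_nat)
    finally show ?thesis using f_in int_pow_mult[of f p "q - p"] by simp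
  qed
  have False if "q < p" "f [^] p \<preceq> f [^] q"
  proof -
    have "f [^] (-q) \<otimes> f [^] p \<preceq> f [^] (-q) \<otimes> f [^] q" using that f_in by (intro le_left) auto
    then have "f [^] (p - q) \<preceq> f [^] (0::int)" using f_in by (simp add: int_pow_mult [symmetric])
    moreover have "f [^] (1::int) \<preceq> f [^] (p - q)" using that by (intro mono) auto
    ultimately show False using f_not_le_one f_in le_trans by fastforce
  qed
  then show ?thesis using mono by force
qed

lemma A_bounds:
  assumes "a \<in> A"
  shows "\<exists>k::nat. a \<preceq> f [^] int k \<and> f [^] (- int k) \<preceq> a"
proof -
  obtain i j :: nat where ij: "a \<preceq> f [^] i" "inv a \<preceq> f [^] j" using f_cofinal assms A.mem_carrier by (meson inv_closed)
  have "inv (f [^] j) \<preceq> inv (inv a)" using ij assms f_in by (intro A_inv_mono) auto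
  then have j: "f [^] (- int j) \<preceq> a" using assms f_in by (simp add: int_pow_neg_int)
  have "f [^] int i \<preceq> f [^] int (max i j)" "f [^] (- int (max i j)) \<preceq> f [^] (- int j)"
    using f_pow_le_iff by auto
  moreover have "a \<preceq> f [^] int i" using ij by (simp add: int_pow_int)
  ultimately show ?thesis using j le_trans by blast
qed

text \<open>
  Both elements lie above a common power of \<open>f\<close>.
\<close>

lemma A_total: assumes "a \<in> A" "b \<in> A" shows "a \<preceq> b \<or> b \<preceq> a"
proof -
  obtain i j :: nat where "f [^] (- int i) \<preceq> a" "f [^] (- int j) \<preceq> b"
    using A_bounds[OF assms(1)] A_bounds[OF assms(2)] by blast
  moreover have "f [^] (- int (max i j)) \<preceq> f [^] (- int i)" "f [^] (- int (max i j)) \<preceq> f [^] (- int j)"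
    using f_pow_le_iff by auto
  ultimately show ?thesis using comparable le_trans by blast
qed

lemma pow_mult_le:
  assumes "a \<in> A" "b \<in> A"
  shows "a [^] (n::nat) \<otimes> b [^] n \<preceq> (a \<otimes> b) [^] n"
proof (induction n)
  case 0
  show ?case using le_refl by simp
next
  case (Suc n)
  have "a [^] n \<otimes> (a \<otimes> (b [^] n \<otimes> b)) \<preceq> a [^] n \<otimes> (b [^] n \<otimes> (a \<otimes> b))"
    using assms by (intro le_left swap) auto
  also have "a [^] n \<otimes> (b [^] n \<otimes> (a \<otimes> b)) = (a [^] n \<otimes> b [^] n) \<otimes> (a \<otimes> b)"
    using assms by (simp add: m_assoc)
  also have "\<dots> \<preceq> (a \<otimes> b) [^] n \<otimes> (a \<otimes> b)"
    using assms Suc by (intro A_right_mono) auto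
  finally show ?case using assms by (simp add: m_assoc)
qed

section \<open>Affine actions with the same order at infinity\<close>

definition slopes :: "'a \<Rightarrow> real set" where
  "slopes a = {of_int p / of_nat q | p (q::nat). q > 0 \<and> f [^] (p::int) \<preceq> a [^] q}"

text \<open>
  The group \<open>A\<close> is totally preordered, biinvariantly, and \<open>f\<close> is a strong unit, so this is the
  order-preserving homomorphism to the reals of Hoelder's theorem, normalised by \<open>tau f = 1\<close>.
\<close>

definition tau :: "'a \<Rightarrow> real" where
  "tau a = Sup (slopes a)"

lemma slopes_le:
  assumes "a \<in> A" "a \<preceq> f [^] k" "r \<in> slopes a" shows "r \<le> of_int k"
proof -
  obtain p and q :: nat where pq: "r = of_int p / of_nat q" "q > 0" "f [^] (p::int) \<preceq> a [^] q"
    using assms slopes_def by auto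
  have "a [^] q \<preceq> (f [^] k) [^] q" using assms f_in by (intro A_pow_mono) auto
  also have "(f [^] k) [^] q = f [^] (k * int q)"
    using f_in int_pow_pow[of f k "int q"] by (simp add: int_pow_int)
  finally have "p \<le> k * int q" using pq le_trans f_pow_le_iff by blast
  then have "real_of_int p \<le> of_int k * of_nat q" by (metis of_int_le_iff of_int_mult of_int_of_nat_eq)
  then show ?thesis using pq by (simp add: divide_le_eq)
qed

lemma slopes_bdd: "a \<in> A \<Longrightarrow> bdd_above (slopes a)"
  using A_bounds slopes_le unfolding bdd_above_def by meson

lemma slopes_nonempty: assumes "a \<in> A" shows "slopes a \<noteq> {}"
proof -
  obtain k :: nat where "f [^] (- int k) \<preceq> a" using A_bounds[OF assms] by blast
  then have "real_of_int (- int k) / of_nat 1 \<in> slopes a"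
    unfolding slopes_def using assms by (intro CollectI exI[of _ "- int k"] exI[of _ "1::nat"]) auto
  then show ?thesis by blast
qed

lemma tau_ge:
  assumes "a \<in> A" "f [^] (p::int) \<preceq> a [^] (q::nat)" "q > 0" shows "of_int p / of_nat q \<le> tau a"
  unfolding tau_def by (rule cSup_upper[OF _ slopes_bdd]) (use assms slopes_def in auto)

lemma tau_leI:
  assumes "a \<in> A" "\<And>p q. q > 0 \<Longrightarrow> f [^] (p::int) \<preceq> a [^] (q::nat) \<Longrightarrow> of_int p / of_nat q \<le> B"
  shows "tau a \<le> B"
  unfolding tau_def by (rule cSup_least[OF slopes_nonempty]) (use assms slopes_def in auto)

text \<open>
  Bring two fractions \<open>p / q\<close> and \<open>p' / q'\<close> to the common denominator \<open>q * q'\<close>. Together with the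
  inequality for inverses below this already gives additivity.
\<close>

lemma tau_superadditive:
  assumes a: "a \<in> A" and b: "b \<in> A" shows "tau a + tau b \<le> tau (a \<otimes> b)"
proof -
  have *: "of_int p / of_nat q + of_int p' / of_nat q' \<le> tau (a \<otimes> b)"
    if "q > 0" "f [^] (p::int) \<preceq> a [^] (q::nat)" "q' > 0" "f [^] (p'::int) \<preceq> b [^] (q'::nat)" for p q p' q'
  proof -
    have pow: "f [^] (s * int n) \<preceq> c [^] (m * n)" if "c \<in> A" "f [^] s \<preceq> c [^] m" for c s and m n :: nat
    proof -
      have "(f [^] s) [^] n \<preceq> (c [^] m) [^] n" using that f_in by (intro A_pow_mono) auto
      moreover have "(f [^] s) [^] n = f [^] (s * int n)"
        using f_in int_pow_pow[of f s "int n"] by (simp add: int_pow_int)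
      moreover have "(c [^] m) [^] n = c [^] (m * n)" using that by (simp add: nat_pow_pow)
      ultimately show ?thesis by simp
    qed
    have "f [^] (p * int q') \<otimes> f [^] (p' * int q) \<preceq> a [^] (q * q') \<otimes> b [^] (q' * q)"
      using a b f_in that by (intro A_mult_mono pow) auto
    also have "\<dots> \<preceq> (a \<otimes> b) [^] (q * q')"
      using pow_mult_le[OF a b, of "q * q'"] by (simp add: mult.commute)
    finally have "f [^] (p * int q' + p' * int q) \<preceq> (a \<otimes> b) [^] (q * q')"
      using f_in by (simp add: int_pow_mult)
    then have "of_int (p * int q' + p' * int q) / of_nat (q * q') \<le> tau (a \<otimes> b)"
      using a b that by (intro tau_ge) auto
    also have "real_of_int (p * int q' + p' * int q) / of_nat (q * q') = of_int p / of_nat q + of_int p' / of_nat q'"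
      using that by (simp add: field_simps)
    finally show ?thesis .
  qed
  have "tau a \<le> tau (a \<otimes> b) - tau b"
  proof (rule tau_leI[OF a])
    fix p q assume pq: "q > 0" "f [^] (p::int) \<preceq> a [^] (q::nat)"
    have "tau b \<le> tau (a \<otimes> b) - of_int p / of_nat q"
    proof (rule tau_leI[OF b])
      fix p' q' assume pq': "q' > 0" "f [^] (p'::int) \<preceq> b [^] (q'::nat)"
      show "of_int p' / of_nat q' \<le> tau (a \<otimes> b) - of_int p / of_nat q" using *[OF pq pq'] by simp
    qed
    then show "of_int p / of_nat q \<le> tau (a \<otimes> b) - tau b" by simp
  qed
  then show ?thesis by simp
qed

lemma tau_mono:
  assumes "a \<in> A" "b \<in> A" "a \<preceq> b" shows "tau a \<le> tau b"
proof (rule tau_leI[OF assms(1)])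
  fix p q assume "q > 0" "f [^] (p::int) \<preceq> a [^] (q::nat)"
  then show "of_int p / of_nat q \<le> tau b"
    using tau_ge[OF assms(2), of p q] A_pow_mono[OF assms, of q] le_trans[of "f [^] p"] by simp
qed

lemma tau_f_pow: "tau (f [^] (p::int)) = of_int p"
proof (rule antisym)
  show "tau (f [^] p) \<le> of_int p"
  proof (rule tau_leI)
    fix p' q assume "q > 0" "f [^] (p'::int) \<preceq> (f [^] p) [^] (q::nat)"
    then have "of_int p' / of_nat q \<in> slopes (f [^] p)" unfolding slopes_def by blast
    then show "of_int p' / of_nat q \<le> real_of_int p"
      by (intro slopes_le[OF _ le_refl]) (use f_in in auto)
  qed (use f_in in auto)
  show "of_int p \<le> tau (f [^] p)" using tau_ge[of "f [^] p" p 1] f_in le_refl by simp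
qed

lemma tau_f [simp]: "tau f = 1"
  using tau_f_pow[of 1] f_in by simp

lemma tau_one [simp]: "tau \<one> = 0"
  using tau_f_pow[of 0] by simp

text \<open>
  By totality, a fraction that is not a slope of \<open>a\<close> is, up to sign, a slope of \<open>inv a\<close>.
\<close>

lemma tau_inv_ge: assumes a: "a \<in> A" shows "- tau a \<le> tau (inv a)"
proof (rule ccontr)
  assume "\<not> ?thesis"
  then have "tau a < - tau (inv a)" by simp
  then obtain r where r: "r \<in> \<rat>" "tau a < r" "r < - tau (inv a)" using Rats_dense_in_real by blast
  then obtain p :: int and q :: nat where pq: "q > 0" "r = of_int p / of_nat q"
    unfolding Rats_eq_int_div_nat by blast
  have "\<not> f [^] p \<preceq> a [^] q" using tau_ge[OF a, of p q] r pq by auto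
  then have "a [^] q \<preceq> f [^] p" using A_total[of "a [^] q" "f [^] p"] a f_in by auto
  then have "inv (f [^] p) \<preceq> inv (a [^] q)" using a f_in by (intro A_inv_mono) auto
  then have "f [^] (-p) \<preceq> (inv a) [^] q" using a f_in by (simp add: int_pow_neg nat_pow_inv)
  then have "- r \<le> tau (inv a)" using tau_ge[of "inv a" "-p" q] a pq by simp
  then show False using r by simp
qed

lemma tau_inv: assumes "a \<in> A" shows "tau (inv a) = - tau a"
  using tau_inv_ge[OF assms] tau_superadditive[of a "inv a"] assms by simp

lemma tau_mult:
  assumes "a \<in> A" "b \<in> A" shows "tau (a \<otimes> b) = tau a + tau b"
  using tau_superadditive[OF assms] tau_superadditive[of "inv a" "a \<otimes> b"] tau_inv assms by simp

lemma tau_pow: "a \<in> A \<Longrightarrow> tau (a [^] (n::nat)) = of_nat n * tau a"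
  by (induction n) (simp_all add: tau_mult algebra_simps)

lemma tau_less_imp_le: "a \<in> A \<Longrightarrow> b \<in> A \<Longrightarrow> tau a < tau b \<Longrightarrow> a \<preceq> b"
  using A_total[of a b] tau_mono[of b a] by auto

text \<open>
  Monotone homomorphisms from \<open>A\<close> to the reals form a single ray. This will be applied to
  \<open>tau\<close> composed with a conjugation.
\<close>

lemma tau_unique:
  fixes s :: "'a \<Rightarrow> real"
  assumes add: "\<And>a b. a \<in> A \<Longrightarrow> b \<in> A \<Longrightarrow> s (a \<otimes> b) = s a + s b"
    and nonneg: "\<And>a. a \<in> A \<Longrightarrow> \<one> \<preceq> a \<Longrightarrow> 0 \<le> s a" and a: "a \<in> A"
  shows "s a = s f * tau a"
proof -
  have one: "s \<one> = 0" using add[of \<one> \<one>] by simp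
  have inv: "s (inv b) = - s b" if "b \<in> A" for b using add[of b "inv b"] that one by simp
  have pow: "s (b [^] n) = of_nat n * s b" if "b \<in> A" for b and n :: nat
    using that by (induction n) (simp_all add: add one algebra_simps)
  have ipow: "s (f [^] p) = of_int p * s f" for p :: int
  proof (cases p rule: int_cases2)
    case (nonneg n)
    then show ?thesis using pow[OF f_in, of n] by (simp add: int_pow_int)
  next
    case (nonpos n)
    then show ?thesis using pow[OF f_in, of n] inv[of "f [^] n"] f_in by (simp add: int_pow_neg_int)
  qed
  have mono: "s b \<le> s c" if "b \<in> A" "c \<in> A" "b \<preceq> c" for b c
  proof -
    have "\<one> \<preceq> inv b \<otimes> c" using that le_inv_right[of b \<one> c] by simp
    then show ?thesis using nonneg[of "inv b \<otimes> c"] add[of "inv b" c] inv that by simp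
  qed
  have sf: "0 \<le> s f" using nonneg f_in one_le_f by blast
  have le: "s f * tau b \<le> s b" if b: "b \<in> A" for b
  proof (cases "s f = 0")
    case True
    obtain k :: nat where "f [^] (- int k) \<preceq> b" using A_bounds[OF b] by blast
    then show ?thesis using True mono[of "f [^] (- int k)" b] ipow b f_in by simp
  next
    case False
    have "tau b \<le> s b / s f"
    proof (rule tau_leI[OF b])
      fix p q assume pq: "q > 0" "f [^] (p::int) \<preceq> b [^] (q::nat)"
      then have "of_int p * s f \<le> of_nat q * s b" using mono[of "f [^] p" "b [^] q"] ipow pow b f_in by simp
      then show "of_int p / of_nat q \<le> s b / s f" using pq False sf by (simp add: field_simps)
    qed
    then show ?thesis using False sf by (simp add: field_simps)
  qed
  show ?thesis using le[OF a] le[of "inv a"] a by (simp add: inv tau_inv)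
qed

section \<open>The multiplier of a conjugation\<close>

definition multiplier :: "'a \<Rightarrow> real" where
  "multiplier g = tau (g \<otimes> f \<otimes> inv g)"

text \<open>
  The element \<open>inv g\<close> may lie on another branch than the powers of \<open>f\<close>, so \<open>a \<otimes> inv g\<close> and \<open>inv g\<close>
  cannot be compared directly. Higher up they can: with \<open>y = g \<otimes> f [^] k\<close> the conjugate \<open>a'\<close> satisfies
  \<open>y \<preceq> a' \<otimes> y\<close>, hence \<open>y \<preceq> a' [^] n \<otimes> y\<close>, and a negative translation number would push
  \<open>a' [^] n \<otimes> y\<close> below \<open>\<one>\<close>.
\<close>

lemma tau_conj_nonneg:
  assumes g: "g \<in> carrier G" and a: "a \<in> A" and pos: "\<one> \<preceq> a"
  shows "0 \<le> tau (g \<otimes> a \<otimes> inv g)"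
proof (rule ccontr)
  define a' where "a' = g \<otimes> a \<otimes> inv g"
  have a': "a' \<in> A" using a g a'_def by auto
  assume "\<not> ?thesis"
  then have neg: "tau a' < 0" using a'_def by simp
  obtain k :: nat where k: "inv g \<preceq> f [^] k" using f_cofinal g by blast
  define y where "y = g \<otimes> f [^] k"
  have y: "y \<in> carrier G" "\<one> \<preceq> y" using k g f_in le_inv_left[of g \<one> "f [^] k"] y_def by auto
  obtain m :: nat where m: "y \<preceq> f [^] m" using f_cofinal y by blast
  have "f [^] k \<otimes> \<one> \<preceq> f [^] k \<otimes> a" using f_in pos by (intro le_left) auto
  also have "\<dots> \<preceq> a \<otimes> f [^] k" using f_in a by (intro swap_one) auto
  finally have "g \<otimes> f [^] k \<preceq> g \<otimes> (a \<otimes> f [^] k)" using g f_in by (intro le_left) auto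
  then have step: "y \<preceq> a' \<otimes> y" using g a f_in by (simp add: y_def a'_def group_normalize)
  have iter: "y \<preceq> a' [^] n \<otimes> y" for n :: nat
  proof (induction n)
    case 0
    then show ?case using y le_refl by simp
  next
    case (Suc n)
    have "a' [^] n \<otimes> y \<preceq> a' [^] n \<otimes> (a' \<otimes> y)" using a' step by (intro le_left) auto
    then show ?case using Suc le_trans a' y by (simp add: m_assoc)
  qed
  have "0 \<le> of_nat n * tau a' + of_nat m" for n :: nat
  proof -
    have "a' [^] n \<otimes> y \<preceq> a' [^] n \<otimes> f [^] m" using m a' by (intro le_left) auto
    then have "\<one> \<preceq> a' [^] n \<otimes> f [^] m" using y iter le_trans by blast
    then have "tau \<one> \<le> tau (a' [^] n \<otimes> f [^] m)" using a' f_in by (intro tau_mono) auto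
    then show ?thesis using a' f_in by (simp add: tau_mult tau_pow)
  qed
  moreover obtain n :: nat where "of_nat n * (- tau a') > of_nat m"
    using reals_Archimedean3[of "- tau a'"] neg by auto
  ultimately show False by (smt (verit) mult_minus_right)
qed

lemma tau_conj:
  assumes g: "g \<in> carrier G" and a: "a \<in> A"
  shows "tau (g \<otimes> a \<otimes> inv g) = multiplier g * tau a"
  unfolding multiplier_def
proof (rule tau_unique[where s = "\<lambda>a. tau (g \<otimes> a \<otimes> inv g)"])
  fix a b assume "a \<in> A" "b \<in> A"
  moreover from this have "g \<otimes> (a \<otimes> b) \<otimes> inv g = (g \<otimes> a \<otimes> inv g) \<otimes> (g \<otimes> b \<otimes> inv g)"
    using g by (simp add: group_normalize)
  ultimately show "tau (g \<otimes> (a \<otimes> b) \<otimes> inv g) = tau (g \<otimes> a \<otimes> inv g) + tau (g \<otimes> b \<otimes> inv g)"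
    using g tau_mult[of "g \<otimes> a \<otimes> inv g" "g \<otimes> b \<otimes> inv g"] by simp
qed (use g a tau_conj_nonneg in auto)

lemma multiplier_mult: assumes "g \<in> carrier G" "k \<in> carrier G" shows "multiplier (g \<otimes> k) = multiplier g * multiplier k"
proof -
  have "(g \<otimes> k) \<otimes> f \<otimes> inv (g \<otimes> k) = g \<otimes> (k \<otimes> f \<otimes> inv k) \<otimes> inv g"
    using assms f_in by (simp add: group_normalize)
  then show ?thesis using tau_conj[of g "k \<otimes> f \<otimes> inv k"] assms f_in by (simp add: multiplier_def)
qed

lemma multiplier_A: assumes "a \<in> A" shows "multiplier a = 1"
proof -
  have "multiplier a = tau (a \<otimes> f) + tau (inv a)"
    unfolding multiplier_def using assms f_in by (intro tau_mult) auto
  also have "\<dots> = 1" using tau_mult[OF assms f_in] tau_inv[OF assms] by simp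
  finally show ?thesis .
qed

lemma multiplier_one [simp]: "multiplier \<one> = 1" by (rule multiplier_A[OF A.one_closed])

lemma multiplier_inv: assumes "g \<in> carrier G" shows "multiplier g * multiplier (inv g) = 1"
  using multiplier_mult[of g "inv g"] assms by simp

lemma multiplier_pos: assumes "g \<in> carrier G" shows "0 < multiplier g"
  using tau_conj_nonneg[OF assms f_in one_le_f] multiplier_inv[OF assms] by (cases "multiplier g = 0") (auto simp: multiplier_def)

lemma multiplier_pow: assumes "g \<in> carrier G" shows "multiplier (g [^] (n::nat)) = multiplier g ^ n"
  by (induction n) (simp_all add: multiplier_mult assms)

section \<open>The height defined by translation numbers\<close>

definition height :: "'a \<Rightarrow> real" where
  "height x = Sup {tau a | a. a \<in> A \<and> a \<preceq> x}"

text \<open>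
  Only for these elements is the supremum defining \<open>height\<close> taken over a nonempty set; they include
  everything above \<open>\<one>\<close>.
\<close>

definition above_A :: "'a \<Rightarrow> bool" where
  "above_A x \<longleftrightarrow> (\<exists>a\<in>A. a \<preceq> x)"

lemma above_one: "\<one> \<preceq> x \<Longrightarrow> above_A x"
  unfolding above_A_def using A.one_closed by blast

lemma above_A_carrier: "above_A x \<Longrightarrow> x \<in> carrier G"
  unfolding above_A_def using le_carrier by blast

lemma above_A_mult: assumes "above_A x" "b \<in> A" shows "above_A (b \<otimes> x)"
  using assms le_left[of b] unfolding above_A_def by (metis A.m_closed A.mem_carrier)

lemma above_A_mono: "above_A x \<Longrightarrow> x \<preceq> y \<Longrightarrow> above_A y"
  unfolding above_A_def using le_trans by blast

lemma height_bdd: assumes "x \<in> carrier G" shows "bdd_above {tau a | a. a \<in> A \<and> a \<preceq> x}"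
proof -
  obtain k :: nat where k: "x \<preceq> f [^] k" using f_cofinal assms by blast
  have "tau a \<le> of_nat k" if "a \<in> A" "a \<preceq> x" for a
    using tau_mono[of a "f [^] k"] that k le_trans f_in by (auto simp: tau_pow)
  then show ?thesis unfolding bdd_above_def by blast
qed

lemma height_ge: "a \<in> A \<Longrightarrow> a \<preceq> x \<Longrightarrow> tau a \<le> height x"
  unfolding height_def using le_carrier by (intro cSup_upper height_bdd) blast+

lemma height_leI: "above_A x \<Longrightarrow> (\<And>a. a \<in> A \<Longrightarrow> a \<preceq> x \<Longrightarrow> tau a \<le> B) \<Longrightarrow> height x \<le> B"
  unfolding height_def by (rule cSup_least) (auto simp: above_A_def)

lemma height_mono: "above_A x \<Longrightarrow> x \<preceq> y \<Longrightarrow> height x \<le> height y"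
proof (rule height_leI)
  fix a assume "x \<preceq> y" "a \<in> A" "a \<preceq> x"
  then show "tau a \<le> height y" using height_ge[of a y] le_trans[of a x y] by simp
qed

lemma height_mult: assumes x: "above_A x" and b: "b \<in> A" shows "height (b \<otimes> x) = tau b + height x"
proof -
  have *: "tau c + height y \<le> height (c \<otimes> y)" if "above_A y" "c \<in> A" for c y
  proof -
    have "height y \<le> height (c \<otimes> y) - tau c"
    proof (rule height_leI[OF that(1)])
      fix a assume "a \<in> A" "a \<preceq> y"
      then have "tau (c \<otimes> a) \<le> height (c \<otimes> y)" using that by (intro height_ge le_left) auto
      then show "tau a \<le> height (c \<otimes> y) - tau c" using tau_mult[of c a] that \<open>a \<in> A\<close> by simp
    qed
    then show ?thesis by simp
  qed
  have "above_A (b \<otimes> x)" using above_A_mult assms by blast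
  then have "tau (inv b) + height (b \<otimes> x) \<le> height (inv b \<otimes> (b \<otimes> x))" using * b by blast
  then show ?thesis using * [OF x b] tau_inv[OF b] b above_A_carrier[OF x] by simp
qed

lemma height_A: assumes "a \<in> A" shows "height a = tau a"
proof -
  have "above_A \<one>" using above_one le_refl by blast
  moreover have "height \<one> = 0"
  proof (rule antisym)
    show "height \<one> \<le> 0" using tau_mono[of _ \<one>] \<open>above_A \<one>\<close> by (intro height_leI) auto
    show "0 \<le> height \<one>" using height_ge[of \<one> \<one>] le_refl by simp
  qed
  ultimately show ?thesis using height_mult[of \<one> a] assms by simp
qed

lemma height_unbounded: "eventually_above (\<lambda>x. M \<le> height x)"
proof -
  obtain k :: nat where k: "M \<le> of_nat k" using real_arch_simple by blast
  have "M \<le> height x" if "f [^] k \<preceq> x" for x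
    using height_ge[of "f [^] k" x] that f_in k by (simp add: tau_pow)
  then show ?thesis unfolding eventually_above_def using f_in by (intro bexI[of _ "f [^] k"]) auto
qed

lemma above_shift:
  assumes "g \<in> carrier G" "inv g \<preceq> x" shows "\<one> \<preceq> g \<otimes> x"
  using assms le_inv_left[of g \<one> x] le_carrier by auto

section \<open>A nontrivial multiplier\<close>

lemma tau_int_pow: assumes "a \<in> A" shows "tau (a [^] (p::int)) = of_int p * tau a"
proof (cases p rule: int_cases2)
  case (nonneg n)
  then show ?thesis using tau_pow[OF assms] by (simp add: int_pow_int)
next
  case (nonpos n)
  then show ?thesis using tau_pow[OF assms, of n] tau_inv[of "a [^] n"] assms by (simp add: int_pow_neg_int)
qed

text \<open>
  Conjugating \<open>f\<close> by powers of an element with multiplier less than 1 gives arbitrarily small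
  positive translation numbers.
\<close>

lemma tau_dense:
  assumes g0: "g0 \<in> carrier G" "multiplier g0 \<noteq> 1" and "c < d"
  shows "\<exists>b\<in>A. c < tau b \<and> tau b < d"
proof -
  obtain g where g: "g \<in> carrier G" "multiplier g < 1"
  proof (cases "multiplier g0 < 1")
    case False
    then have "multiplier g0 > 1" using g0 by simp
    then have "multiplier (inv g0) < 1"
      using multiplier_inv[OF g0(1)] multiplier_pos[of "inv g0"] g0 mult_strict_right_mono[of 1 "multiplier g0" "multiplier (inv g0)"] by simp
    then show ?thesis using g0 that[of "inv g0"] by simp
  qed (use g0 that in blast)
  obtain n :: nat where n: "multiplier g ^ n < d - c"
    using real_arch_pow_inv[of "d - c" "multiplier g"] g \<open>c < d\<close> by auto
  define e where "e = multiplier g ^ n"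
  have e: "e > 0" "e < d - c" using multiplier_pos[OF g(1)] n e_def by auto
  define b where "b = g [^] n \<otimes> f \<otimes> inv (g [^] n)"
  have b: "b \<in> A" "tau b = e"
    using g f_in tau_conj[of "g [^] n" f] multiplier_pow[OF g(1), of n] by (auto simp: b_def e_def)
  \<comment> \<open>The first multiple of \<open>e\<close> beyond \<open>c\<close>.\<close>
  define p where "p = \<lfloor>c / e\<rfloor> + 1"
  have "c / e < p" "p \<le> c / e + 1" unfolding p_def by linarith+
  then have "c < p * e" "p * e \<le> c + e" using e by (simp_all add: field_simps)
  then show ?thesis using tau_int_pow[of b p] b e by (intro bexI[of _ "b [^] p"]) auto
qed

lemma height_less_imp_le:
  assumes x: "above_A x" and y: "above_A y" and "height x < height y" shows "x \<preceq> y"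
proof -
  obtain a b where ab: "a \<in> A" "a \<preceq> x" "b \<in> A" "b \<preceq> y" using x y above_A_def by blast
  have "\<exists>c. c \<preceq> x \<and> c \<preceq> y"
    using A_total[OF ab(1,3)] ab le_trans[of a b y] le_trans[of b a x] by blast
  then have "x \<preceq> y \<or> y \<preceq> x" using comparable by blast
  then show ?thesis using height_mono[OF y, of x] assms(3) by auto
qed

text \<open>
  A monotone function that is equivariant under \<open>A\<close> is determined up to a constant when \<open>tau\<close> has
  dense image; the difference bound is stated in one direction, and exchanging \<open>x\<close> and \<open>x'\<close> gives
  the other. If \<open>tau b\<close> is slightly larger than the difference of heights, then \<open>inv b\<close> moves \<open>x'\<close>
  below \<open>x\<close> in height, hence in the preorder. A high power of \<open>f\<close> first lifts both points above \<open>z\<close>,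
  where \<open>h'\<close> is controlled.
\<close>

lemma height_difference_le:
  assumes dense: "\<And>c d. c < d \<Longrightarrow> \<exists>b\<in>A. c < tau b \<and> tau b < d"
    and z: "\<one> \<preceq> z" and mono: "\<And>x y. z \<preceq> x \<Longrightarrow> x \<preceq> y \<Longrightarrow> h' x \<le> h' y"
    and equivariant: "\<And>b x. b \<in> A \<Longrightarrow> z \<preceq> x \<Longrightarrow> z \<preceq> b \<otimes> x \<Longrightarrow> h' (b \<otimes> x) = h' x + tau b"
    and x: "z \<preceq> x" and x': "z \<preceq> x'"
  shows "h' x' - h' x \<le> height x' - (height x :: real)"
proof (rule field_le_epsilon)
  fix e :: real assume "e > 0"
  then obtain b where b: "b \<in> A" "height x' - height x < tau b" "tau b < height x' - height x + e"
    using dense[of "height x' - height x" "height x' - height x + e"] by auto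
  have one_le: "\<one> \<preceq> x" "\<one> \<preceq> x'" using z x x' le_trans by blast+
  have above: "above_A x" "above_A x'" "above_A z" using one_le z above_one by blast+
  \<comment> \<open>Lift by \<open>f [^] m\<close> so far that both points come to lie above \<open>z\<close>.\<close>
  obtain m :: nat where m: "\<bar>height z\<bar> + \<bar>height x\<bar> + \<bar>height x'\<bar> + \<bar>tau b\<bar> < of_nat m"
    using reals_Archimedean2 by blast
  define c where "c = f [^] m \<otimes> inv b"
  have c: "c \<in> A" "tau c = of_nat m - tau b"
    using b f_in by (auto simp: c_def tau_mult tau_pow tau_inv)
  have fm: "f [^] m \<in> A" "tau (f [^] m) = of_nat m" using f_in by (auto simp: tau_pow)
  have height_u: "height (f [^] m \<otimes> x) = of_nat m + height x" "height (c \<otimes> x') = of_nat m - tau b + height x'"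
    using height_mult[OF above(1) fm(1)] height_mult[OF above(2) c(1)] fm c by auto
  have above_u: "above_A (f [^] m \<otimes> x)" "above_A (c \<otimes> x')" using above_A_mult above fm c by blast+
  have z_le: "z \<preceq> f [^] m \<otimes> x" "z \<preceq> c \<otimes> x'"
    using height_less_imp_le[OF above(3) above_u(1)] height_less_imp_le[OF above(3) above_u(2)] height_u m by auto
  have "c \<otimes> x' \<preceq> f [^] m \<otimes> x"
    using height_less_imp_le[OF above_u(2,1)] height_u b by auto
  then have "h' (c \<otimes> x') \<le> h' (f [^] m \<otimes> x)" using mono z_le by blast
  then show "h' x' - h' x \<le> height x' - height x + e"
    using equivariant[OF c(1) x' z_le(2)] equivariant[OF fm(1) x z_le(1)] c fm b by simp
qed

lemma height_mult_left: assumes "g \<in> carrier G" "above_A (g \<otimes> x)" "x \<in> carrier G" "b \<in> A"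
  shows "height (g \<otimes> (b \<otimes> x)) = multiplier g * tau b + height (g \<otimes> x)"
proof -
  have "g \<otimes> (b \<otimes> x) = (g \<otimes> b \<otimes> inv g) \<otimes> (g \<otimes> x)" using assms by (simp add: group_normalize)
  then show ?thesis using height_mult[OF assms(2), of "g \<otimes> b \<otimes> inv g"] tau_conj[of g b] assms by simp
qed

text \<open>
  Rescaled by \<open>multiplier g\<close>, the function \<open>x \<mapsto> height (g \<otimes> x)\<close> has the same equivariance under
  \<open>A\<close> as \<open>height\<close>, so the two differ by a constant.
\<close>

lemma has_affine_height_if_nontrivial_multiplier:
  assumes g0: "g0 \<in> carrier G" "multiplier g0 \<noteq> 1"
  shows "has_affine_height G prec"
proof (rule has_affine_heightI[where multiplier = multiplier and h = height and ?t0.0 = \<one> and f = f and d = 1])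
  fix g assume g: "g \<in> carrier G"
  obtain z where z: "\<one> \<preceq> z" "inv g \<preceq> z" using directed[of \<one> "inv g"] g by auto
  define h' where "h' x = height (g \<otimes> x) / multiplier g" for x
  have above: "above_A (g \<otimes> x)" if "z \<preceq> x" for x
    using above_shift[OF g] z that le_trans above_one by blast
  have diff: "h' x' - h' x \<le> height x' - height x" if x: "z \<preceq> x" "z \<preceq> x'" for x x'
  proof (rule height_difference_le[OF tau_dense[OF g0] z(1)])
    show "h' x \<le> h' y" if "z \<preceq> x" "x \<preceq> y" for x y
      using that above multiplier_pos[OF g] height_mono[of "g \<otimes> x" "g \<otimes> y"] g
      by (simp add: h'_def divide_right_mono le_left)
    show "h' (b \<otimes> x) = h' x + tau b" if "b \<in> A" "z \<preceq> x" "z \<preceq> b \<otimes> x" for b x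
      using height_mult_left[OF g above[OF that(2)] _ that(1)] le_carrier[OF that(2)] multiplier_pos[OF g]
      by (simp add: h'_def field_simps)
  qed (use x in auto)
  define c where "c = h' z - height z"
  have zz: "z \<preceq> z" using z le_carrier le_refl by blast
  have "h' x = height x + c" if "z \<preceq> x" for x
    using diff[OF zz that] diff[OF that zz] c_def by simp
  then have "height (g \<otimes> x) = multiplier g * height x + multiplier g * c" if "z \<preceq> x" for x
    using that multiplier_pos[OF g] unfolding h'_def by (force simp: field_simps)
  then show "\<exists>b. eventually_above (\<lambda>x. height (g \<otimes> x) = multiplier g * height x + b)"
    unfolding eventually_above_def using z le_carrier by blast
next
  show "eventually_above (\<lambda>x. height (f \<otimes> x) = height x + 1)"
    using eventually_above_ge[of \<one>] by (rule eventually_above_mono) (use height_mult[OF above_one f_in] in auto)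
qed (use multiplier_pos multiplier_mult multiplier_A f_in height_mono above_one height_unbounded in auto)

section \<open>A subgroup of finite index\<close>

text \<open>
  Averaging \<open>height (r \<otimes> x)\<close> over representatives \<open>r\<close> of the cosets of \<open>A\<close> makes the height
  equivariant under all of \<open>G\<close>: right multiplication by \<open>k\<close> permutes the cosets and changes their
  representatives by elements of \<open>A\<close>, which only contribute translations.
\<close>

lemma has_affine_height_if_finite_index:
  assumes fin: "finite (rcosets A)"
  shows "has_affine_height G prec"
proof -
  define rep where "rep D = (SOME r. r \<in> D)" for D :: "'a set"
  have rep: "rep D \<in> D" "rep D \<in> carrier G" "A #> rep D = D" if D: "D \<in> rcosets A" for D
  proof -
    obtain r where r: "r \<in> carrier G" "D = A #> r" using D unfolding RCOSETS_def by auto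
    then have "r \<in> D" using rcos_self[OF r(1) A.subgroup_axioms] by (simp only: r(2))
    then show *: "rep D \<in> D" unfolding rep_def by (rule someI)
    then show "rep D \<in> carrier G" using r r_coset_subset_G[OF A.subset r(1)] by auto
    show "A #> rep D = D" using * r repr_independence[OF _ r(1) A.subgroup_axioms, of "rep D"] by simp
  qed
  define shift where "shift k D = D #> k" for k D
  have shift: "shift k D \<in> rcosets A" "D #> k = A #> (rep D \<otimes> k)" if "D \<in> rcosets A" "k \<in> carrier G" for D k
  proof -
    show *: "D #> k = A #> (rep D \<otimes> k)"
      using coset_mult_assoc[OF A.subset, of "rep D" k] rep[OF that(1)] that by simp
    show "shift k D \<in> rcosets A" unfolding shift_def * using rep[OF that(1)] that
      by (intro rcosetsI A.subset) auto
  qed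
  have shift_inv: "shift (inv k) (shift k D) = D" if "D \<in> rcosets A" "k \<in> carrier G" for D k
    using coset_mult_assoc[of D k "inv k"] coset_mult_one[of D] that rcosets_part_G[OF A.subgroup_axioms]
    unfolding shift_def by auto
  have bij: "bij_betw (shift k) (rcosets A) (rcosets A)" if k: "k \<in> carrier G" for k
    by (rule bij_betw_byWitness[where f' = "shift (inv k)"])
      (use k shift(1) shift_inv shift_inv[of _ "inv k"] in auto)
  \<comment> \<open>The element of \<open>A\<close> by which \<open>rep D \<otimes> k\<close> differs from the representative of its coset.\<close>
  define c where "c k D = rep D \<otimes> k \<otimes> inv (rep (shift k D))" for k D
  have c: "c k D \<in> A" if "D \<in> rcosets A" "k \<in> carrier G" for k D
  proof -
    have "rep D \<otimes> k \<in> A #> rep (shift k D)"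
      using rep(3)[OF shift(1)[OF that]] shift(2)[OF that] rcos_self[OF _ A.subgroup_axioms] rep[OF that(1)] that
      unfolding shift_def by auto
    then obtain a where a: "a \<in> A" "rep D \<otimes> k = a \<otimes> rep (shift k D)" unfolding r_coset_def by auto
    then show ?thesis using rep(2)[OF shift(1)[OF that]] unfolding c_def by (simp add: m_assoc)
  qed
  have card_pos: "card (rcosets A) > 0"
    using fin rcosetsI[OF A.subset one_closed] by (auto simp: card_gt_0_iff)
  define h where "h x = (\<Sum>D\<in>rcosets A. height (rep D \<otimes> x)) / card (rcosets A)" for x
  have bound: "\<exists>t\<in>carrier G. \<forall>D\<in>rcosets A. inv (rep D) \<otimes> w \<preceq> t" if "w \<in> carrier G" for w
    using finite_upper_bound[of "(\<lambda>D. inv (rep D) \<otimes> w) ` (rcosets A)"] fin rep(2) that by auto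
  obtain t0 where t0: "t0 \<in> carrier G" "\<And>D. D \<in> rcosets A \<Longrightarrow> inv (rep D) \<otimes> \<one> \<preceq> t0"
    using bound[OF one_closed] by blast
  have above: "above_A (rep D \<otimes> x)" if "D \<in> rcosets A" "t0 \<preceq> x" for D x
    using above_shift[of "rep D" x] t0(2)[OF that(1)] le_trans[OF _ that(2)] rep(2)[OF that(1)] above_one by auto
  show ?thesis
  proof (rule has_affine_heightI[where multiplier = "\<lambda>_. 1" and h = h and ?t0.0 = t0 and f = f
        and d = "(\<Sum>D\<in>rcosets A. multiplier (rep D)) / card (rcosets A)"])
    fix x y assume xy: "t0 \<preceq> x" "x \<preceq> y"
    have "height (rep D \<otimes> x) \<le> height (rep D \<otimes> y)" if "D \<in> rcosets A" for D
      using height_mono[OF above[OF that xy(1)]] le_left[OF rep(2)[OF that] xy(2)] by blast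
    then show "h x \<le> h y" unfolding h_def by (intro divide_right_mono sum_mono) auto
  next
    fix M
    obtain w where w: "w \<in> carrier G" "\<And>x. w \<preceq> x \<Longrightarrow> M \<le> height x" using height_unbounded[of M] unfolding eventually_above_def by blast
    obtain t where t: "t \<in> carrier G" "\<And>D. D \<in> rcosets A \<Longrightarrow> inv (rep D) \<otimes> w \<preceq> t"
      using bound[OF w(1)] by blast
    have "M \<le> h x" if x: "t \<preceq> x" for x
    proof -
      have "M \<le> height (rep D \<otimes> x)" if D: "D \<in> rcosets A" for D
        using le_trans[OF t(2)[OF D] x] le_inv_left[of "rep D" w x] rep(2)[OF D] w le_carrier[OF x] by blast
      then have "(\<Sum>D\<in>rcosets A. M) \<le> (\<Sum>D\<in>rcosets A. height (rep D \<otimes> x))"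
        by (rule sum_mono)
      then show ?thesis using card_pos unfolding h_def by (simp add: field_simps)
    qed
    then show "eventually_above (\<lambda>x. M \<le> h x)" unfolding eventually_above_def using t by blast
  next
    fix k assume k: "k \<in> carrier G"
    have "h (k \<otimes> x) = 1 * h x + (\<Sum>D\<in>rcosets A. tau (c k D)) / card (rcosets A)" if x: "t0 \<preceq> x" for x
    proof -
      have x_in: "x \<in> carrier G" using le_carrier x by blast
      have "height (rep D \<otimes> (k \<otimes> x)) = tau (c k D) + height (rep (shift k D) \<otimes> x)" if D: "D \<in> rcosets A" for D
      proof -
        have "rep D \<otimes> (k \<otimes> x) = c k D \<otimes> (rep (shift k D) \<otimes> x)"
          using rep(2)[OF D] rep(2)[OF shift(1)[OF D k]] k x_in by (simp add: c_def m_assoc)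
        then show ?thesis using height_mult[OF above[OF shift(1)[OF D k] x] c[OF D k]] by simp
      qed
      then have "(\<Sum>D\<in>rcosets A. height (rep D \<otimes> (k \<otimes> x)))
        = (\<Sum>D\<in>rcosets A. tau (c k D)) + (\<Sum>D\<in>rcosets A. height (rep (shift k D) \<otimes> x))"
        by (simp add: sum.distrib)
      also have "(\<Sum>D\<in>rcosets A. height (rep (shift k D) \<otimes> x)) = (\<Sum>D\<in>rcosets A. height (rep D \<otimes> x))"
        by (rule sum.reindex_bij_betw[OF bij[OF k]])
      finally show ?thesis by (simp add: h_def add_divide_distrib)
    qed
    then show "\<exists>b. eventually_above (\<lambda>x. h (k \<otimes> x) = 1 * h x + b)" unfolding eventually_above_def using t0 by blast
  next
    have "h (f \<otimes> x) = h x + (\<Sum>D\<in>rcosets A. multiplier (rep D)) / card (rcosets A)" if x: "t0 \<preceq> x" for x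
    proof -
      have "height (rep D \<otimes> (f \<otimes> x)) = multiplier (rep D) + height (rep D \<otimes> x)" if D: "D \<in> rcosets A" for D
        using height_mult_left[OF rep(2)[OF D] above[OF D x] _ f_in] le_carrier x by auto
      then show ?thesis by (simp add: h_def sum.distrib add_divide_distrib)
    qed
    then show "eventually_above (\<lambda>x. h (f \<otimes> x) = h x + (\<Sum>D\<in>rcosets A. multiplier (rep D)) / card (rcosets A))"
      unfolding eventually_above_def using t0 by blast
  next
    have "(\<Sum>D\<in>rcosets A. multiplier (rep D)) > 0"
      using fin card_pos rep(2) multiplier_pos by (intro sum_pos) auto
    then show "(\<Sum>D\<in>rcosets A. multiplier (rep D)) / card (rcosets A) \<noteq> 0" using card_pos by auto
  qed (use t0 f_in in auto)
qed

section \<open>The kernel of the translation number\<close>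

text \<open>
  For an element of multiplier 1 the height of \<open>g \<otimes> f [^] m\<close> is eventually \<open>m\<close> plus a constant,
  which serves as a rough translation length of \<open>g\<close>.
\<close>

lemma germ_of_height:
  assumes trivial_multiplier: "multiplier g = 1" and g: "g \<in> carrier G"
  shows "\<exists>(q::real) (m0::nat). \<forall>m\<ge>m0. above_A (g \<otimes> f [^] m) \<and> height (g \<otimes> f [^] m) = q + of_nat m"
proof -
  obtain m0 :: nat where m0: "inv g \<preceq> f [^] m0" using f_cofinal g by auto
  have above: "above_A (g \<otimes> f [^] m0)" using above_shift[OF g m0] above_one by blast
  have "above_A (g \<otimes> f [^] m) \<and> height (g \<otimes> f [^] m) = (height (g \<otimes> f [^] m0) - of_nat m0) + of_nat m"
    if m: "m \<ge> m0" for m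
  proof
    have eq: "f [^] m = f [^] (m - m0) \<otimes> f [^] m0" using m f_in by (simp add: nat_pow_mult)
    show "height (g \<otimes> f [^] m) = (height (g \<otimes> f [^] m0) - of_nat m0) + of_nat m"
      using height_mult_left[OF g above, of "f [^] (m - m0)"] m trivial_multiplier f_in unfolding eq by (simp add: tau_pow)
    have "inv g \<preceq> f [^] m" using m0 f_pow_mono_nat[OF m] le_trans by blast
    then show "above_A (g \<otimes> f [^] m)" using above_shift[OF g] above_one by blast
  qed
  then show ?thesis by blast
qed

text \<open>
  The constants \<open>q g\<close> of the preceding lemma form a quasimorphism on \<open>G\<close>, up to an error of 2.
  If \<open>b\<close> conjugates \<open>c\<close> to \<open>a \<otimes> c\<close>, then it conjugates \<open>c [^] n\<close> to \<open>d \<otimes> c [^] n\<close> with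
  \<open>tau d = n * tau a\<close>. A quasimorphism changes by a bounded amount under conjugation by \<open>b\<close>, so
  \<open>n * tau a\<close> is bounded. The same argument shows that lifts of commuting circle homeomorphisms
  commute.
\<close>

lemma tau_commutator:
  assumes trivial_multiplier: "\<And>g. g \<in> carrier G \<Longrightarrow> multiplier g = 1"
    and b: "b \<in> carrier G" and c: "c \<in> carrier G" and a: "a \<in> A"
    and eq: "b \<otimes> c \<otimes> inv b = a \<otimes> c"
  shows "tau a = 0"
proof -
  have "\<forall>g\<in>carrier G. \<exists>(q::real) (m0::nat). \<forall>m\<ge>m0. above_A (g \<otimes> f [^] m) \<and> height (g \<otimes> f [^] m) = q + of_nat m"
    using germ_of_height trivial_multiplier by blast
  then obtain q :: "'a \<Rightarrow> real" and m0 :: "'a \<Rightarrow> nat" where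
    q: "\<And>g m. g \<in> carrier G \<Longrightarrow> m \<ge> m0 g \<Longrightarrow> above_A (g \<otimes> f [^] m) \<and> height (g \<otimes> f [^] m) = q g + of_nat m"
    by metis
  have f_pow: "above_A (f [^] n)" "height (f [^] n) = of_nat n" for n :: nat
    using f_pow_mono_nat[of 0 n] above_one height_A[of "f [^] n"] f_in by (auto simp: tau_pow)
  have quasi: "\<bar>q (g \<otimes> k) - q g - q k\<bar> \<le> 2" if g: "g \<in> carrier G" and k: "k \<in> carrier G" for g k
  proof -
    obtain m1 :: nat where m1: "of_nat (m0 g) + 2 - q k < of_nat m1" using reals_Archimedean2 by blast
    define m where "m = max m1 (max (m0 (g \<otimes> k)) (m0 k))"
    define s where "s = q k + of_nat m"
    have s: "of_nat (m0 g) + 2 < s" using m1 by (auto simp: s_def m_def)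
    \<comment> \<open>Trap \<open>y\<close> between two powers of \<open>f\<close> whose exponents differ by 2; multiplication by \<open>g\<close> keeps it trapped.\<close>
    define n where "n = nat \<lfloor>s\<rfloor>"
    have n: "of_nat n \<le> s" "s < of_nat n + 1" "n \<ge> 1" "n - 1 \<ge> m0 g"
      using s unfolding n_def by linarith+
    define y where "y = k \<otimes> f [^] m"
    have y: "above_A y" "height y = s" using q[OF k, of m] by (auto simp: y_def s_def m_def)
    have gy: "g \<otimes> y = (g \<otimes> k) \<otimes> f [^] m" using g k f_in by (simp add: y_def m_assoc)
    have height_gy: "height (g \<otimes> y) = q (g \<otimes> k) + of_nat m"
      unfolding gy using q[of "g \<otimes> k" m] g k by (simp add: m_def)
    have "f [^] (n - 1) \<preceq> y" using n y f_pow by (intro height_less_imp_le) auto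
    then have lower: "g \<otimes> f [^] (n - 1) \<preceq> g \<otimes> y" using g le_left by blast
    have "y \<preceq> f [^] (n + 1)" using n y f_pow[of "n + 1"] by (intro height_less_imp_le) auto
    then have upper: "g \<otimes> y \<preceq> g \<otimes> f [^] (n + 1)" using g le_left by blast
    have q_g: "above_A (g \<otimes> f [^] (n - 1))" "height (g \<otimes> f [^] (n - 1)) = q g + of_nat (n - 1)"
      "height (g \<otimes> f [^] (n + 1)) = q g + of_nat (n + 1)"
      using q[OF g, of "n - 1"] q[OF g, of "n + 1"] n by auto
    have "height (g \<otimes> f [^] (n - 1)) \<le> height (g \<otimes> y)" using height_mono q_g lower by blast
    moreover have "height (g \<otimes> y) \<le> height (g \<otimes> f [^] (n + 1))"
      using height_mono[OF above_A_mono[OF q_g(1) lower] upper] .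
    ultimately show ?thesis using n height_gy q_g unfolding s_def by (simp add: of_nat_diff abs_le_iff)
  qed
  have q_A: "q (d \<otimes> g) = tau d + q g" if d: "d \<in> A" and g: "g \<in> carrier G" for d g
  proof -
    define m where "m = max (m0 g) (m0 (d \<otimes> g))"
    have "height ((d \<otimes> g) \<otimes> f [^] m) = tau d + height (g \<otimes> f [^] m)"
      using height_mult[of "g \<otimes> f [^] m" d] q[OF g, of m] d g f_in by (simp add: m_def m_assoc)
    then show ?thesis using q[OF g, of m] q[of "d \<otimes> g" m] d g by (simp add: m_def)
  qed
  have power: "\<exists>d\<in>A. (a \<otimes> c) [^] n = d \<otimes> c [^] n \<and> tau d = of_nat n * tau a" for n :: nat
  proof (induction n)
    case 0
    show ?case using A.one_closed by (intro bexI[of _ \<one>]) auto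
  next
    case (Suc n)
    then obtain d where d: "d \<in> A" "(a \<otimes> c) [^] n = d \<otimes> c [^] n" "tau d = of_nat n * tau a" by blast
    \<comment> \<open>Moving \<open>a\<close> past \<open>c [^] n\<close> replaces it by a conjugate with the same translation number.\<close>
    define e where "e = c [^] n \<otimes> a \<otimes> inv (c [^] n)"
    have e: "e \<in> A" "tau e = tau a" using tau_conj[of "c [^] n" a] trivial_multiplier c a by (auto simp: e_def)
    have "(a \<otimes> c) [^] Suc n = (d \<otimes> e) \<otimes> c [^] Suc n"
      using d(1,2) a c by (simp add: e_def group_normalize)
    then show ?case using d e by (intro bexI[of _ "d \<otimes> e"]) (auto simp: tau_mult algebra_simps)
  qed
  have bound: "\<bar>of_nat n * tau a\<bar> \<le> 4 + \<bar>q b + q (inv b)\<bar>" for n :: nat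
  proof -
    obtain d where d: "d \<in> A" "(a \<otimes> c) [^] n = d \<otimes> c [^] n" "tau d = of_nat n * tau a"
      using power by blast
    have "b \<otimes> c [^] n \<otimes> inv b = d \<otimes> c [^] n"
      using conj_nat_pow[OF b c, of n] d(2) unfolding eq by simp
    then have "q (b \<otimes> c [^] n \<otimes> inv b) = of_nat n * tau a + q (c [^] n)" using q_A[OF d(1)] d(3) c by simp
    moreover have "\<bar>q (b \<otimes> c [^] n \<otimes> inv b) - q (b \<otimes> c [^] n) - q (inv b)\<bar> \<le> 2"
      using quasi b c by auto
    moreover have "\<bar>q (b \<otimes> c [^] n) - q b - q (c [^] n)\<bar> \<le> 2" using quasi b c by auto
    ultimately show ?thesis by linarith
  qed
  show ?thesis
  proof (rule ccontr)
    assume "tau a \<noteq> 0"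
    then obtain n :: nat where "4 + \<bar>q b + q (inv b)\<bar> < of_nat n * \<bar>tau a\<bar>"
      using reals_Archimedean3[of "\<bar>tau a\<bar>"] by auto
    then show False using bound[of n] by (simp add: abs_mult)
  qed
qed

definition tau_kernel :: "'a set" where
  "tau_kernel = {a \<in> A. tau a = 0}"

lemma tau_kernel_normal: "tau_kernel \<lhd> G"
proof (rule normal_invI)
  show "subgroup tau_kernel G"
    by (rule subgroupI) (auto simp: tau_kernel_def tau_inv tau_mult intro!: exI[of _ \<one>])
  show "x \<otimes> h \<otimes> inv x \<in> tau_kernel" if "x \<in> carrier G" "h \<in> tau_kernel" for x h
    using that tau_conj[of x h] by (simp add: tau_kernel_def)
qed

lemma tree_order_mod_tau_kernel: "tree_order G (le_mod tau_kernel)"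
proof (rule tree_order_le_mod[OF tau_kernel_normal])
  obtain z where z: "z \<in> carrier G" "\<not> z \<preceq> f" using unbounded by blast
  have "\<not> z \<preceq> c" if "c \<in> tau_kernel" for c
  proof
    assume "z \<preceq> c"
    moreover have "c \<preceq> f" using that f_in by (intro tau_less_imp_le) (auto simp: tau_kernel_def)
    ultimately show False using z le_trans by blast
  qed
  then show "\<exists>z\<in>carrier G. \<forall>c\<in>tau_kernel. \<not> z \<preceq> c" using z by blast
qed

text \<open>
  Commutators of \<open>B\<close> lie in \<open>A\<close> and have translation number 0, so \<open>B\<close> commutes on the quotient,
  and \<open>f\<close> is still cofinal there.
\<close>

lemma hyperbolic_mod_tau_kernel:
  assumes trivial_multiplier: "\<And>g. g \<in> carrier G \<Longrightarrow> multiplier g = 1"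
    and B: "B \<lhd> G" "A \<subseteq> B"
    and commutators: "\<And>b c. b \<in> B \<Longrightarrow> c \<in> B \<Longrightarrow> b \<otimes> c \<otimes> inv b \<otimes> inv c \<in> A"
  shows "hyperbolic_tree_order G (le_mod tau_kernel) B f"
proof -
  interpret B: normal B G by fact
  interpret Q: tree_order G "le_mod tau_kernel" by (rule tree_order_mod_tau_kernel)
  show ?thesis
  proof (unfold_locales, goal_cases)
    case 1
    show ?case
    proof (rule Q.commutes_onI[OF acts_trivially_le_mod[OF tau_kernel_normal tree_order_mod_tau_kernel]
            tau_kernel_normal B.subset])
      fix b c assume bc: "b \<in> B" "c \<in> B"
      define a where "a = b \<otimes> c \<otimes> inv b \<otimes> inv c"
      have a: "a \<in> A" using commutators bc a_def by blast
      have "b \<otimes> c \<otimes> inv b = a \<otimes> c" using bc by (simp add: a_def group_normalize)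
      then have "tau a = 0" using tau_commutator[OF trivial_multiplier B.mem_carrier[OF bc(1)] B.mem_carrier[OF bc(2)] a] by simp
      then show "b \<otimes> c \<otimes> inv b \<otimes> inv c \<in> tau_kernel" using a by (simp add: tau_kernel_def a_def)
    qed
  next
    case 2
    show ?case using f_in B by blast
  next
    case 3
    show ?case using le_imp_le_mod[OF tau_kernel_normal one_le_f] .
  next
    case (4 z)
    then show ?case using f_cofinal le_imp_le_mod[OF tau_kernel_normal] by blast
  qed
qed

end

section \<open>Pulling back a height by infima\<close>

lemma Inf_affine:
  fixes S :: "real set"
  assumes "a > 0" "S \<noteq> {}" "bdd_below S"
  shows "Inf ((\<lambda>t. a * t + b) ` S) = a * Inf S + b"
proof (rule antisym)
  have bdd: "bdd_below ((\<lambda>t. a * t + b) ` S)"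
  proof -
    obtain M where "\<And>s. s \<in> S \<Longrightarrow> M \<le> s" using assms(3) unfolding bdd_below_def by blast
    then have "a * M + b \<le> t" if "t \<in> (\<lambda>t. a * t + b) ` S" for t using that assms(1) by auto
    then show ?thesis unfolding bdd_below_def by blast
  qed
  have "(Inf ((\<lambda>t. a * t + b) ` S) - b) / a \<le> Inf S"
  proof (rule cInf_greatest[OF assms(2)])
    fix s assume "s \<in> S"
    then have "Inf ((\<lambda>t. a * t + b) ` S) \<le> a * s + b" using bdd by (intro cInf_lower) auto
    then show "(Inf ((\<lambda>t. a * t + b) ` S) - b) / a \<le> s" using assms(1) by (simp add: field_simps)
  qed
  then show "Inf ((\<lambda>t. a * t + b) ` S) \<le> a * Inf S + b" using assms(1) by (simp add: field_simps)
  show "a * Inf S + b \<le> Inf ((\<lambda>t. a * t + b) ` S)"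
    using assms by (intro cInf_greatest) (auto intro!: mult_left_mono cInf_lower)
qed

text \<open>
  The set \<open>U x\<close> consists of the points of \<open>Y\<close> that are regarded as lying above \<open>x\<close>. It shrinks as
  \<open>x\<close> grows, escapes to infinity in \<open>Y\<close>, and moves with the group near infinity. Increasing affine
  maps commute with infima, so the infimum of \<open>h'\<close> over \<open>U x\<close> inherits the affine action.
\<close>

lemma affine_height_Inf:
  fixes prec :: "'x \<Rightarrow> 'x \<Rightarrow> bool" and prec' :: "'y \<Rightarrow> 'y \<Rightarrow> bool"
  assumes psi: "\<psi> \<in> hom G Aff" and height: "affine_height G Y prec' act' \<psi> h'"
    and directed: "\<And>s t. s \<in> X \<Longrightarrow> t \<in> X \<Longrightarrow> \<exists>u\<in>X. prec s u \<and> prec t u"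
    and trans: "\<And>x y z. prec x y \<Longrightarrow> prec y z \<Longrightarrow> prec x z"
    and antimono: "\<exists>t\<in>X. \<forall>x\<in>X. \<forall>x'\<in>X. prec t x \<longrightarrow> prec x x' \<longrightarrow> U x' \<subseteq> U x"
    and nonempty: "\<exists>t\<in>X. \<forall>x\<in>X. prec t x \<longrightarrow> U x \<noteq> {}"
    and above: "\<And>s. s \<in> Y \<Longrightarrow> \<exists>t\<in>X. \<forall>x\<in>X. prec t x \<longrightarrow> (\<forall>y\<in>U x. y \<in> Y \<and> prec' s y)"
    and equivariant: "\<And>k. k \<in> carrier G \<Longrightarrow>
      \<exists>t\<in>X. \<forall>x\<in>X. prec t x \<longrightarrow> U (act k x) = act' k ` U x"
  shows "affine_height G X prec act \<psi> (\<lambda>x. Inf (h' ` U x))"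
proof -
  define ev where "ev P \<longleftrightarrow> (\<exists>t\<in>X. \<forall>x\<in>X. prec t x \<longrightarrow> P x)" for P
  have ev_conj: "ev (\<lambda>x. P x \<and> Q x)" if "ev P" "ev Q" for P Q
    using that directed trans unfolding ev_def by meson
  have unb: "\<exists>s\<in>Y. \<forall>y\<in>Y. prec' s y \<longrightarrow> M \<le> h' y" for M
    using height unfolding affine_height_def by blast
  have ge: "ev (\<lambda>x. U x \<noteq> {} \<and> (\<forall>y\<in>U x. y \<in> Y \<and> M \<le> h' y))" for M
  proof (rule ev_conj)
    show "ev (\<lambda>x. U x \<noteq> {})" using nonempty ev_def by simp
    obtain s where "s \<in> Y" "\<And>y. y \<in> Y \<Longrightarrow> prec' s y \<Longrightarrow> M \<le> h' y" using unb by blast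
    then show "ev (\<lambda>x. \<forall>y\<in>U x. y \<in> Y \<and> M \<le> h' y)" using above[of s] unfolding ev_def by meson
  qed
  have bdd: "bdd_below (h' ` U x)" if "\<forall>y\<in>U x. y \<in> Y \<and> (0::real) \<le> h' y" for x
    using that unfolding bdd_below_def by blast
  show ?thesis
    unfolding affine_height_def
  proof (intro conjI allI ballI)
    obtain t1 where t1: "t1 \<in> X" "\<And>x. x \<in> X \<Longrightarrow> prec t1 x \<Longrightarrow> U x \<noteq> {} \<and> (\<forall>y\<in>U x. y \<in> Y \<and> 0 \<le> h' y)"
      using ge[of 0] unfolding ev_def by blast
    obtain t2 where t2: "t2 \<in> X" "\<And>x x'. x \<in> X \<Longrightarrow> x' \<in> X \<Longrightarrow> prec t2 x \<Longrightarrow> prec x x' \<Longrightarrow> U x' \<subseteq> U x"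
      using antimono by blast
    obtain t where t: "t \<in> X" "prec t1 t" "prec t2 t" using directed t1 t2 by blast
    have "Inf (h' ` U x) \<le> Inf (h' ` U x')" if "x \<in> X" "x' \<in> X" "prec t x" "prec x x'" for x x'
    proof (rule cInf_superset_mono)
      show "h' ` U x' \<noteq> {}" using t1(2)[OF that(2)] t that trans by blast
      show "bdd_below (h' ` U x)" using t1(2)[OF that(1)] t that trans by (intro bdd) blast
      show "h' ` U x' \<subseteq> h' ` U x" using t2(2)[OF that(1,2)] t that trans by (intro image_mono) blast
    qed
    then show "\<exists>t\<in>X. \<forall>x\<in>X. \<forall>y\<in>X. prec t x \<longrightarrow> prec x y \<longrightarrow> Inf (h' ` U x) \<le> Inf (h' ` U y)"
      using t by blast
  next
    fix M
    obtain t1 where t1: "t1 \<in> X" "\<And>x. x \<in> X \<Longrightarrow> prec t1 x \<Longrightarrow> U x \<noteq> {} \<and> (\<forall>y\<in>U x. y \<in> Y \<and> M \<le> h' y)"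
      using ge[of M] unfolding ev_def by blast
    have "M \<le> Inf (h' ` U x)" if "x \<in> X" "prec t1 x" for x
      using t1(2)[OF that] by (intro cInf_greatest) auto
    then show "\<exists>t\<in>X. \<forall>x\<in>X. prec t x \<longrightarrow> M \<le> Inf (h' ` U x)" using t1 by blast
  next
    fix k assume k: "k \<in> carrier G"
    obtain a b where ab: "a > 0" "\<psi> k = (\<lambda>t. a * t + b)"
      using hom_in_carrier[OF psi k] unfolding Aff_carrier by blast
    obtain s where s: "s \<in> Y" "\<And>y. y \<in> Y \<Longrightarrow> prec' s y \<Longrightarrow> h' (act' k y) = \<psi> k (h' y)"
      using height k unfolding affine_height_def by blast
    have "ev (\<lambda>x. (U x \<noteq> {} \<and> (\<forall>y\<in>U x. y \<in> Y \<and> 0 \<le> h' y)) \<and> (\<forall>y\<in>U x. y \<in> Y \<and> prec' s y) \<and>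
        U (act k x) = act' k ` U x)"
      using above[OF s(1)] equivariant[OF k] by (intro ev_conj ge) (simp_all add: ev_def)
    then obtain t where t: "t \<in> X" "\<And>x. x \<in> X \<Longrightarrow> prec t x \<Longrightarrow>
        (U x \<noteq> {} \<and> (\<forall>y\<in>U x. y \<in> Y \<and> 0 \<le> h' y)) \<and> (\<forall>y\<in>U x. y \<in> Y \<and> prec' s y) \<and>
        U (act k x) = act' k ` U x"
      unfolding ev_def by blast
    have "Inf (h' ` U (act k x)) = \<psi> k (Inf (h' ` U x))" if x: "x \<in> X" "prec t x" for x
    proof -
      have "h' ` U (act k x) = (\<lambda>t. a * t + b) ` (h' ` U x)"
        using t(2)[OF x] s(2) ab by (auto simp: image_image)
      moreover have "bdd_below (h' ` U x)" "h' ` U x \<noteq> {}" using t(2)[OF x] bdd by auto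
      ultimately show ?thesis using Inf_affine[OF ab(1)] ab by simp
    qed
    then show "\<exists>t\<in>X. \<forall>x\<in>X. prec t x \<longrightarrow> Inf (h' ` U (act k x)) = \<psi> k (Inf (h' ` U x))"
      using t(1) by blast
  qed
qed

section \<open>Convex hulls of cyclic orbits\<close>

lemma (in group) conj_int_pow:
  assumes "g \<in> carrier G" "x \<in> carrier G"
  shows "(g \<otimes> x \<otimes> inv g) [^] (n::int) = g \<otimes> x [^] n \<otimes> inv g"
proof (cases n rule: int_cases2)
  case (nonneg m)
  then show ?thesis using conj_nat_pow[OF assms] by (simp add: int_pow_int)
next
  case (nonpos m)
  then show ?thesis using conj_nat_pow[OF assms, of m] assms by (simp add: int_pow_neg_int group_normalize)
qed

context tree_order
begin

text \<open>
  When \<open>z \<preceq> b \<otimes> z\<close>, the orbit of \<open>z\<close> is an increasing sequence and this is its convex hull; on the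
  line, if \<open>b\<close> moves \<open>z\<close>, it would be the component of \<open>z\<close> in the complement of the fixed points
  of \<open>b\<close>.
\<close>

definition orbit_hull :: "'a \<Rightarrow> 'a \<Rightarrow> 'a set" where
  "orbit_hull b z = {w. \<exists>n::nat. b [^] (- int n) \<otimes> z \<preceq> w \<and> w \<preceq> b [^] (int n) \<otimes> z}"

lemma iterate_le:
  assumes "b \<in> carrier G" "z \<preceq> b \<otimes> z"
  shows "z \<preceq> b [^] (n::nat) \<otimes> z"
proof (induction n)
  case 0
  then show ?case using assms le_carrier le_refl by simp
next
  case (Suc n)
  have "b [^] n \<otimes> z \<preceq> b [^] n \<otimes> (b \<otimes> z)" using assms by (intro le_left) auto
  then show ?case using le_trans[OF Suc] assms(1) le_carrier[OF assms(2)] by (simp add: m_assoc)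
qed

lemma iterate_ge:
  assumes "b \<in> carrier G" "b \<otimes> z \<preceq> z"
  shows "b [^] (n::nat) \<otimes> z \<preceq> z"
proof (induction n)
  case 0
  then show ?case using assms le_carrier le_refl by simp
next
  case (Suc n)
  have "b [^] n \<otimes> (b \<otimes> z) \<preceq> b [^] n \<otimes> z" using assms by (intro le_left) auto
  then show ?case using le_trans[OF _ Suc] assms(1) le_carrier[OF assms(2)] by (simp add: m_assoc)
qed

lemma int_pow_act:
  assumes "b \<in> carrier G" "z \<in> carrier G"
  shows "b [^] (i::int) \<otimes> (b [^] (j::int) \<otimes> z) = b [^] (i + j) \<otimes> z"
  using assms by (simp add: m_assoc [symmetric] int_pow_mult)

lemma orbit_mono:
  assumes b: "b \<in> carrier G" and z: "z \<preceq> b \<otimes> z" and ij: "i \<le> (j::int)"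
  shows "b [^] i \<otimes> z \<preceq> b [^] j \<otimes> z"
proof -
  have z_in: "z \<in> carrier G" using z le_carrier by blast
  have "b [^] i \<otimes> z \<preceq> b [^] i \<otimes> (b [^] nat (j - i) \<otimes> z)"
    using iterate_le[OF b z] b by (intro le_left) auto
  also have "b [^] nat (j - i) = b [^] (j - i)" using ij by (simp add: pow_nat)
  finally show ?thesis using int_pow_act[OF b z_in, of i "j - i"] by simp
qed

lemma hull_self: assumes "b \<in> carrier G" "z \<preceq> b \<otimes> z" shows "z \<in> orbit_hull b z"
  unfolding orbit_hull_def using assms le_carrier le_refl by (intro CollectI exI[of _ "0::nat"]) auto

lemma hull_convex:
  assumes xy: "x \<in> orbit_hull b z" "y \<in> orbit_hull b z"
    and b: "b \<in> carrier G" "z \<preceq> b \<otimes> z" and w: "x \<preceq> w" "w \<preceq> y"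
  shows "w \<in> orbit_hull b z"
proof -
  obtain m n :: nat where mn: "b [^] (- int m) \<otimes> z \<preceq> x" "y \<preceq> b [^] (int n) \<otimes> z"
    using xy unfolding orbit_hull_def by blast
  have "b [^] (- int (max m n)) \<otimes> z \<preceq> b [^] (- int m) \<otimes> z" "b [^] (int n) \<otimes> z \<preceq> b [^] int (max m n) \<otimes> z"
    using orbit_mono[OF b] by auto
  then show ?thesis unfolding orbit_hull_def using mn w le_trans by blast
qed

lemma hull_subset:
  assumes b: "b \<in> carrier G" and z: "z \<in> carrier G" and z': "z' \<in> orbit_hull b z"
  shows "orbit_hull b z' \<subseteq> orbit_hull b z"
proof
  fix w assume "w \<in> orbit_hull b z'"
  then obtain k :: nat where k: "b [^] (- int k) \<otimes> z' \<preceq> w" "w \<preceq> b [^] (int k) \<otimes> z'"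
    unfolding orbit_hull_def by blast
  obtain n :: nat where n: "b [^] (- int n) \<otimes> z \<preceq> z'" "z' \<preceq> b [^] (int n) \<otimes> z"
    using z' unfolding orbit_hull_def by blast
  have "b [^] (- int k) \<otimes> (b [^] (- int n) \<otimes> z) \<preceq> b [^] (- int k) \<otimes> z'"
    using n b by (intro le_left) auto
  then have "b [^] (- int k) \<otimes> (b [^] (- int n) \<otimes> z) \<preceq> w" using k le_trans by blast
  moreover have "b [^] (int k) \<otimes> z' \<preceq> b [^] (int k) \<otimes> (b [^] (int n) \<otimes> z)"
    using n b by (intro le_left) auto
  then have "w \<preceq> b [^] (int k) \<otimes> (b [^] (int n) \<otimes> z)" using k le_trans by blast
  ultimately show "w \<in> orbit_hull b z"
    unfolding orbit_hull_def int_pow_act[OF b z] by (intro CollectI exI[of _ "k + n"]) (simp add: add.commute)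
qed

text \<open>
  Points of the hull behave like the base point. The points \<open>z'\<close> and \<open>b \<otimes> z'\<close> both lie above
  \<open>b [^] (- n) \<otimes> z\<close>, so they are comparable; if \<open>b\<close> moved \<open>z'\<close> strictly downwards, then \<open>z'\<close> could not
  be overtaken by the orbit of \<open>z\<close>.
\<close>

lemma hull_rebase:
  assumes b: "b \<in> carrier G" and z: "z \<preceq> b \<otimes> z" and z': "z' \<in> orbit_hull b z"
  shows "z' \<preceq> b \<otimes> z'" "orbit_hull b z' = orbit_hull b z"
proof -
  obtain n0 :: nat where n0: "b [^] (- int n0) \<otimes> z \<preceq> z'" "z' \<preceq> b [^] (int n0) \<otimes> z"
    using z' unfolding orbit_hull_def by blast
  have z_in: "z \<in> carrier G" "z' \<in> carrier G" using z n0 le_carrier by blast+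
  \<comment> \<open>The exponent must be positive, because \<open>b [^] (2 * n) \<otimes> z'\<close> is compared with \<open>b \<otimes> z'\<close>.\<close>
  define n where "n = Suc n0"
  have "b [^] (- int n) \<otimes> z \<preceq> b [^] (- int n0) \<otimes> z" "b [^] (int n0) \<otimes> z \<preceq> b [^] (int n) \<otimes> z"
    unfolding n_def using orbit_mono[OF b z] by auto
  then have n: "b [^] (- int n) \<otimes> z \<preceq> z'" "z' \<preceq> b [^] (int n) \<otimes> z"
    using n0 le_trans by blast+
  have flip: "b [^] (- int n) \<otimes> z' \<preceq> z" "z \<preceq> b [^] (int n) \<otimes> z'"
    using le_left[OF int_pow_closed[OF b, of "- int n"] n(2)] le_left[OF int_pow_closed[OF b, of "int n"] n(1)]
      int_pow_act[OF b z_in(1)] z_in by auto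
  show le: "z' \<preceq> b \<otimes> z'"
  proof (rule ccontr)
    assume neg: "\<not> z' \<preceq> b \<otimes> z'"
    have "b [^] (- int n) \<otimes> z \<preceq> b \<otimes> z'"
    proof -
      have "b [^] (- int n) \<otimes> z \<preceq> b [^] (1 + - int n) \<otimes> z" using orbit_mono[OF b z] by simp
      also have "\<dots> = b \<otimes> (b [^] (- int n) \<otimes> z)" using int_pow_act[OF b z_in(1), of 1 "- int n"] b by simp
      also have "\<dots> \<preceq> b \<otimes> z'" using n b le_left by blast
      finally show ?thesis .
    qed
    then have down: "b \<otimes> z' \<preceq> z'" using comparable n neg by blast
    have "z' \<preceq> b [^] (int n) \<otimes> (b [^] (int n) \<otimes> z')"
      using n(2) le_left[OF int_pow_closed[OF b, of "int n"] flip(2)] le_trans by blast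
    also have "\<dots> = b \<otimes> (b [^] (int (n + n0)) \<otimes> z')"
    proof -
      have "int n + int n = 1 + int (n + n0)" by (simp add: n_def)
      moreover have "b \<otimes> (b [^] (int (n + n0)) \<otimes> z') = b [^] (1 + int (n + n0)) \<otimes> z'"
        using int_pow_act[OF b z_in(2), of 1 "int (n + n0)"] b by simp
      ultimately show ?thesis by (simp only: int_pow_act[OF b z_in(2)])
    qed
    also have "\<dots> \<preceq> b \<otimes> z'"
      unfolding int_pow_int using iterate_ge[OF b down] b by (intro le_left)
    finally show False using neg by blast
  qed
  have "z \<in> orbit_hull b z'" unfolding orbit_hull_def using flip by blast
  then show "orbit_hull b z' = orbit_hull b z" using hull_subset[OF b z_in(1) z'] hull_subset[OF b z_in(2)] by blast
qed

lemma hull_conj: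
  assumes "g \<in> carrier G" "b \<in> carrier G" "z \<in> carrier G" "w \<in> carrier G"
  shows "g \<otimes> w \<in> orbit_hull (g \<otimes> b \<otimes> inv g) (g \<otimes> z) \<longleftrightarrow> w \<in> orbit_hull b z"
proof -
  have "(g \<otimes> b \<otimes> inv g) [^] (i::int) \<otimes> (g \<otimes> z) = g \<otimes> (b [^] i \<otimes> z)" for i
    unfolding conj_int_pow[OF assms(1,2)] using assms by (simp add: group_normalize)
  then show ?thesis unfolding orbit_hull_def using assms by (simp add: le_left_iff)
qed

end

section \<open>Commuting elements with bounded orbits\<close>

locale elliptic_tree_order = tree_order G prec
  for G (structure) and prec (infix "\<preceq>" 50) +
  fixes A
  assumes A_normal: "A \<lhd> G" and A_commutes: "commutes_on A"
    and A_cofinal: "z \<in> carrier G \<Longrightarrow> \<exists>c\<in>A. z \<preceq> c"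
    and A_elliptic: "c \<in> A \<Longrightarrow> \<one> \<preceq> c \<Longrightarrow> \<exists>z\<in>carrier G. \<forall>k::nat. \<not> z \<preceq> c [^] k"
begin

sublocale A: normal A G by (rule A_normal)

lemma int_pow_in_A: "b \<in> A \<Longrightarrow> b [^] (n::int) \<in> A"
proof (cases n rule: int_cases2)
  case (nonneg m)
  have "b \<in> A \<Longrightarrow> b [^] m \<in> A" by (induction m) auto
  moreover assume "b \<in> A"
  ultimately show ?thesis using nonneg by (simp add: int_pow_int)
next
  case (nonpos m)
  have "b \<in> A \<Longrightarrow> b [^] m \<in> A" by (induction m) auto
  moreover assume "b \<in> A"
  ultimately show ?thesis using nonpos by (simp add: int_pow_neg_int)
qed

lemma swap: "a \<in> A \<Longrightarrow> b \<in> A \<Longrightarrow> x \<in> carrier G \<Longrightarrow> a \<otimes> (b \<otimes> x) \<preceq> b \<otimes> (a \<otimes> x)"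
  using A_commutes commutes_on_def by blast

text \<open>
  Commutation converts upper bounds into lower bounds: applying \<open>b [^] (- n)\<close> and \<open>c [^] (- m)\<close> to
  \<open>b [^] n \<otimes> z \<preceq> c [^] m \<otimes> z\<close> gives \<open>c [^] (- m) \<otimes> z \<preceq> b [^] (- n) \<otimes> z\<close>, although the downward
  orbits could run along different branches.
\<close>

lemma hull_subset_commuting:
  assumes b: "b \<in> A" "z \<preceq> b \<otimes> z" and c: "c \<in> A" "z \<preceq> c \<otimes> z"
    and dominated: "\<And>n::nat. \<exists>m::nat. b [^] (int n) \<otimes> z \<preceq> c [^] (int m) \<otimes> z"
  shows "orbit_hull b z \<subseteq> orbit_hull c z"
proof
  fix w assume "w \<in> orbit_hull b z"
  then obtain n :: nat where n: "b [^] (- int n) \<otimes> z \<preceq> w" "w \<preceq> b [^] (int n) \<otimes> z"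
    unfolding orbit_hull_def by blast
  obtain m :: nat where m: "b [^] (int n) \<otimes> z \<preceq> c [^] (int m) \<otimes> z" using dominated by blast
  have z: "z \<in> carrier G" using b le_carrier by blast
  have in_G: "b \<in> carrier G" "c \<in> carrier G" using b c by auto
  have "c [^] (- int m) \<otimes> z = c [^] (- int m) \<otimes> (b [^] (- int n) \<otimes> (b [^] (int n) \<otimes> z))"
    using int_pow_act[OF in_G(1) z] z by simp
  also have "\<dots> \<preceq> c [^] (- int m) \<otimes> (b [^] (- int n) \<otimes> (c [^] (int m) \<otimes> z))"
    using m in_G by (intro le_left) auto
  also have "\<dots> \<preceq> b [^] (- int n) \<otimes> (c [^] (- int m) \<otimes> (c [^] (int m) \<otimes> z))"
    using b c z in_G int_pow_in_A by (intro swap) auto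
  also have "\<dots> = b [^] (- int n) \<otimes> z"
    using int_pow_act[OF in_G(2) z] z by simp
  finally have "c [^] (- int m) \<otimes> z \<preceq> w" using n le_trans by blast
  moreover have "w \<preceq> c [^] (int m) \<otimes> z" using n m le_trans by blast
  ultimately show "w \<in> orbit_hull c z" unfolding orbit_hull_def by blast
qed

lemma hull_nested:
  assumes b: "b \<in> A" "z \<preceq> b \<otimes> z" and c: "c \<in> A" "z \<preceq> c \<otimes> z"
  shows "orbit_hull b z \<subseteq> orbit_hull c z \<or> orbit_hull c z \<subseteq> orbit_hull b z"
proof (cases "\<forall>n::nat. \<exists>m::nat. b [^] (int n) \<otimes> z \<preceq> c [^] (int m) \<otimes> z")
  case True
  then show ?thesis using hull_subset_commuting[OF b c] by blast
next
  case False
  then obtain n :: nat where n: "\<And>m::nat. \<not> b [^] (int n) \<otimes> z \<preceq> c [^] (int m) \<otimes> z" by blast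
  have z: "z \<in> carrier G" using b le_carrier by blast
  have up: "z \<preceq> d [^] (int k) \<otimes> z" if "d \<in> A" "z \<preceq> d \<otimes> z" for d and k :: nat
    using orbit_mono[of d z 0 "int k"] that z by simp
  then have "c [^] (int m) \<otimes> z \<preceq> b [^] (int n) \<otimes> z" for m :: nat
    using n[of m] comparable[OF up[OF b] up[OF c]] by blast
  then show ?thesis using hull_subset_commuting[OF c b] by blast
qed

lemma hulls_nested:
  assumes b: "b \<in> A" "x \<preceq> b \<otimes> x" and c: "c \<in> A" "y \<preceq> c \<otimes> y"
    and z: "z \<in> orbit_hull b x" "z \<in> orbit_hull c y"
  shows "orbit_hull b x \<subseteq> orbit_hull c y \<or> orbit_hull c y \<subseteq> orbit_hull b x"
  using hull_nested[of b z c] hull_rebase[OF _ b(2) z(1)] hull_rebase[OF _ c(2) z(2)] b c by auto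

text \<open>
  Because \<open>A\<close> commutes, the translate by \<open>c\<close> of a hull of \<open>b\<close> is again a hull of \<open>b\<close>, not just of a
  conjugate of \<open>b\<close>.
\<close>

lemma hull_translate:
  assumes b: "b \<in> A" and c: "c \<in> A" and z: "z \<in> carrier G" and w: "w \<in> carrier G"
  shows "c \<otimes> w \<in> orbit_hull b (c \<otimes> z) \<longleftrightarrow> w \<in> orbit_hull b z"
proof -
  have 1: "b [^] i \<otimes> (c \<otimes> z) \<preceq> c \<otimes> w \<longleftrightarrow> b [^] i \<otimes> z \<preceq> w" for i :: int
  proof -
    have "b [^] i \<otimes> (c \<otimes> z) \<preceq> c \<otimes> w \<longleftrightarrow> c \<otimes> (b [^] i \<otimes> z) \<preceq> c \<otimes> w"
      using swap[of "b [^] i" c z] swap[of c "b [^] i" z] int_pow_in_A b c z le_trans by blast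
    then show ?thesis using le_left_iff b c z w by simp
  qed
  have 2: "c \<otimes> w \<preceq> b [^] i \<otimes> (c \<otimes> z) \<longleftrightarrow> w \<preceq> b [^] i \<otimes> z" for i :: int
  proof -
    have "c \<otimes> w \<preceq> b [^] i \<otimes> (c \<otimes> z) \<longleftrightarrow> c \<otimes> w \<preceq> c \<otimes> (b [^] i \<otimes> z)"
      using swap[of "b [^] i" c z] swap[of c "b [^] i" z] int_pow_in_A b c z le_trans by blast
    then show ?thesis using le_left_iff b c z w by simp
  qed
  show ?thesis unfolding orbit_hull_def by (simp add: 1 2)
qed

lemma hull_translate_disjoint_or_equal:
  assumes b: "b \<in> A" and c: "c \<in> A" and x: "x \<preceq> b \<otimes> x"
    and w: "w \<in> orbit_hull b x" "w \<in> orbit_hull b (c \<otimes> x)"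
  shows "orbit_hull b (c \<otimes> x) = orbit_hull b x"
proof -
  have x_in: "x \<in> carrier G" using x le_carrier by blast
  have "c \<otimes> x \<preceq> c \<otimes> (b \<otimes> x)" using x c by (intro le_left) auto
  also have "\<dots> \<preceq> b \<otimes> (c \<otimes> x)" using b c x_in by (intro swap)
  finally show ?thesis using hull_rebase(2)[OF _ x w(1)] hull_rebase(2)[OF _ _ w(2)] b by auto
qed

lemma hull_one_bounded:
  assumes d: "d \<in> A" "\<one> \<preceq> d" shows "\<exists>w\<in>carrier G. \<forall>z\<in>orbit_hull d \<one>. z \<preceq> w"
proof -
  obtain z0 where z0: "z0 \<in> carrier G" "\<And>k::nat. \<not> z0 \<preceq> d [^] k" using A_elliptic[OF d] by blast
  obtain u where u: "z0 \<preceq> u" "\<one> \<preceq> u" using directed[of z0 \<one>] z0 by auto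
  have d_G: "d \<in> carrier G" using d by simp
  have "d [^] k \<preceq> u" for k :: nat
  proof -
    have "\<one> \<preceq> d [^] k" using iterate_le[of d \<one> k] d by simp
    then show ?thesis using comparable[OF _ u(2)] z0(2)[of k] u(1) le_trans by blast
  qed
  then have "z \<preceq> u" if "z \<in> orbit_hull d \<one>" for z
    using that le_trans d_G unfolding orbit_hull_def by (auto simp: int_pow_int)
  then show ?thesis using u le_carrier by blast
qed

text \<open>
  Hulls are directed. To join \<open>x\<close> to \<open>\<one>\<close>, take an upper bound \<open>w\<close> of both, a hull through \<open>\<one>\<close>
  that contains \<open>w\<close> and a hull through \<open>x\<close> that contains \<open>w\<close>. These two meet in \<open>w\<close>, so the larger one
  contains \<open>\<one>\<close> and \<open>x\<close>.
\<close>

lemma finite_subset_hull: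
  assumes "finite F" "F \<subseteq> carrier G"
  shows "\<exists>d\<in>A. \<one> \<preceq> d \<and> F \<subseteq> orbit_hull d \<one>"
  using assms
proof induction
  case empty
  show ?case using A.one_closed le_refl[of \<one>] by auto
next
  case (insert x F)
  then obtain d where d: "d \<in> A" "\<one> \<preceq> d" "F \<subseteq> orbit_hull d \<one>" by auto
  have x: "x \<in> carrier G" using insert by simp
  obtain w where w: "\<one> \<preceq> w" "x \<preceq> w" using directed[of \<one> x] x by auto
  have w_in: "w \<in> carrier G" using w le_carrier by blast
  obtain c where c: "c \<in> A" "w \<preceq> c" using A_cofinal w_in by blast
  have c1: "\<one> \<preceq> c" using w c le_trans by blast
  have c_in: "c \<in> carrier G" using c by simp
  have wc: "w \<in> orbit_hull c \<one>"
  proof -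
    have "inv c \<preceq> \<one>" using le_inv_left[of c \<one> \<one>] c1 c_in by simp
    then have "inv c \<preceq> w" using w le_trans by blast
    then show ?thesis unfolding orbit_hull_def using c c_in
      by (intro CollectI exI[of _ "1::nat"]) (simp add: int_pow_neg)
  qed
  obtain e where e: "e \<in> A" "w \<preceq> e \<otimes> x"
  proof -
    obtain e' where e': "e' \<in> A" "inv x \<otimes> w \<preceq> e'" using A_cofinal[of "inv x \<otimes> w"] x w_in by auto
    have "w \<preceq> x \<otimes> e'" using e' le_inv_left[of x w e'] x w_in by simp
    also have "x \<otimes> e' = (x \<otimes> e' \<otimes> inv x) \<otimes> x" using e' x by (simp add: group_normalize)
    finally show ?thesis using A.inv_op_closed2[OF x e'(1)] by (rule that[rotated])
  qed
  have ex: "x \<preceq> e \<otimes> x" using w e le_trans by blast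
  have e_in: "e \<in> carrier G" using e by simp
  have we: "w \<in> orbit_hull e x"
  proof -
    have "inv e \<otimes> x \<preceq> x" using le_inv_left[of e x x] ex x e_in by simp
    then have "inv e \<otimes> x \<preceq> w" using w le_trans by blast
    then show ?thesis unfolding orbit_hull_def using e e_in
      by (intro CollectI exI[of _ "1::nat"]) (simp add: int_pow_neg)
  qed
  have one_c: "\<one> \<in> orbit_hull c \<one>" using hull_self[of c \<one>] c_in c1 by simp
  have x_e: "x \<in> orbit_hull e x" using hull_self[OF e_in ex] .
  \<comment> \<open>Whichever of the two hulls through \<open>w\<close> is larger contains both \<open>\<one>\<close> and \<open>x\<close>.\<close>
  obtain d1 where d1: "d1 \<in> A" "\<one> \<preceq> d1" "x \<in> orbit_hull d1 \<one>" "\<one> \<in> orbit_hull d1 \<one>"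
  proof (cases "orbit_hull e x \<subseteq> orbit_hull c \<one>")
    case True
    then show ?thesis using x_e c c1 one_c that by blast
  next
    case False
    then have "orbit_hull c \<one> \<subseteq> orbit_hull e x"
      using hulls_nested[OF c(1) _ e(1) ex wc we] c1 c_in by auto
    then have "\<one> \<in> orbit_hull e x" using one_c by blast
    from hull_rebase[OF e_in ex this] show ?thesis using e e_in x_e \<open>\<one> \<in> orbit_hull e x\<close> by (intro that[of e]) auto
  qed
  have "\<one> \<in> orbit_hull d \<one>" using hull_self[of d \<one>] d by simp
  then have "orbit_hull d1 \<one> \<subseteq> orbit_hull d \<one> \<or> orbit_hull d \<one> \<subseteq> orbit_hull d1 \<one>"
    using hulls_nested[OF d1(1) _ d(1) _ d1(4)] d d1 by simp
  then show ?case using d d1 by blast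
qed

end

section \<open>The tree of leaves\<close>

text \<open>
  The hull of \<open>a\<close> at \<open>\<one>\<close> is the base leaf. That it contains the generators makes consecutive
  translates along a word overlap.
\<close>

locale leaf_tree_order = elliptic_tree_order G prec A
  for G (structure) and prec (infix "\<preceq>" 50) and A +
  fixes S a
  assumes S_generates: "S \<subseteq> carrier G" "generate G S = carrier G"
    and a_in: "a \<in> A" and one_le_a: "\<one> \<preceq> a" and S_hull: "S \<subseteq> orbit_hull a \<one>"
begin

definition leaf :: "'a \<Rightarrow> 'a set" where
  "leaf x = {w \<in> carrier G. inv x \<otimes> w \<in> orbit_hull a \<one>}"

lemma a_G [simp]: "a \<in> carrier G" using a_in by simp

lemma one_hull: "\<one> \<in> orbit_hull a \<one>"
  using hull_self[of a \<one>] one_le_a by simp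

lemma hull_carrier: "orbit_hull b z \<subseteq> carrier G"
  unfolding orbit_hull_def using le_carrier by blast

lemma leaf_eq_hull:
  assumes x: "x \<in> carrier G"
  shows "leaf x = orbit_hull (x \<otimes> a \<otimes> inv x) x" "x \<otimes> a \<otimes> inv x \<in> A" "x \<preceq> (x \<otimes> a \<otimes> inv x) \<otimes> x"
proof -
  have "w \<in> leaf x \<longleftrightarrow> w \<in> orbit_hull (x \<otimes> a \<otimes> inv x) x" if w: "w \<in> carrier G" for w
    using hull_conj[of x a \<one> "inv x \<otimes> w"] x w by (simp add: leaf_def)
  then show "leaf x = orbit_hull (x \<otimes> a \<otimes> inv x) x" using hull_carrier leaf_def by blast
  show "x \<otimes> a \<otimes> inv x \<in> A" using A.inv_op_closed2[OF x a_in] .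
  have "x \<otimes> \<one> \<preceq> x \<otimes> a" using one_le_a x by (intro le_left)
  then show "x \<preceq> (x \<otimes> a \<otimes> inv x) \<otimes> x" using x by (simp add: group_normalize)
qed

lemma leaf_self: "x \<in> carrier G \<Longrightarrow> x \<in> leaf x"
  using one_hull by (simp add: leaf_def)

lemma leaf_one: "leaf \<one> = orbit_hull a \<one>"
  using hull_carrier[of a \<one>] by (auto simp: leaf_def subset_iff)

lemma leaf_carrier: "leaf x \<subseteq> carrier G"
  by (auto simp: leaf_def)

lemma leaf_mult:
  assumes "g \<in> carrier G" "x \<in> carrier G" "w \<in> carrier G"
  shows "w \<in> leaf (g \<otimes> x) \<longleftrightarrow> inv g \<otimes> w \<in> leaf x"
  using assms by (simp add: leaf_def group_normalize)

lemma leaf_mult_mono: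
  assumes "g \<in> carrier G" "x \<in> carrier G" "y \<in> carrier G" "leaf x \<subseteq> leaf y"
  shows "leaf (g \<otimes> x) \<subseteq> leaf (g \<otimes> y)"
  using assms leaf_mult leaf_carrier by blast

lemma leaves_nested:
  assumes "x \<in> carrier G" "y \<in> carrier G" "z \<in> leaf x" "z \<in> leaf y"
  shows "leaf x \<subseteq> leaf y \<or> leaf y \<subseteq> leaf x"
  using hulls_nested[OF leaf_eq_hull(2,3)[OF assms(1)] leaf_eq_hull(2,3)[OF assms(2)]] assms
  by (simp add: leaf_eq_hull(1))

text \<open>
  This is why \<open>A\<close> will act trivially on leaves: a leaf cannot be moved by \<open>A\<close> without being moved off
  itself.
\<close>

lemma leaf_translate_eq:
  assumes x: "x \<in> carrier G" and c: "c \<in> A" and w: "w \<in> leaf x" "w \<in> leaf (c \<otimes> x)"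
  shows "leaf (c \<otimes> x) = leaf x"
proof -
  define b where "b = x \<otimes> a \<otimes> inv x"
  have b: "leaf x = orbit_hull b x" "b \<in> A" "x \<preceq> b \<otimes> x" using leaf_eq_hull[OF x] b_def by auto
  have "v \<in> leaf (c \<otimes> x) \<longleftrightarrow> v \<in> orbit_hull b (c \<otimes> x)" if v: "v \<in> carrier G" for v
    using leaf_mult[of c x v] hull_translate[OF b(2) c x, of "inv c \<otimes> v"] v x c b(1) by simp
  then have "leaf (c \<otimes> x) = orbit_hull b (c \<otimes> x)" using hull_carrier leaf_carrier by blast
  then show ?thesis using hull_translate_disjoint_or_equal[OF b(2) c b(3)] w b(1) by simp
qed

lemma leaf_convex:
  assumes "x \<in> carrier G" "y \<in> leaf x" "y' \<in> leaf x" "y \<preceq> w" "w \<preceq> y'"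
  shows "w \<in> leaf x"
  using assms hull_convex[of y "x \<otimes> a \<otimes> inv x" x y' w] leaf_eq_hull[of x] by auto

text \<open>
  A bounded hull is not all of \<open>G\<close>, so some edge of the Cayley graph, from \<open>g\<close> in the hull to \<open>v\<close>
  outside, leaves it. A single leaf contains both endpoints of this edge; it meets the hull and is
  not contained in it, so it contains the hull.
\<close>

lemma hull_subset_leaf:
  assumes d: "d \<in> A" "\<one> \<preceq> d" shows "\<exists>g\<in>carrier G. orbit_hull d \<one> \<subseteq> leaf g"
proof -
  have d_G: "d \<in> carrier G" "\<one> \<preceq> d \<otimes> \<one>" using d by auto
  have one_in: "\<one> \<in> orbit_hull d \<one>" using hull_self[OF d_G] .
  obtain w where w: "\<And>z. z \<in> orbit_hull d \<one> \<Longrightarrow> z \<preceq> w" using hull_one_bounded[OF d] by blast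
  obtain z where z: "z \<in> carrier G" "z \<notin> orbit_hull d \<one>" using unbounded[of w] w by blast
  have step: "\<exists>g\<in>orbit_hull d \<one>. \<exists>s\<in>S. g \<otimes> s \<notin> orbit_hull d \<one> \<or> g \<otimes> inv s \<notin> orbit_hull d \<one>"
  proof (rule ccontr)
    assume "\<not> ?thesis"
    then have closed: "g \<otimes> s \<in> orbit_hull d \<one>" "g \<otimes> inv s \<in> orbit_hull d \<one>" if "g \<in> orbit_hull d \<one>" "s \<in> S" for g s
      using that by auto
    have "k \<in> carrier G \<and> (\<forall>g\<in>orbit_hull d \<one>. g \<otimes> k \<in> orbit_hull d \<one>)" if "k \<in> generate G S" for k
      using that
    proof induction
      case one
      then show ?case using hull_carrier[of d \<one>] by (auto simp: subset_iff)
    next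
      case (incl h)
      then show ?case using closed S_generates by auto
    next
      case (inv h)
      then show ?case using closed S_generates by auto
    next
      case (eng h1 h2)
      have "g \<otimes> (h1 \<otimes> h2) \<in> orbit_hull d \<one>" if g: "g \<in> orbit_hull d \<one>" for g
      proof -
        have "g \<otimes> (h1 \<otimes> h2) = (g \<otimes> h1) \<otimes> h2" using eng g hull_carrier by (simp add: m_assoc subset_iff)
        then show ?thesis using eng g by simp
      qed
      then show ?case using eng by simp
    qed
    then have "\<one> \<otimes> z \<in> orbit_hull d \<one>" using z one_in S_generates by blast
    then show False using z by simp
  qed
  have nested: "orbit_hull d \<one> \<subseteq> leaf x" if "x \<in> carrier G" "g \<in> orbit_hull d \<one>" "g \<in> leaf x" "v \<in> leaf x" "v \<notin> orbit_hull d \<one>" for x g v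
    using hulls_nested[OF d(1) d_G(2) leaf_eq_hull(2,3)[OF that(1)] that(2)] that leaf_eq_hull(1)[OF that(1)] by auto
  obtain g s where gs: "g \<in> orbit_hull d \<one>" "s \<in> S" and out: "g \<otimes> s \<notin> orbit_hull d \<one> \<or> g \<otimes> inv s \<notin> orbit_hull d \<one>"
    using step by blast
  have in_G: "g \<in> carrier G" "s \<in> carrier G" using gs hull_carrier S_generates by auto
  have s_hull: "s \<in> orbit_hull a \<one>" using S_hull gs by blast
  from out show ?thesis
  proof
    assume out: "g \<otimes> s \<notin> orbit_hull d \<one>"
    have "g \<otimes> s \<in> leaf g" using in_G s_hull by (simp add: leaf_def)
    then show ?thesis using nested[OF in_G(1) gs(1) leaf_self[OF in_G(1)] _ out] in_G by blast
  next
    assume out: "g \<otimes> inv s \<notin> orbit_hull d \<one>"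
    have "g \<in> leaf (g \<otimes> inv s)" using in_G s_hull by (simp add: leaf_def group_normalize)
    then show ?thesis using nested[OF _ gs(1) _ leaf_self out] in_G by auto
  qed
qed

lemma finite_subset_leaf:
  assumes "finite F" "F \<subseteq> carrier G" shows "\<exists>g\<in>carrier G. F \<subseteq> leaf g"
proof -
  obtain d where d: "d \<in> A" "\<one> \<preceq> d" "F \<subseteq> orbit_hull d \<one>" using finite_subset_hull[OF assms] by auto
  obtain g where "g \<in> carrier G" "orbit_hull d \<one> \<subseteq> leaf g" using hull_subset_leaf[OF d(1,2)] by auto
  then show ?thesis using d(3) by (intro bexI[of _ g]) auto
qed

lemma leaves_directed:
  assumes s: "s \<in> carrier G" and F: "finite F" "F \<subseteq> carrier G"
  shows "\<exists>g\<in>carrier G. leaf s \<subseteq> leaf g \<and> \<one> \<in> leaf g \<and> F \<subseteq> leaf g"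
proof -
  obtain g where g: "g \<in> carrier G" "insert \<one> (insert s F) \<subseteq> leaf g"
    using finite_subset_leaf[of "insert \<one> (insert s F)"] s F by auto
  then have "leaf s \<subseteq> leaf g \<or> leaf g \<subseteq> leaf s" using leaves_nested[OF s g(1)] leaf_self[OF s] by blast
  then show ?thesis using g s by blast
qed

text \<open>
  Inclusion of leaves up to translation by \<open>A\<close>.
\<close>

definition leaf_le :: "'a \<Rightarrow> 'a \<Rightarrow> bool" where
  "leaf_le x y \<longleftrightarrow> x \<in> carrier G \<and> y \<in> carrier G \<and> (\<exists>c\<in>A. leaf (c \<otimes> x) \<subseteq> leaf y)"

lemma leaf_subset_imp_le: "x \<in> carrier G \<Longrightarrow> y \<in> carrier G \<Longrightarrow> leaf x \<subseteq> leaf y \<Longrightarrow> leaf_le x y"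
  unfolding leaf_le_def using A.one_closed by (intro conjI bexI[of _ \<one>]) auto

lemma tree_order_leaf_le: "tree_order G leaf_le"
proof (unfold_locales, goal_cases)
  case (1 x y)
  then show ?case by (simp add: leaf_le_def)
next
  case (2 x)
  then show ?case by (simp add: leaf_subset_imp_le)
next
  case (3 x y z)
  then obtain c d where cd: "c \<in> A" "d \<in> A" "leaf (c \<otimes> x) \<subseteq> leaf y" "leaf (d \<otimes> y) \<subseteq> leaf z"
    and in_G: "x \<in> carrier G" "y \<in> carrier G" "z \<in> carrier G" unfolding leaf_le_def by auto
  have "leaf (d \<otimes> (c \<otimes> x)) \<subseteq> leaf (d \<otimes> y)" using cd in_G by (intro leaf_mult_mono) auto
  then have "leaf (d \<otimes> c \<otimes> x) \<subseteq> leaf z" using cd in_G by (simp add: m_assoc)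
  then show ?case unfolding leaf_le_def using cd in_G by blast
next
  case (4 g x y)
  then obtain c where c: "c \<in> A" "leaf (c \<otimes> x) \<subseteq> leaf y"
    and in_G: "x \<in> carrier G" "y \<in> carrier G" unfolding leaf_le_def by auto
  have "(g \<otimes> c \<otimes> inv g) \<otimes> (g \<otimes> x) = g \<otimes> (c \<otimes> x)" using c 4 in_G by (simp add: group_normalize)
  moreover have "leaf (g \<otimes> (c \<otimes> x)) \<subseteq> leaf (g \<otimes> y)" using c 4 in_G by (intro leaf_mult_mono) auto
  moreover have "g \<otimes> c \<otimes> inv g \<in> A" using A.inv_op_closed2 c 4 by simp
  ultimately have "\<exists>e\<in>A. leaf (e \<otimes> (g \<otimes> x)) \<subseteq> leaf (g \<otimes> y)" by metis
  then show ?case unfolding leaf_le_def using 4 in_G by simp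
next
  case (5 z x y)
  then obtain c d where cd: "c \<in> A" "d \<in> A" "leaf (c \<otimes> z) \<subseteq> leaf x" "leaf (d \<otimes> z) \<subseteq> leaf y"
    and in_G: "x \<in> carrier G" "y \<in> carrier G" "z \<in> carrier G" unfolding leaf_le_def by auto
  define e where "e = c \<otimes> inv d"
  have e: "e \<in> A" using cd by (simp add: e_def)
  have "leaf (e \<otimes> (d \<otimes> z)) \<subseteq> leaf (e \<otimes> y)" using cd e in_G by (intro leaf_mult_mono) auto
  then have "leaf (c \<otimes> z) \<subseteq> leaf (e \<otimes> y)" using cd in_G by (simp add: e_def group_normalize)
  moreover have "c \<otimes> z \<in> leaf (c \<otimes> z)" using cd in_G by (intro leaf_self) auto
  ultimately have nested: "leaf x \<subseteq> leaf (e \<otimes> y) \<or> leaf (e \<otimes> y) \<subseteq> leaf x"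
    using leaves_nested[of x "e \<otimes> y" "c \<otimes> z"] cd e in_G by auto
  have "leaf (inv e \<otimes> x) \<subseteq> leaf y" if "leaf x \<subseteq> leaf (e \<otimes> y)"
    using leaf_mult_mono[OF _ _ _ that, of "inv e"] e in_G by simp
  then have "(\<exists>c\<in>A. leaf (c \<otimes> x) \<subseteq> leaf y) \<or> (\<exists>c\<in>A. leaf (c \<otimes> y) \<subseteq> leaf x)"
    using nested e A.m_inv_closed by blast
  then show ?case unfolding leaf_le_def using in_G by blast
next
  case (6 x y)
  obtain g where g: "g \<in> carrier G" "leaf x \<subseteq> leaf g" "\<one> \<in> leaf g" using leaves_directed[of x "{}"] 6 by auto
  obtain k where k: "k \<in> carrier G" "leaf y \<subseteq> leaf k" "\<one> \<in> leaf k" using leaves_directed[of y "{}"] 6 by auto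
  have "leaf g \<subseteq> leaf k \<or> leaf k \<subseteq> leaf g" using leaves_nested g k by blast
  then have "\<exists>z\<in>carrier G. leaf x \<subseteq> leaf z \<and> leaf y \<subseteq> leaf z" using g k by blast
  then show ?case using leaf_subset_imp_le 6 by blast
next
  case 7
  obtain w where w: "\<And>z. z \<in> orbit_hull a \<one> \<Longrightarrow> z \<preceq> w" using hull_one_bounded[OF a_in one_le_a] by blast
  obtain z where z: "z \<in> carrier G" "z \<notin> orbit_hull a \<one>" using unbounded[of w] w by blast
  obtain g where g: "g \<in> carrier G" "leaf \<one> \<subseteq> leaf g" "z \<in> leaf g" using leaves_directed[of \<one> "{z}"] z by auto
  have "\<not> leaf_le g \<one>"
  proof
    assume "leaf_le g \<one>"
    then obtain c where c: "c \<in> A" "leaf (c \<otimes> g) \<subseteq> leaf \<one>" unfolding leaf_le_def by blast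
    have "c \<otimes> g \<in> leaf (c \<otimes> g)" using c g by (intro leaf_self) auto
    then have "leaf (c \<otimes> g) = leaf g" using leaf_translate_eq[OF g(1) c(1), of "c \<otimes> g"] c g by blast
    then show False using c g z leaf_one by blast
  qed
  then show ?case using g by blast
qed

lemma acts_trivially_leaf_le: "tree_order.acts_trivially G leaf_le A"
proof -
  interpret L: tree_order G leaf_le by (rule tree_order_leaf_le)
  show ?thesis unfolding L.acts_trivially_def leaf_le_def by fastforce
qed

text \<open>
  The pulled back height of \<open>x\<close> is the infimum of the heights of the leaves that contain both \<open>\<one>\<close>
  and \<open>x\<close>. The base point \<open>\<one>\<close> lies in at most one leaf of each class modulo \<open>A\<close>. Moving the base point to
  \<open>inv k\<close> makes no difference once \<open>x\<close> lies outside a leaf that contains \<open>\<one>\<close> and \<open>inv k\<close>, and this gives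
  the equivariance.
\<close>

lemma affine_height_leaf_le:
  assumes "has_affine_height G leaf_le"
  shows "has_affine_height G prec"
proof -
  obtain \<psi> h' where psi: "\<psi> \<in> hom G Aff" "irreducible_action G \<psi>"
    "affine_height G (carrier G) leaf_le (\<lambda>g x. g \<otimes> x) \<psi> h'"
    using assms has_affine_height_def by blast
  define U where "U x = {g \<in> carrier G. \<one> \<in> leaf g \<and> x \<in> leaf g}" for x
  \<comment> \<open>A leaf is bounded, so high elements lie outside it.\<close>
  have escape: "\<exists>t\<in>carrier G. \<forall>x\<in>carrier G. t \<preceq> x \<longrightarrow> x \<notin> leaf g" if g: "g \<in> carrier G" for g
  proof -
    obtain w where w: "w \<in> carrier G" "\<And>z. z \<in> orbit_hull a \<one> \<Longrightarrow> z \<preceq> w" using hull_one_bounded[OF a_in one_le_a] by blast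
    obtain z where z: "z \<in> carrier G" "\<not> z \<preceq> w" using unbounded by blast
    have "x \<notin> leaf g" if "g \<otimes> z \<preceq> x" for x
    proof
      assume "x \<in> leaf g"
      then have "inv g \<otimes> x \<preceq> w" using w by (simp add: leaf_def)
      then have "x \<preceq> g \<otimes> w" using le_inv_left g w that le_carrier by blast
      then have "g \<otimes> z \<preceq> g \<otimes> w" using that le_trans by blast
      then show False using le_left_iff g z w by blast
    qed
    then show ?thesis using g z by (intro bexI[of _ "g \<otimes> z"]) auto
  qed
  have contains: "leaf g \<subseteq> leaf k" if "g \<in> carrier G" "k \<in> carrier G" "z \<in> leaf g" "z \<in> leaf k" "x \<in> leaf k" "x \<notin> leaf g" for g k x z
    using leaves_nested[OF that(1-4)] that by blast
  have "affine_height G (carrier G) prec (\<lambda>g x. g \<otimes> x) \<psi> (\<lambda>x. Inf (h' ` U x))"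
  proof (rule affine_height_Inf[OF psi(1,3)])
    show "\<exists>u\<in>carrier G. s \<preceq> u \<and> t \<preceq> u" if "s \<in> carrier G" "t \<in> carrier G" for s t
      using directed that le_carrier by blast
    show "x \<preceq> z" if "x \<preceq> y" "y \<preceq> z" for x y z using that le_trans by blast
    show "\<exists>t\<in>carrier G. \<forall>x\<in>carrier G. \<forall>x'\<in>carrier G. t \<preceq> x \<longrightarrow> x \<preceq> x' \<longrightarrow> U x' \<subseteq> U x"
      using leaf_convex by (intro bexI[of _ \<one>]) (auto simp: U_def)
    show "\<exists>t\<in>carrier G. \<forall>x\<in>carrier G. t \<preceq> x \<longrightarrow> U x \<noteq> {}"
    proof (intro bexI ballI impI)
      fix x assume "x \<in> carrier G"
      then obtain g where "g \<in> carrier G" "{\<one>, x} \<subseteq> leaf g" using finite_subset_leaf[of "{\<one>, x}"] by auto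
      then show "U x \<noteq> {}" by (auto simp: U_def)
    qed (rule one_closed)
  next
    fix s assume s: "s \<in> carrier G"
    obtain g where g: "g \<in> carrier G" "leaf s \<subseteq> leaf g" "\<one> \<in> leaf g" using leaves_directed[of s "{}"] s by auto
    obtain t where t: "t \<in> carrier G" "\<And>x. x \<in> carrier G \<Longrightarrow> t \<preceq> x \<Longrightarrow> x \<notin> leaf g" using escape[OF g(1)] by blast
    have "y \<in> carrier G \<and> leaf_le s y" if "x \<in> carrier G" "t \<preceq> x" "y \<in> U x" for x y
      using contains[OF g(1) _ g(3), of y x] t(2)[OF that(1,2)] that(3) g(2) leaf_subset_imp_le[OF s, of y]
      unfolding U_def by blast
    then show "\<exists>t\<in>carrier G. \<forall>x\<in>carrier G. t \<preceq> x \<longrightarrow> (\<forall>y\<in>U x. y \<in> carrier G \<and> leaf_le s y)"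
      using t by blast
  next
    fix k assume k: "k \<in> carrier G"
    obtain g where g: "g \<in> carrier G" "{\<one>, inv k} \<subseteq> leaf g" using finite_subset_leaf[of "{\<one>, inv k}"] k by auto
    obtain t where t: "t \<in> carrier G" "\<And>x. x \<in> carrier G \<Longrightarrow> t \<preceq> x \<Longrightarrow> x \<notin> leaf g" using escape[OF g(1)] by blast
    have "U (k \<otimes> x) = (\<lambda>y. k \<otimes> y) ` U x" if x: "x \<in> carrier G" "t \<preceq> x" for x
    proof -
      have one_iff: "\<one> \<in> leaf y \<longleftrightarrow> inv k \<in> leaf y" if "y \<in> carrier G" "x \<in> leaf y" for y
        using contains[OF g(1) that(1) _ _ that(2) t(2)[OF x]] g(2) by blast
      have "k \<otimes> y \<in> U (k \<otimes> x) \<longleftrightarrow> y \<in> U x" if y: "y \<in> carrier G" for y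
        using leaf_mult[OF k y, of \<one>] leaf_mult[OF k y, of "k \<otimes> x"] one_iff[OF y] k y x unfolding U_def by auto
      moreover have "z \<in> (\<lambda>y. k \<otimes> y) ` U x" if "z \<in> U (k \<otimes> x)" "inv k \<otimes> z \<in> U x" for z
        using that k by (intro image_eqI[of _ _ "inv k \<otimes> z"]) (auto simp: U_def)
      moreover have "inv k \<otimes> z \<in> U x" if "z \<in> U (k \<otimes> x)" for z
        using calculation(1)[of "inv k \<otimes> z"] that k unfolding U_def by auto
      ultimately show ?thesis unfolding U_def by blast
    qed
    then show "\<exists>t\<in>carrier G. \<forall>x\<in>carrier G. t \<preceq> x \<longrightarrow> U (k \<otimes> x) = (\<lambda>y. k \<otimes> y) ` U x"
      using t by blast
  qed
  then show ?thesis using psi has_affine_height_def by blast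
qed

end

section \<open>Climbing the derived series\<close>

text \<open>
  Downward induction on \<open>i\<close>: as long as all multipliers are 1, the kernel of the translation number
  is collapsed and the next term of the series takes over, with the same \<open>f\<close>.
\<close>

lemma (in group) hyperbolic_has_affine_height:
  assumes "i \<le> k"
    and normal: "\<And>i. i \<le> k \<Longrightarrow> N i \<lhd> G" and incl: "\<And>i. i < k \<Longrightarrow> N i \<subseteq> N (Suc i)"
    and commutators: "\<And>i b c. i < k \<Longrightarrow> b \<in> N (Suc i) \<Longrightarrow> c \<in> N (Suc i) \<Longrightarrow> b \<otimes> c \<otimes> inv b \<otimes> inv c \<in> N i"
    and fin: "finite (rcosets N k)"
    and hyp: "hyperbolic_tree_order G prec (N i) f"
  shows "has_affine_height G prec"
  using \<open>i \<le> k\<close> hyp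
proof (induction i arbitrary: prec rule: inc_induct)
  case base
  then interpret hyperbolic_tree_order G prec "N k" f .
  show ?case using has_affine_height_if_finite_index fin by blast
next
  case (step n)
  interpret hyperbolic_tree_order G prec "N n" f by (rule step.prems)
  show ?case
  proof (cases "\<exists>g\<in>carrier G. multiplier g \<noteq> 1")
    case True
    then show ?thesis using has_affine_height_if_nontrivial_multiplier by blast
  next
    case False
    then have "hyperbolic_tree_order G (le_mod tau_kernel) (N (Suc n)) f"
      using step.hyps by (intro hyperbolic_mod_tau_kernel normal incl commutators) auto
    then have "has_affine_height G (le_mod tau_kernel)" by (rule step.IH)
    then show ?thesis using affine_height_le_mod tau_kernel_normal by blast
  qed
qed

text \<open>
  Otherwise an upper bound of finitely many coset representatives would be a greatest element.
\<close>

lemma (in tree_order) not_acts_trivially_if_finite_index: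
  assumes N: "N \<lhd> G" and fin: "finite (rcosets N)" shows "\<not> acts_trivially N"
proof
  assume triv: "acts_trivially N"
  interpret N: normal N G by fact
  define rep where "rep D = (SOME r. r \<in> D)" for D :: "'a set"
  have rep: "rep D \<in> D" if D: "D \<in> rcosets N" for D
  proof -
    obtain r where r: "r \<in> carrier G" "D = N #> r" using D unfolding RCOSETS_def by auto
    have "r \<in> D" using rcos_self[OF r(1) N.subgroup_axioms] by (simp only: r(2))
    then show ?thesis unfolding rep_def by (rule someI)
  qed
  have rep_G: "rep D \<in> carrier G" if "D \<in> rcosets N" for D
    using rep[OF that] rcosets_part_G[OF N.subgroup_axioms] that by auto
  obtain w where w: "w \<in> carrier G" "\<And>D. D \<in> rcosets N \<Longrightarrow> rep D \<preceq> w"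
    using finite_upper_bound[of "rep ` (rcosets N)"] fin rep_G by auto
  have "z \<preceq> w" if z: "z \<in> carrier G" for z
  proof -
    have D: "N #> z \<in> rcosets N" using rcosetsI[OF N.subset z] .
    have "z \<in> N #> rep (N #> z)"
      using repr_independence[OF rep[OF D] z N.subgroup_axioms] rcos_self[OF z N.subgroup_axioms] by simp
    then obtain n where n: "n \<in> N" "z = n \<otimes> rep (N #> z)" unfolding r_coset_def by auto
    have "n \<otimes> rep (N #> z) \<preceq> rep (N #> z)" using acts_triviallyD(2)[OF triv N n(1) rep_G[OF D]] .
    then show ?thesis using w(2)[OF D] n(2) le_trans by metis
  qed
  then show False using unbounded by blast
qed

lemma (in group) tree_order_has_affine_height:
  assumes "i \<le> k"
    and S: "finite S" "S \<subseteq> carrier G" "generate G S = carrier G"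
    and normal: "\<And>i. i \<le> k \<Longrightarrow> N i \<lhd> G" and incl: "\<And>i. i < k \<Longrightarrow> N i \<subseteq> N (Suc i)"
    and commutators: "\<And>i b c. i < k \<Longrightarrow> b \<in> N (Suc i) \<Longrightarrow> c \<in> N (Suc i) \<Longrightarrow> b \<otimes> c \<otimes> inv b \<otimes> inv c \<in> N i"
    and fin: "finite (rcosets N k)"
    and tree: "tree_order G prec" and triv: "tree_order.acts_trivially G prec (N i)"
  shows "has_affine_height G prec"
  using \<open>i \<le> k\<close> tree triv
proof (induction i arbitrary: prec rule: inc_induct)
  case base
  then show ?case using tree_order.not_acts_trivially_if_finite_index normal fin by blast
next
  case (step n)
  interpret tree_order G prec by (rule step.prems)
  define A where "A = N (Suc n)"
  have A: "A \<lhd> G" using normal step.hyps by (simp add: A_def)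
  interpret A: normal A G by (rule A)
  have commutes: "commutes_on A"
    using step commutators by (intro commutes_onI[OF step.prems(2)] normal A.subset) (auto simp: A_def)
  show ?case
  proof (cases "\<exists>f\<in>A. prec \<one> f \<and> (\<forall>z\<in>carrier G. \<exists>m::nat. prec z (f [^] m))")
    case True
    then obtain f where f: "f \<in> A" "prec \<one> f" "\<And>z. z \<in> carrier G \<Longrightarrow> \<exists>m::nat. prec z (f [^] m)" by auto
    have "hyperbolic_tree_order G prec A f"
      using A commutes f by unfold_locales auto
    then show ?thesis
      using hyperbolic_has_affine_height[OF _ normal incl commutators fin, of "Suc n"] step.hyps A_def by simp
  next
    case not_hyperbolic: False
    show ?thesis
    proof (cases "\<exists>z\<in>carrier G. \<forall>c\<in>A. \<not> prec z c")
      case coarse: True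
      note tree' = tree_order_le_mod[OF A coarse]
      have "has_affine_height G (le_mod A)"
        using step.IH[OF tree'] acts_trivially_le_mod[OF A tree'] by (simp add: A_def)
      then show ?thesis by (rule affine_height_le_mod[OF A])
    next
      case cofinal: False
      interpret elliptic_tree_order G prec A
        using A commutes cofinal not_hyperbolic by unfold_locales auto
      obtain a where a: "a \<in> A" "prec \<one> a" "S \<subseteq> orbit_hull a \<one>"
        using finite_subset_hull[OF S(1,2)] by auto
      interpret leaf_tree_order G prec A S a
        using S a by unfold_locales auto
      have "has_affine_height G leaf_le"
        using step.IH[OF tree_order_leaf_le] acts_trivially_leaf_le by (simp add: A_def)
      then show ?thesis by (rule affine_height_leaf_le)
    qed
  qed
qed

text \<open>
  The core is the kernel of the action of \<open>G\<close> on the finite set of cosets of \<open>H\<close>.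
\<close>

lemma (in group) finite_index_normal_core:
  assumes H: "subgroup H G" and fin: "finite (rcosets H)"
  shows "\<exists>K. K \<lhd> G \<and> K \<subseteq> H \<and> finite (rcosets K)"
proof -
  define K where "K = {g \<in> carrier G. \<forall>D\<in>rcosets H. D #> g = D}"
  have D_G: "D \<subseteq> carrier G" if "D \<in> rcosets H" for D
    using rcosets_part_G[OF H] that by auto
  have D_mult: "(D #> g) #> k = D #> (g \<otimes> k)" if "D \<in> rcosets H" "g \<in> carrier G" "k \<in> carrier G" for D g k
    using coset_mult_assoc[OF D_G] that by simp
  have D_shift: "D #> g \<in> rcosets H" if D: "D \<in> rcosets H" and g: "g \<in> carrier G" for D g
  proof -
    obtain r where r: "r \<in> carrier G" "D = H #> r" using D unfolding RCOSETS_def by auto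
    then have "D #> g = H #> (r \<otimes> g)" using coset_mult_assoc[OF subgroup.subset[OF H]] g by simp
    then show ?thesis using rcosetsI[OF subgroup.subset[OF H], of "r \<otimes> g"] r g by simp
  qed
  have D_one: "D #> \<one> = D" if "D \<in> rcosets H" for D using coset_mult_one[OF D_G[OF that]] .
  have "subgroup K G"
  proof (rule subgroupI)
    show "K \<subseteq> carrier G" by (auto simp: K_def)
    show "K \<noteq> {}" using D_one by (auto simp: K_def)
    show "inv g \<in> K" if g: "g \<in> K" for g
    proof -
      have g_G: "g \<in> carrier G" using g by (simp add: K_def)
      have "D #> inv g = D" if "D \<in> rcosets H" for D
      proof -
        have "D #> g = D" using g that by (simp add: K_def)
        then show ?thesis using D_mult[OF that g_G, of "inv g"] g_G D_one[OF that] by simp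
      qed
      then show ?thesis using g_G by (simp add: K_def)
    qed
    show "g \<otimes> k \<in> K" if "g \<in> K" "k \<in> K" for g k
      using that by (auto simp: K_def simp flip: D_mult)
  qed
  then have normal: "K \<lhd> G"
  proof (rule normal_invI)
    fix x g assume x: "x \<in> carrier G" and g: "g \<in> K"
    have g_G: "g \<in> carrier G" using g by (simp add: K_def)
    have "D #> (x \<otimes> g \<otimes> inv x) = D" if D: "D \<in> rcosets H" for D
    proof -
      have "D #> (x \<otimes> g \<otimes> inv x) = (D #> x) #> g #> inv x"
        using x g_G D D_shift[OF D x] by (simp add: D_mult m_assoc)
      also have "(D #> x) #> g = D #> x" using g D_shift[OF D x] by (simp add: K_def)
      also have "(D #> x) #> inv x = D" using D_mult[OF D x, of "inv x"] x D_one[OF D] by simp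
      finally show ?thesis .
    qed
    then show "x \<otimes> g \<otimes> inv x \<in> K" using x g_G by (simp add: K_def)
  qed
  have "K \<subseteq> H"
  proof
    fix g assume g: "g \<in> K"
    then have g_G: "g \<in> carrier G" by (simp add: K_def)
    have "H #> \<one> = H" using coset_mult_one[OF subgroup.subset[OF H]] .
    then have "H \<in> rcosets H" using rcosetsI[OF subgroup.subset[OF H] one_closed] by simp
    then have "H #> g = H" using g by (simp add: K_def)
    then show "g \<in> H" using rcos_self[OF g_G H] by simp
  qed
  moreover have "finite (rcosets K)"
  proof -
    define \<Phi> where "\<Phi> g = (\<lambda>D\<in>rcosets H. D #> g)" for g
    define pick where "pick p = (SOME g. g \<in> carrier G \<and> \<Phi> g = p)" for p
    have "\<Phi> ` carrier G \<subseteq> (rcosets H) \<rightarrow>\<^sub>E (rcosets H)" using D_shift by (auto simp: \<Phi>_def)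
    then have fin_img: "finite (\<Phi> ` carrier G)" using finite_PiE[OF fin, of "\<lambda>_. rcosets H"] fin finite_subset by blast
    have "K #> g = K #> pick (\<Phi> g)" if g: "g \<in> carrier G" for g
    proof -
      have "\<exists>k. k \<in> carrier G \<and> \<Phi> k = \<Phi> g" using g by blast
      then have "pick (\<Phi> g) \<in> carrier G \<and> \<Phi> (pick (\<Phi> g)) = \<Phi> g" unfolding pick_def by (rule someI_ex)
      then have k: "pick (\<Phi> g) \<in> carrier G" "\<Phi> (pick (\<Phi> g)) = \<Phi> g" by auto
      define k where "k = pick (\<Phi> g)"
      have eq: "D #> k = D #> g" if "D \<in> rcosets H" for D
        using fun_cong[OF k(2), of D] that by (simp add: \<Phi>_def k_def)
      have k_G: "k \<in> carrier G" using k k_def by simp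
      have "D #> (g \<otimes> inv k) = D" if D: "D \<in> rcosets H" for D
      proof -
        have "D #> (g \<otimes> inv k) = (D #> k) #> inv k" using D_mult[OF D g, of "inv k"] eq[OF D] k_G by simp
        then show ?thesis using D_mult[OF D k_G, of "inv k"] D_one[OF D] k_G by simp
      qed
      then have mem: "g \<otimes> inv k \<in> K" using g k_G by (simp add: K_def)
      have "g = (g \<otimes> inv k) \<otimes> k" using g k_G by (simp add: m_assoc)
      then have "g \<in> K #> k" using mem unfolding r_coset_def by blast
      then show ?thesis using repr_independence[OF _ k_G normal_imp_subgroup[OF normal]] k_def by simp
    qed
    then have "rcosets K \<subseteq> (\<lambda>p. K #> pick p) ` (\<Phi> ` carrier G)" unfolding RCOSETS_def by auto
    then show ?thesis using fin_img finite_subset by blast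
  qed
  ultimately show ?thesis using normal by blast
qed

text \<open>
  The derived series of a finite-index normal solvable subgroup, numbered from the bottom; its terms
  are normal in \<open>G\<close> since derived subgroups of normal subgroups are normal.
\<close>

lemma (in group) virtually_solvable_series:
  assumes "virtually_solvable G"
  shows "\<exists>(N :: nat \<Rightarrow> 'a set) k. N 0 = {\<one>} \<and> (\<forall>i\<le>k. N i \<lhd> G) \<and> (\<forall>i<k. N i \<subseteq> N (Suc i)) \<and>
    (\<forall>i<k. \<forall>b\<in>N (Suc i). \<forall>c\<in>N (Suc i). b \<otimes> c \<otimes> inv b \<otimes> inv c \<in> N i) \<and> finite (rcosets N k)"
proof -
  obtain H where H: "subgroup H G" "finite (rcosets H)" "solvable (G\<lparr>carrier := H\<rparr>)"
    using assms unfolding virtually_solvable_def by blast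
  obtain K where K: "K \<lhd> G" "K \<subseteq> H" "finite (rcosets K)" using finite_index_normal_core H by blast
  interpret GH: group "G\<lparr>carrier := H\<rparr>" using subgroup_imp_group[OF H(1)] .
  interpret inj: group_hom "G\<lparr>carrier := H\<rparr>" G id using canonical_inj_is_hom[OF H(1)] by (simp add: id_def)
  obtain n where n: "(derived (G\<lparr>carrier := H\<rparr>) ^^ n) H = {\<one>}"
    using H(3) GH.solvable_iff_trivial_derived_seq by auto
  have "(derived G ^^ n) H = {\<one>}"
    using inj.exp_of_derived_img[of H n] n by simp
  then have trivial: "(derived G ^^ n) K \<subseteq> {\<one>}" using mono_exp_of_derived[OF K(2), of n] by simp
  have normal: "(derived G ^^ i) K \<lhd> G" for i
    by (induction i) (simp_all add: K derived_is_normal)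
  define N where "N i = (derived G ^^ (n - i)) K" for i
  have step: "N i = derived G (N (Suc i))" if "i < n" for i
  proof -
    have "n - i = Suc (n - Suc i)" using that by simp
    then show ?thesis by (simp add: N_def)
  qed
  have "N 0 = {\<one>}"
    using trivial subgroup.one_closed[OF normal_imp_subgroup[OF normal[of n]]] by (auto simp: N_def)
  moreover have "N i \<lhd> G" for i using normal by (simp add: N_def)
  moreover have "N i \<subseteq> N (Suc i)" if "i < n" for i
    unfolding step[OF that] by (rule derived_incl[OF order_refl normal_imp_subgroup]) (simp add: N_def normal)
  moreover have "b \<otimes> c \<otimes> inv b \<otimes> inv c \<in> N i" if "i < n" "b \<in> N (Suc i)" "c \<in> N (Suc i)" for i b c
    unfolding step[OF that(1)] derived_def using that by (intro generate.incl) blast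
  moreover have "finite (rcosets N n)" using K by (simp add: N_def)
  ultimately show ?thesis by (intro exI[of _ N] exI[of _ n]) blast
qed

section \<open>Irreducible actions on the line\<close>

locale irreducible_line_action = group G for G (structure) +
  fixes \<phi> :: "'a \<Rightarrow> real \<Rightarrow> real"
  assumes phi_hom: "\<phi> \<in> hom G Homeo0" and irreducible: "irreducible_action G \<phi>"
begin

lemma phi_strict_mono: "g \<in> carrier G \<Longrightarrow> strict_mono (\<phi> g)"
  using hom_in_carrier[OF phi_hom] by (simp add: Homeo0_def)

lemma phi_mult: "g \<in> carrier G \<Longrightarrow> k \<in> carrier G \<Longrightarrow> \<phi> (g \<otimes> k) x = \<phi> g (\<phi> k x)"
  using hom_mult[OF phi_hom] by (simp add: Homeo0_mult)

lemma phi_one: "\<phi> \<one> x = x"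
  using hom_one[OF phi_hom group_axioms group_Homeo0] by (simp add: Homeo0_def)

lemma phi_le_iff: "g \<in> carrier G \<Longrightarrow> \<phi> g x \<le> \<phi> g y \<longleftrightarrow> x \<le> y"
  using strict_mono_less_eq phi_strict_mono by blast

lemma phi_inv: "g \<in> carrier G \<Longrightarrow> \<phi> g (\<phi> (inv g) x) = x" "g \<in> carrier G \<Longrightarrow> \<phi> (inv g) (\<phi> g x) = x"
  using phi_mult[of g "inv g" x] phi_mult[of "inv g" g x] phi_one by auto

text \<open>
  The supremum of a bounded orbit would be a global fixed point.
\<close>

lemma orbit_unbounded: "\<exists>g\<in>carrier G. r < \<phi> g 0"
proof (rule ccontr)
  assume "\<not> ?thesis"
  then have bound: "\<phi> g 0 \<le> r" if "g \<in> carrier G" for g using that by force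
  define s where "s = (SUP g\<in>carrier G. \<phi> g 0)"
  have bdd: "bdd_above ((\<lambda>g. \<phi> g 0) ` carrier G)" using bound unfolding bdd_above_def by blast
  have le: "s \<le> \<phi> k s" if k: "k \<in> carrier G" for k
    unfolding s_def
  proof (rule cSUP_least)
    show "carrier G \<noteq> {}" using one_closed by blast
    fix g assume g: "g \<in> carrier G"
    have "\<phi> (inv k \<otimes> g) 0 \<le> s" unfolding s_def using g k by (intro cSUP_upper bdd) auto
    then have "\<phi> k (\<phi> (inv k \<otimes> g) 0) \<le> \<phi> k s" using phi_le_iff k by blast
    then show "\<phi> g 0 \<le> \<phi> k (SUP g\<in>carrier G. \<phi> g 0)"
      using g k phi_mult[of k "inv k \<otimes> g" 0] by (simp add: s_def)
  qed
  have "\<phi> k s = s" if k: "k \<in> carrier G" for k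
  proof (rule antisym)
    have "\<phi> k s \<le> \<phi> k (\<phi> (inv k) s)" using le[of "inv k"] phi_le_iff k by auto
    then show "\<phi> k s \<le> s" using phi_inv k by simp
  qed (rule le[OF k])
  then show False using irreducible unfolding irreducible_action_def by blast
qed

definition orbit_le :: "'a \<Rightarrow> 'a \<Rightarrow> bool" where
  "orbit_le x y \<longleftrightarrow> x \<in> carrier G \<and> y \<in> carrier G \<and> \<phi> x 0 \<le> \<phi> y 0"

lemma tree_order_orbit_le: "tree_order G orbit_le"
proof (unfold_locales, goal_cases)
  case (6 x y)
  then show ?case unfolding orbit_le_def by (metis linear order_refl)
next
  case 7
  obtain g where "g \<in> carrier G" "0 < \<phi> g 0" using orbit_unbounded by blast
  then have "\<not> orbit_le g \<one>" by (simp add: orbit_le_def phi_one)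
  then show ?case using \<open>g \<in> carrier G\<close> by blast
qed (auto simp: orbit_le_def phi_mult phi_le_iff)

text \<open>
  The value of the semiconjugacy at \<open>x\<close> is the infimum of the height over the orbit points that
  are not to the left of \<open>x\<close>.
\<close>

lemma semiconjugate_if_has_affine_height:
  assumes "has_affine_height G orbit_le"
  shows "\<exists>\<psi>. \<psi> \<in> hom G Aff \<and> irreducible_action G \<psi> \<and> semiconjugate_near_infinity G \<phi> \<psi>"
proof -
  obtain \<psi> h' where psi: "\<psi> \<in> hom G Aff" "irreducible_action G \<psi>"
    "affine_height G (carrier G) orbit_le (\<lambda>g x. g \<otimes> x) \<psi> h'"
    using assms unfolding has_affine_height_def by blast
  define U where "U x = {g \<in> carrier G. x \<le> \<phi> g 0}" for x
  have "affine_height G UNIV (\<le>) \<phi> \<psi> (\<lambda>x. Inf (h' ` U x))"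
  proof (rule affine_height_Inf[OF psi(1,3)])
    show "\<exists>t\<in>UNIV. \<forall>x\<in>UNIV. t \<le> x \<longrightarrow> U x \<noteq> {}"
    proof -
      have "U x \<noteq> {}" for x using orbit_unbounded[of x] less_imp_le unfolding U_def by blast
      then show ?thesis by blast
    qed
    show "\<exists>t\<in>UNIV. \<forall>x\<in>UNIV. t \<le> x \<longrightarrow> (\<forall>y\<in>U x. y \<in> carrier G \<and> orbit_le s y)" if "s \<in> carrier G" for s
      using that by (intro bexI[of _ "\<phi> s 0"]) (auto simp: U_def orbit_le_def)
    show "\<exists>t\<in>UNIV. \<forall>x\<in>UNIV. t \<le> x \<longrightarrow> U (\<phi> k x) = (\<lambda>y. k \<otimes> y) ` U x" if k: "k \<in> carrier G" for k
    proof -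
      have "U (\<phi> k x) = (\<lambda>y. k \<otimes> y) ` U x" for x
      proof
        show "(\<lambda>y. k \<otimes> y) ` U x \<subseteq> U (\<phi> k x)" using k by (auto simp: U_def phi_mult phi_le_iff)
        show "U (\<phi> k x) \<subseteq> (\<lambda>y. k \<otimes> y) ` U x"
        proof
          fix y assume y: "y \<in> U (\<phi> k x)"
          then have "\<phi> k x \<le> \<phi> k (\<phi> (inv k \<otimes> y) 0)" using k phi_mult[of k "inv k \<otimes> y" 0] by (simp add: U_def)
          then have "inv k \<otimes> y \<in> U x" using y k by (simp add: U_def phi_le_iff)
          then show "y \<in> (\<lambda>y. k \<otimes> y) ` U x" using y k by (intro image_eqI[of _ _ "inv k \<otimes> y"]) (auto simp: U_def)
        qed
      qed
      then show ?thesis by blast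
    qed
    show "\<exists>u\<in>UNIV. s \<le> u \<and> t \<le> u" for s t :: real by (meson UNIV_I max.cobounded1 max.cobounded2)
  qed (auto simp: U_def)
  then have h: "\<exists>t. \<forall>x y. t \<le> x \<longrightarrow> x \<le> y \<longrightarrow> Inf (h' ` U x) \<le> Inf (h' ` U y)"
    "\<And>M. \<exists>t. \<forall>x\<ge>t. M \<le> Inf (h' ` U x)"
    "\<And>k. k \<in> carrier G \<Longrightarrow> \<exists>t. \<forall>x\<ge>t. Inf (h' ` U (\<phi> k x)) = \<psi> k (Inf (h' ` U x))"
    unfolding affine_height_def by auto
  obtain t where t: "\<And>x y. t \<le> x \<Longrightarrow> x \<le> y \<Longrightarrow> Inf (h' ` U x) \<le> Inf (h' ` U y)" using h(1) by blast
  have "semiconjugate_near_infinity G \<phi> \<psi>"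
    unfolding semiconjugate_near_infinity_def
  proof (intro exI[of _ t] exI[of _ "\<lambda>x. Inf (h' ` U x)"] conjI ballI)
    show "mono_on {t<..} (\<lambda>x. Inf (h' ` U x))" using t by (intro mono_onI) auto
    show "filterlim (\<lambda>x. Inf (h' ` U x)) at_top at_top"
      unfolding filterlim_at_top eventually_at_top_linorder using h(2) by blast
    show "\<forall>\<^sub>F x in at_top. \<psi> g (Inf (h' ` U x)) = Inf (h' ` U (\<phi> g x))" if "g \<in> carrier G" for g
      unfolding eventually_at_top_linorder using h(3)[OF that] by metis
  qed
  then show ?thesis using psi by blast
qed

lemma exists_affine_semiconjugacy:
  assumes "finitely_generated_group G" "virtually_solvable G"
  shows "\<exists>\<psi>. \<psi> \<in> hom G Aff \<and> irreducible_action G \<psi> \<and> semiconjugate_near_infinity G \<phi> \<psi>"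
proof (rule semiconjugate_if_has_affine_height)
  interpret T: tree_order G orbit_le by (rule tree_order_orbit_le)
  obtain S where S: "finite S" "S \<subseteq> carrier G" "generate G S = carrier G"
    using assms(1) unfolding finitely_generated_group_def by blast
  obtain N :: "nat \<Rightarrow> 'a set" and k where series: "N 0 = {\<one>} \<and> (\<forall>i\<le>k. N i \<lhd> G) \<and> (\<forall>i<k. N i \<subseteq> N (Suc i)) \<and>
    (\<forall>i<k. \<forall>b\<in>N (Suc i). \<forall>c\<in>N (Suc i). b \<otimes> c \<otimes> inv b \<otimes> inv c \<in> N i) \<and> finite (rcosets N k)"
    using virtually_solvable_series[OF assms(2)] by (elim exE)
  then have N: "N 0 = {\<one>}" "\<And>i. i \<le> k \<Longrightarrow> N i \<lhd> G" "\<And>i. i < k \<Longrightarrow> N i \<subseteq> N (Suc i)"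
    "\<And>i b c. i < k \<Longrightarrow> b \<in> N (Suc i) \<Longrightarrow> c \<in> N (Suc i) \<Longrightarrow> b \<otimes> c \<otimes> inv b \<otimes> inv c \<in> N i"
    "finite (rcosets N k)"
    by simp_all
  have triv: "T.acts_trivially (N 0)" unfolding T.acts_trivially_def N(1) using T.le_refl by simp
  show "has_affine_height G orbit_le"
    by (rule tree_order_has_affine_height[where N = N, OF le0 S _ _ _ N(5) tree_order_orbit_le triv])
      (rule N; assumption)+
qed

end

definition slope :: "(real \<Rightarrow> real) \<Rightarrow> real" where
  "slope f = f 1 - f 0"

locale affine_action = group G for G (structure) +
  fixes \<psi> :: "'a \<Rightarrow> real \<Rightarrow> real"
  assumes psi_hom: "\<psi> \<in> hom G Aff"
begin

definition dilation :: "'a \<Rightarrow> real" where "dilation g = slope (\<psi> g)"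
definition shift :: "'a \<Rightarrow> real" where "shift g = \<psi> g 0"

lemma psi_eq: "g \<in> carrier G \<Longrightarrow> \<psi> g t = dilation g * t + shift g"
  and dilation_pos: "g \<in> carrier G \<Longrightarrow> dilation g > 0"
proof -
  assume g: "g \<in> carrier G"
  obtain p q where "p > 0" "\<psi> g = (\<lambda>x. p * x + q)"
    using hom_in_carrier[OF psi_hom g] unfolding Aff_carrier by blast
  then show "\<psi> g t = dilation g * t + shift g" "dilation g > 0" by (simp_all add: dilation_def shift_def slope_def)
qed

lemma psi_mult: "g \<in> carrier G \<Longrightarrow> k \<in> carrier G \<Longrightarrow> \<psi> (g \<otimes> k) t = \<psi> g (\<psi> k t)"
  using hom_mult[OF psi_hom] by (simp add: Aff_mult)

lemma dilation_mult: "g \<in> carrier G \<Longrightarrow> k \<in> carrier G \<Longrightarrow> dilation (g \<otimes> k) = dilation g * dilation k"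
  and shift_mult: "g \<in> carrier G \<Longrightarrow> k \<in> carrier G \<Longrightarrow> shift (g \<otimes> k) = dilation g * shift k + shift g"
proof -
  assume gk: "g \<in> carrier G" "k \<in> carrier G"
  show shift: "shift (g \<otimes> k) = dilation g * shift k + shift g"
    using psi_mult[OF gk, of 0] psi_eq gk by (simp add: psi_eq algebra_simps)
  show "dilation (g \<otimes> k) = dilation g * dilation k"
    using psi_mult[OF gk, of 1] psi_eq gk shift by (simp add: algebra_simps)
qed

lemma dilation_one [simp]: "dilation \<one> = 1"
  using dilation_mult[of \<one> \<one>] dilation_pos[of \<one>] by simp

lemma shift_one [simp]: "shift \<one> = 0"
  using shift_mult[of \<one> \<one>] by simp

lemma dilation_inv: "g \<in> carrier G \<Longrightarrow> dilation (inv g) = 1 / dilation g"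
  using dilation_mult[of g "inv g"] dilation_pos[of g] by (simp add: field_simps)

lemma shift_inv: "g \<in> carrier G \<Longrightarrow> shift (inv g) = - shift g / dilation g"
  using shift_mult[of g "inv g"] dilation_pos[of g] by (simp add: field_simps)

lemma dilation_conj: "g \<in> carrier G \<Longrightarrow> k \<in> carrier G \<Longrightarrow> dilation (g \<otimes> k \<otimes> inv g) = dilation k"
  using dilation_pos[of g] by (simp add: dilation_mult dilation_inv)

lemma shift_conj: "g \<in> carrier G \<Longrightarrow> k \<in> carrier G \<Longrightarrow> dilation k = 1 \<Longrightarrow> shift (g \<otimes> k \<otimes> inv g) = dilation g * shift k"
  using dilation_pos[of g] by (simp add: dilation_mult shift_mult shift_inv)

lemma dilation_commutator: "g \<in> carrier G \<Longrightarrow> k \<in> carrier G \<Longrightarrow> dilation (g \<otimes> k \<otimes> inv g \<otimes> inv k) = 1"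
  using dilation_pos[of g] dilation_pos[of k] by (simp add: dilation_mult dilation_inv)

lemma shift_commutator:
  assumes "g \<in> carrier G" "k \<in> carrier G"
  shows "shift (g \<otimes> k \<otimes> inv g \<otimes> inv k) = (1 - dilation k) * shift g - (1 - dilation g) * shift k"
  using assms dilation_pos[of g] dilation_pos[of k] by (simp add: dilation_mult dilation_inv shift_mult shift_inv field_simps)

lemma translation_pow:
  assumes "c \<in> carrier G" "dilation c = 1"
  shows "dilation (c [^] (n::int)) = 1" "shift (c [^] n) = of_int n * shift c"
proof -
  have nat: "dilation (c [^] n) = 1 \<and> shift (c [^] n) = of_nat n * shift c" for n :: nat
    by (induction n) (use assms in \<open>simp_all add: dilation_mult shift_mult algebra_simps\<close>)
  have "dilation (c [^] n) = 1 \<and> shift (c [^] n) = of_int n * shift c"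
  proof (cases n rule: int_cases2)
    case (nonneg m)
    then show ?thesis using nat[of m] by (simp add: int_pow_int)
  next
    case (nonpos m)
    then show ?thesis using nat[of m] assms by (simp add: int_pow_neg_int dilation_inv shift_inv)
  qed
  then show "dilation (c [^] n) = 1" "shift (c [^] n) = of_int n * shift c" by auto
qed

text \<open>
  Equivalently, \<open>\<psi> g t > t\<close> for all sufficiently large \<open>t\<close>.
\<close>

definition up :: "'a \<Rightarrow> bool" where
  "up g \<longleftrightarrow> dilation g > 1 \<or> (dilation g = 1 \<and> shift g > 0)"

text \<open>
  If all these commutators were trivial, then \<open>G\<close> would preserve the fixed point of \<open>\<psi> k\<close>.
\<close>

lemma commutator_translates:
  assumes irr: "irreducible_action G \<psi>" and k: "k \<in> carrier G" "dilation k \<noteq> 1"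
  shows "\<exists>g\<in>carrier G. shift (g \<otimes> k \<otimes> inv g \<otimes> inv k) \<noteq> 0"
proof (rule ccontr)
  assume "\<not> ?thesis"
  then have *: "(1 - dilation k) * shift g = (1 - dilation g) * shift k" if "g \<in> carrier G" for g
    using shift_commutator[OF that k(1)] that by simp
  have "\<psi> g (shift k / (1 - dilation k)) = shift k / (1 - dilation k)" if "g \<in> carrier G" for g
    using *[OF that] k psi_eq[OF that] by (simp add: field_simps)
  then show False using irr unfolding irreducible_action_def by blast
qed

end

locale order_equivalent_actions =
  A: affine_action G \<psi> + B: affine_action G \<psi>' for G (structure) and \<psi> \<psi>' +
  assumes up_iff: "g \<in> carrier G \<Longrightarrow> A.up g \<longleftrightarrow> B.up g"
begin

text \<open>
  A dilation dominates all powers of the translation \<open>d\<close> at infinity, but a translation does not.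
\<close>

lemma slope_one_transfer:
  assumes d: "d \<in> carrier G" "A.dilation d = 1" "B.dilation d = 1" "A.shift d > 0"
    and g: "g \<in> carrier G" "A.dilation g = 1"
  shows "\<not> B.dilation g > 1"
proof
  assume gt: "B.dilation g > 1"
  obtain n :: nat where "A.shift g < of_nat n * A.shift d" using reals_Archimedean3[OF d(4)] by blast
  then have "\<not> A.up (g \<otimes> d [^] (- int n))"
    using d g A.translation_pow[OF d(1,2), of "- int n"] by (simp add: A.up_def A.dilation_mult A.shift_mult)
  moreover have "B.up (g \<otimes> d [^] (- int n))"
    using d g gt B.translation_pow[OF d(1,3), of "- int n"] by (simp add: B.up_def B.dilation_mult)
  ultimately show False using up_iff d g by simp
qed

lemma slope_one_imp:
  assumes d: "d \<in> carrier G" "A.dilation d = 1" "B.dilation d = 1" "A.shift d > 0"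
    and g: "g \<in> carrier G" "A.dilation g = 1"
  shows "B.dilation g = 1"
proof -
  have "A.dilation (inv g) = 1" using g by (simp add: A.dilation_inv)
  then have "\<not> B.dilation (inv g) > 1" using slope_one_transfer[OF d, of "inv g"] g by simp
  moreover have "\<not> B.dilation g > 1" using slope_one_transfer[OF d g] .
  ultimately show ?thesis using g B.dilation_pos[OF g(1)] by (simp add: B.dilation_inv field_simps)
qed

text \<open>
  Rational numbers between the two ratios would give a product of powers of \<open>c\<close> and \<open>d\<close> that moves
  upwards for one action and downwards for the other.
\<close>

lemma translation_ratio_le:
  assumes d: "d \<in> carrier G" "A.dilation d = 1" "B.dilation d = 1" "A.shift d > 0" "B.shift d > 0"
    and c: "c \<in> carrier G" "A.dilation c = 1" "B.dilation c = 1"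
  shows "A.shift c / A.shift d \<le> B.shift c / B.shift d"
proof (rule ccontr)
  assume "\<not> ?thesis"
  then have "B.shift c / B.shift d < A.shift c / A.shift d" by simp
  then obtain r where r: "r \<in> \<rat>" "B.shift c / B.shift d < r" "r < A.shift c / A.shift d" using Rats_dense_in_real by blast
  then obtain p :: int and q :: nat where pq: "q > 0" "r = of_int p / of_nat q"
    unfolding Rats_eq_int_div_nat by blast
  define x where "x = c [^] (int q) \<otimes> d [^] (- p)"
  have x: "x \<in> carrier G" using c d by (simp add: x_def)
  have "A.dilation x = 1" "A.shift x = of_nat q * A.shift c - of_int p * A.shift d"
    using A.translation_pow[OF c(1,2), of "int q"] A.translation_pow[OF d(1,2), of "- p"] c d
    by (simp_all add: x_def A.dilation_mult A.shift_mult)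
  moreover have "of_nat q * A.shift c - of_int p * A.shift d > 0" using r pq d by (simp add: field_simps)
  ultimately have "A.up x" by (simp add: A.up_def)
  have "B.dilation x = 1" "B.shift x = of_nat q * B.shift c - of_int p * B.shift d"
    using B.translation_pow[OF c(1,3), of "int q"] B.translation_pow[OF d(1,3), of "- p"] c d
    by (simp_all add: x_def B.dilation_mult B.shift_mult)
  moreover have "of_nat q * B.shift c - of_int p * B.shift d < 0" using r pq d by (simp add: field_simps)
  ultimately have "\<not> B.up x" by (simp add: B.up_def)
  then show False using \<open>A.up x\<close> up_iff x by simp
qed

end

lemma (in order_equivalent_actions) swap_actions: "order_equivalent_actions G \<psi>' \<psi>"
  by unfold_locales (use up_iff in auto)

lemma affine_conjugateI:
  assumes psi: "affine_action G \<psi>" "affine_action G \<psi>'" and r: "r > 0"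
    and eq: "\<And>g t. g \<in> carrier G \<Longrightarrow> \<psi>' g (r * t + s) = r * \<psi> g t + s"
  shows "affine_conjugate G \<psi> \<psi>'"
proof -
  interpret Aff: group Aff by (rule group_Aff)
  interpret A: affine_action G \<psi> by fact
  define f where "f = (\<lambda>t. r * t + s)"
  have f: "f \<in> carrier Aff" unfolding Aff_carrier f_def using r by blast
  have f': "f \<circ> inv\<^bsub>Aff\<^esub> f = id"
    using Aff.r_inv[OF f] by (simp add: Aff_mult Aff_one)
  have "\<psi>' g = f \<otimes>\<^bsub>Aff\<^esub> \<psi> g \<otimes>\<^bsub>Aff\<^esub> inv\<^bsub>Aff\<^esub> f" if g: "g \<in> carrier G" for g
  proof -
    have "\<psi>' g \<circ> f = f \<circ> \<psi> g" using eq[OF g] by (auto simp: f_def)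
    then have "\<psi>' g \<circ> (f \<circ> inv\<^bsub>Aff\<^esub> f) = f \<circ> \<psi> g \<circ> inv\<^bsub>Aff\<^esub> f" by (simp add: comp_assoc [symmetric])
    then show ?thesis by (simp add: f' Aff_mult)
  qed
  then show ?thesis unfolding affine_conjugate_def using f by blast
qed

context order_equivalent_actions
begin

text \<open>
  If one of the actions contains a dilation, a commutator is a translation for both actions and
  nontrivial for that one. Otherwise all elements are translations for both actions.
\<close>

lemma common_translation:
  assumes irr: "irreducible_action G \<psi>" "irreducible_action G \<psi>'"
  shows "\<exists>d\<in>carrier G. A.dilation d = 1 \<and> B.dilation d = 1 \<and> A.shift d > 0 \<and> B.shift d > 0"
proof -
  have sign: "A.shift d > 0 \<longleftrightarrow> B.shift d > 0" if "d \<in> carrier G" "A.dilation d = 1" "B.dilation d = 1" for d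
    using up_iff[OF that(1)] that by (simp add: A.up_def B.up_def)
  have "\<exists>d\<in>carrier G. A.dilation d = 1 \<and> B.dilation d = 1 \<and> (A.shift d \<noteq> 0 \<or> B.shift d \<noteq> 0)"
  proof (cases "\<exists>k\<in>carrier G. A.dilation k \<noteq> 1 \<or> B.dilation k \<noteq> 1")
    case True
    then obtain k where k: "k \<in> carrier G" "A.dilation k \<noteq> 1 \<or> B.dilation k \<noteq> 1" by blast
    then obtain g where g: "g \<in> carrier G"
      "A.shift (g \<otimes> k \<otimes> inv g \<otimes> inv k) \<noteq> 0 \<or> B.shift (g \<otimes> k \<otimes> inv g \<otimes> inv k) \<noteq> 0"
      using A.commutator_translates[OF irr(1)] B.commutator_translates[OF irr(2)] by blast
    then show ?thesis using k A.dilation_commutator B.dilation_commutator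
      by (intro bexI[of _ "g \<otimes> k \<otimes> inv g \<otimes> inv k"]) auto
  next
    case False
    obtain g where g: "g \<in> carrier G" "\<psi> g 0 \<noteq> 0"
      using irr(1) unfolding irreducible_action_def by blast
    then show ?thesis using False by (intro bexI[of _ g]) (auto simp: A.shift_def)
  qed
  then obtain d where d: "d \<in> carrier G" "A.dilation d = 1" "B.dilation d = 1" "A.shift d \<noteq> 0 \<or> B.shift d \<noteq> 0" by blast
  show ?thesis
  proof (cases "A.shift d > 0")
    case True
    then show ?thesis using d sign by blast
  next
    case False
    have inv: "A.dilation (inv d) = 1" "B.dilation (inv d) = 1" "A.shift (inv d) = - A.shift d" "B.shift (inv d) = - B.shift d"
      using d by (simp_all add: A.dilation_inv B.dilation_inv A.shift_inv B.shift_inv)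
    have "A.shift (inv d) > 0 \<or> B.shift (inv d) > 0" using False sign[of d] d inv by auto
    then show ?thesis using sign[of "inv d"] inv d by (intro bexI[of _ "inv d"]) auto
  qed
qed

text \<open>
  In suitable affine coordinates the two cocycles agree: \<open>r\<close> rescales translations, and the
  commutator formula shows that \<open>B.shift - r * A.shift\<close> is proportional to \<open>1 - A.dilation\<close>, with the
  factor \<open>s\<close>.
\<close>

lemma affine_conjugate_actions:
  assumes irr: "irreducible_action G \<psi>" "irreducible_action G \<psi>'"
  shows "affine_conjugate G \<psi> \<psi>'"
proof -
  interpret S: order_equivalent_actions G \<psi>' \<psi> by (rule swap_actions)
  obtain d where d: "d \<in> carrier G" "A.dilation d = 1" "B.dilation d = 1" "A.shift d > 0" "B.shift d > 0"
    using common_translation[OF irr] by blast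
  have dilation_iff: "A.dilation g = 1 \<longleftrightarrow> B.dilation g = 1" if "g \<in> carrier G" for g
    using slope_one_imp[OF d(1-4) that] S.slope_one_imp[OF d(1,3,2,5) that] by blast
  define r where "r = B.shift d / A.shift d"
  have r: "r > 0" using d by (simp add: r_def)
  have shift_T: "B.shift c = r * A.shift c" if "c \<in> carrier G" "A.dilation c = 1" for c
    using translation_ratio_le[OF d that] S.translation_ratio_le[OF d(1,3,2,5,4) that(1) _ that(2)] dilation_iff that d
    by (simp add: r_def field_simps)
  have dilation_eq: "B.dilation g = A.dilation g" if g: "g \<in> carrier G" for g
  proof -
    have "B.shift (g \<otimes> d \<otimes> inv g) = r * A.shift (g \<otimes> d \<otimes> inv g)"
      using g d by (intro shift_T) (auto simp: A.dilation_conj)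
    then have "B.dilation g * B.shift d = A.dilation g * (r * A.shift d)" using g d by (simp add: A.shift_conj B.shift_conj)
    then show ?thesis using d by (simp add: r_def)
  qed
  obtain s where s: "\<And>g. g \<in> carrier G \<Longrightarrow> B.shift g = r * A.shift g + s * (1 - A.dilation g)"
  proof (cases "\<exists>k\<in>carrier G. A.dilation k \<noteq> 1")
    case True
    then obtain k where k: "k \<in> carrier G" "A.dilation k \<noteq> 1" by blast
    have "B.shift g = r * A.shift g + ((B.shift k - r * A.shift k) / (1 - A.dilation k)) * (1 - A.dilation g)" if g: "g \<in> carrier G" for g
    proof -
      have "B.shift (g \<otimes> k \<otimes> inv g \<otimes> inv k) = r * A.shift (g \<otimes> k \<otimes> inv g \<otimes> inv k)"
        using g k by (intro shift_T) (auto simp: A.dilation_commutator)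
      then have "(1 - A.dilation k) * B.shift g - (1 - A.dilation g) * B.shift k = r * ((1 - A.dilation k) * A.shift g - (1 - A.dilation g) * A.shift k)"
        using g k by (simp add: A.shift_commutator B.shift_commutator dilation_eq)
      then have "(1 - A.dilation k) * (B.shift g - r * A.shift g) = (1 - A.dilation g) * (B.shift k - r * A.shift k)"
        by (simp add: algebra_simps)
      then have "B.shift g - r * A.shift g = (1 - A.dilation g) * (B.shift k - r * A.shift k) / (1 - A.dilation k)"
        using k by (simp add: eq_divide_eq mult.commute)
      then show ?thesis by (simp add: mult.commute)
    qed
    then show ?thesis using that by blast
  next
    case False
    then show ?thesis using shift_T that[of 0] by auto
  qed
  show ?thesis
  proof (rule affine_conjugateI[OF A.affine_action_axioms B.affine_action_axioms r])
    show "\<psi>' g (r * t + s) = r * \<psi> g t + s" if "g \<in> carrier G" for g t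
      using that s[OF that] dilation_eq[OF that] by (simp add: A.psi_eq B.psi_eq algebra_simps)
  qed
qed

end

section \<open>Uniqueness\<close>

context irreducible_line_action
begin

lemma phi_filterlim: assumes c: "c \<in> carrier G" shows "filterlim (\<phi> c) at_top at_top"
  unfolding filterlim_at_top eventually_at_top_linorder
proof (intro allI exI impI)
  fix Z x :: real assume "\<phi> (inv c) Z \<le> x"
  then have "\<phi> c (\<phi> (inv c) Z) \<le> \<phi> c x" using phi_le_iff c by blast
  then show "Z \<le> \<phi> c x" using phi_inv c by simp
qed

text \<open>
  If \<open>c\<close> moves upwards for \<open>\<psi>'\<close>, then \<open>h'\<close> grows by a definite amount along each orbit of
  \<open>\<phi> c\<close> that starts high enough, so these orbits tend to \<open>+\<infinity>\<close>. If \<open>c\<close> did not move upwards for \<open>\<psi>\<close>,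
  then \<open>h\<close> would stay bounded along them, although \<open>h\<close> tends to \<open>+\<infinity>\<close>.
\<close>

lemma up_transfer:
  assumes psi: "\<psi> \<in> hom G Aff" "\<psi>' \<in> hom G Aff"
    and semi: "semiconjugate_near_infinity G \<phi> \<psi>" "semiconjugate_near_infinity G \<phi> \<psi>'"
    and c: "c \<in> carrier G" and up: "affine_action.up \<psi>' c"
  shows "affine_action.up \<psi> c"
proof (rule ccontr)
  interpret A: affine_action G \<psi> by unfold_locales (rule psi)
  interpret B: affine_action G \<psi>' by unfold_locales (rule psi)
  assume not_up: "\<not> A.up c"
  obtain a h where h: "mono_on {a<..} h" "filterlim h at_top at_top"
    "\<And>g. g \<in> carrier G \<Longrightarrow> \<forall>\<^sub>F x in at_top. \<psi> g (h x) = h (\<phi> g x)"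
    using semi(1) unfolding semiconjugate_near_infinity_def by blast
  obtain a' h' where h': "mono_on {a'<..} h'" "filterlim h' at_top at_top"
    "\<And>g. g \<in> carrier G \<Longrightarrow> \<forall>\<^sub>F x in at_top. \<psi>' g (h' x) = h' (\<phi> g x)"
    using semi(2) unfolding semiconjugate_near_infinity_def by blast
  have "\<exists>T. \<forall>t\<ge>T. \<psi> c t \<le> t"
  proof (cases "A.dilation c = 1")
    case True
    then have "\<forall>t\<ge>0. \<psi> c t \<le> t" using not_up A.psi_eq[OF c] by (simp add: A.up_def)
    then show ?thesis by blast
  next
    case False
    then have "A.dilation c < 1" using not_up by (auto simp: A.up_def)
    then have "\<forall>t\<ge>A.shift c / (1 - A.dilation c). \<psi> c t \<le> t"
      using A.psi_eq[OF c] by (simp add: field_simps)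
    then show ?thesis by blast
  qed
  then obtain T where T: "\<And>t. T \<le> t \<Longrightarrow> \<psi> c t \<le> t" by blast
  have "\<exists>T d. d > 0 \<and> (\<forall>t\<ge>T. t + d \<le> \<psi>' c t)"
  proof (cases "B.dilation c = 1")
    case True
    then have "B.shift c > 0" "\<forall>t\<ge>0. t + B.shift c \<le> \<psi>' c t" using up B.psi_eq[OF c] by (simp_all add: B.up_def)
    then show ?thesis by blast
  next
    case False
    then have "B.dilation c > 1" using up by (auto simp: B.up_def)
    then have "\<forall>t\<ge>(1 - B.shift c) / (B.dilation c - 1). t + 1 \<le> \<psi>' c t"
      using B.psi_eq[OF c] by (simp add: field_simps)
    then show ?thesis using zero_less_one by blast
  qed
  then obtain T' d where T': "d > 0" "\<And>t. T' \<le> t \<Longrightarrow> t + d \<le> \<psi>' c t" by blast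
  have "\<forall>\<^sub>F x in at_top. T \<le> h x" "\<forall>\<^sub>F x in at_top. T' \<le> h' x"
    using h(2) h'(2) unfolding filterlim_at_top by auto
  moreover have "\<forall>\<^sub>F x in at_top. a' < \<phi> c x"
    using phi_filterlim[OF c] unfolding filterlim_at_top_dense by blast
  ultimately have "\<forall>\<^sub>F x in at_top. \<psi> c (h x) = h (\<phi> c x) \<and> \<psi>' c (h' x) = h' (\<phi> c x) \<and>
      T \<le> h x \<and> T' \<le> h' x \<and> a' < x \<and> a' < \<phi> c x"
    using h(3)[OF c] h'(3)[OF c] by (intro eventually_conj eventually_gt_at_top)
  then obtain X where X: "\<And>x. X \<le> x \<Longrightarrow> \<psi> c (h x) = h (\<phi> c x) \<and> \<psi>' c (h' x) = h' (\<phi> c x) \<and>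
      T \<le> h x \<and> T' \<le> h' x \<and> a' < x \<and> a' < \<phi> c x"
    unfolding eventually_at_top_linorder by blast
  have step: "h' x + d \<le> h' (\<phi> c x)" "h (\<phi> c x) \<le> h x" "X \<le> \<phi> c x" if x: "X \<le> x" for x
  proof -
    show 1: "h' x + d \<le> h' (\<phi> c x)" using X[OF x] T'(2)[of "h' x"] by simp
    show "h (\<phi> c x) \<le> h x" using X[OF x] T[of "h x"] by simp
    have "\<not> \<phi> c x < x"
      using mono_onD[OF h'(1), of "\<phi> c x" x] X[OF x] 1 T'(1) by auto
    then show "X \<le> \<phi> c x" using x by simp
  qed
  have iter: "X \<le> (\<phi> c ^^ n) X \<and> h' X + of_nat n * d \<le> h' ((\<phi> c ^^ n) X) \<and> h ((\<phi> c ^^ n) X) \<le> h X" for n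
  proof (induction n)
    case (Suc n)
    then show ?case using step[of "(\<phi> c ^^ n) X"] by (simp add: algebra_simps)
  qed simp
  obtain R where R: "\<And>x. R \<le> x \<Longrightarrow> h X + 1 \<le> h x"
    using h(2) unfolding filterlim_at_top eventually_at_top_linorder by blast
  define R' where "R' = max R X"
  obtain n :: nat where n: "h' R' - h' X < of_nat n * d" using reals_Archimedean3[OF T'(1)] by blast
  define y where "y = (\<phi> c ^^ n) X"
  have y: "X \<le> y" "h' R' < h' y" "h y \<le> h X" using iter[of n] n unfolding y_def by auto
  have "a' < R'" "a' < y" using X[of X] X[of y] y by (auto simp: R'_def)
  then have "\<not> y < R'" using mono_onD[OF h'(1), of y R'] y by auto
  then have "R \<le> y" by (simp add: R'_def)
  then show False using R[of y] y by simp
qed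

lemma affine_semiconjugacy_unique:
  assumes psi: "\<psi> \<in> hom G Aff" "\<psi>' \<in> hom G Aff"
    and irr: "irreducible_action G \<psi>" "irreducible_action G \<psi>'"
    and semi: "semiconjugate_near_infinity G \<phi> \<psi>" "semiconjugate_near_infinity G \<phi> \<psi>'"
  shows "affine_conjugate G \<psi> \<psi>'"
proof -
  interpret order_equivalent_actions G \<psi> \<psi>'
    by unfold_locales (use psi up_transfer[OF psi semi] up_transfer[OF psi(2,1) semi(2,1)] in auto)
  show ?thesis by (rule affine_conjugate_actions[OF irr])
qed

end

theorem theorem2:
  fixes G :: "('g, 'm) monoid_scheme" and \<phi> :: "'g \<Rightarrow> real \<Rightarrow> real"
  assumes "group G"
    and "finitely_generated_group G"
    and "virtually_solvable G"
    and "\<phi> \<in> hom G Homeo0"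
    and "irreducible_action G \<phi>"
  shows "(\<exists>\<psi>. \<psi> \<in> hom G Aff \<and> irreducible_action G \<psi> \<and> semiconjugate_near_infinity G \<phi> \<psi>) \<and>
         (\<forall>\<psi> \<psi>'. \<psi> \<in> hom G Aff \<longrightarrow> irreducible_action G \<psi> \<longrightarrow> semiconjugate_near_infinity G \<phi> \<psi> \<longrightarrow>
                 \<psi>' \<in> hom G Aff \<longrightarrow> irreducible_action G \<psi>' \<longrightarrow> semiconjugate_near_infinity G \<phi> \<psi>' \<longrightarrow>
                 affine_conjugate G \<psi> \<psi>')"
proof -
  interpret irreducible_line_action G \<phi>
    using assms unfolding irreducible_line_action_def irreducible_line_action_axioms_def by simp
  show ?thesis
    using exists_affine_semiconjugacy[OF assms(2,3)] affine_semiconjugacy_unique by blast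
qed

end
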